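(* Let $\mu$ be a (complex) pluriharmonic measure on $\mathrm{b}D$, and let $m$ be the dimension of the real analytic manifold $\mathrm{b}D$. Then $\mu$ is absolutely continuous with respect to the Hausdorff measure $\mathcal{H}^{m-1}$ on $\mathrm{b}D$; that is, every $\mathcal{H}^{m-1}$-negligible subset of $\mathrm{b}D$ is $\mu$-negligible.
   Context: Setting. $D\subseteq\mathbb{C}^n$ is a bounded symmetric domain (a bounded connected open set such that for every $z\in D$ there is a holomorphic involution of $D$ having $z$ as an isolated fixed point) which is convex and circular ($\alpha z\in D$ for all $z\in D$ and $\alpha\in\mathbb{C}$ with $|\alpha|=1$). $\mathrm{b}D$ is the Silov boundary of $D$: the smallest closed subset of $\partial D$ such that $\sup_D|f|=\max_{\mathrm{b}D}|f|$ for every holomorphic $f$ on $D$ extending continuously to the closure $\overline{D}$; it is a compact real analytic submanifold of $\mathbb{C}^n$. $K$ is the compact group of linear automorphisms of $D$; it acts transitively on $\mathrm{b}D$, and it is assumed that $K\subseteq U(n)$ and that $\mathrm{b}D$ is contained in the Euclidean unit sphere. $\beta$ is the unique $K$-invariant probability measure on $\mathrm{b}D$. Measures are complex Radon measures. The Hausdorff measure $\mathcal{H}^{m-1}$ is taken with respect to the distance on $\mathrm{b}D$ induced by the Euclidean distance. Kernels. The Hardy space $H^2(D)$ is the space of holomorphic $f$ on $D$ with $\|f\|^2=\sup_{0\le\rho<1}\int_{\mathrm{b}D}|f(\rho\zeta)|^2\,\mathrm{d}\beta(\zeta)<\infty$; $\mathcal{C}$ is its reproducing kernel, which extends to a sesqui-holomorphic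 function on a neighbourhood of $D\times\overline{D}$. The Poisson–Szegő kernel is $\mathcal{P}(z,\zeta)=|\mathcal{C}(z,\zeta)|^2/\mathcal{C}(z,z)$ for $z\in D$, $\zeta\in\mathrm{b}D$, and $(\mathcal{P}\mu)(z)=\int_{\mathrm{b}D}\mathcal{P}(z,\zeta)\,\mathrm{d}\mu(\zeta)$. A measure $\mu$ on $\mathrm{b}D$ is pluriharmonic if the function $\mathcal{P}\mu$ is pluriharmonic on $D$, i.e. harmonic on the intersection of $D$ with every complex line. *)

theory Defs
  imports "HOL-Analysis.Analysis"
begin

section \<open>Holomorphic functions and bounded symmetric domains in complex n-space\<close>

text \<open>Both notions are meant for open sets: Frechet differentiability with complex linear derivative.\<close>

definition hol_on :: "(complex^'n \<Rightarrow> complex) \<Rightarrow> (complex^'n) set \<Rightarrow> bool" where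
  "hol_on f S \<longleftrightarrow>
     (\<forall>z\<in>S. \<exists>L. Vector_Spaces.linear (*s) (*) L \<and> (f has_derivative L) (at z))"

definition hol_map_on :: "(complex^'n \<Rightarrow> complex^'n) \<Rightarrow> (complex^'n) set \<Rightarrow> bool" where
  "hol_map_on \<phi> S \<longleftrightarrow> (\<forall>i. hol_on (\<lambda>z. \<phi> z $ i) S)"

definition bounded_symmetric_domain :: "(complex^'n) set \<Rightarrow> bool" where
  "bounded_symmetric_domain D \<longleftrightarrow>
     D \<noteq> {} \<and> open D \<and> connected D \<and> bounded D \<and>
     (\<forall>z\<in>D. \<exists>\<phi>. hol_map_on \<phi> D \<and> \<phi> ` D \<subseteq> D \<and> (\<forall>w\<in>D. \<phi> (\<phi> w) = w) \<and> \<phi> z = z \<and>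
        (\<exists>r>0. \<forall>w\<in>D \<inter> ball z r. \<phi> w = w \<longrightarrow> w = z))"

definition circular :: "(complex^'n) set \<Rightarrow> bool" where
  "circular D \<longleftrightarrow> (\<forall>z\<in>D. \<forall>\<alpha>. cmod \<alpha> = 1 \<longrightarrow> \<alpha> *s z \<in> D)"

definition has_max_modulus_property :: "(complex^'n) set \<Rightarrow> (complex^'n) set \<Rightarrow> bool" where
  "has_max_modulus_property D B \<longleftrightarrow>
     (\<forall>f. continuous_on (closure D) f \<and> hol_on f D \<longrightarrow>
        (\<exists>\<zeta>\<in>B. cmod (f \<zeta>) = (SUP z\<in>D. cmod (f z)) \<and> (\<forall>\<xi>\<in>B. cmod (f \<xi>) \<le> cmod (f \<zeta>))))"

definition is_silov_boundary :: "(complex^'n) set \<Rightarrow> (complex^'n) set \<Rightarrow> bool" where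
  "is_silov_boundary D B \<longleftrightarrow>
     closed B \<and> B \<subseteq> frontier D \<and> has_max_modulus_property D B \<and>
     (\<forall>B'. closed B' \<and> B' \<subseteq> frontier D \<and> has_max_modulus_property D B' \<longrightarrow> B \<subseteq> B')"

definition linear_automorphisms :: "(complex^'n) set \<Rightarrow> (complex^'n \<Rightarrow> complex^'n) set" where
  "linear_automorphisms D = {T. Vector_Spaces.linear (*s) (*s) T \<and> bij T \<and> T ` D = D}"

definition hermitian_inner :: "complex^'n \<Rightarrow> complex^'n \<Rightarrow> complex" where
  "hermitian_inner x y = (\<Sum>i\<in>UNIV. x $ i * cnj (y $ i))"

definition unitary_maps :: "(complex^'n \<Rightarrow> complex^'n) set" where
  "unitary_maps = {T. Vector_Spaces.linear (*s) (*s) T \<and>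
     (\<forall>x y. hermitian_inner (T x) (T y) = hermitian_inner x y)}"

definition borel_on :: "'a::topological_space set \<Rightarrow> 'a measure" where
  "borel_on B = restrict_space borel B"

definition is_invariant_probability ::
    "(complex^'n) set \<Rightarrow> (complex^'n) set \<Rightarrow> (complex^'n) measure \<Rightarrow> bool" where
  "is_invariant_probability D B \<beta> \<longleftrightarrow>
     sets \<beta> = sets (borel_on B) \<and> emeasure \<beta> (space \<beta>) = 1 \<and>
     (\<forall>T\<in>linear_automorphisms D. distr \<beta> (borel_on B) T = \<beta>)"

definition is_unique_invariant_probability ::
    "(complex^'n) set \<Rightarrow> (complex^'n) set \<Rightarrow> (complex^'n) measure \<Rightarrow> bool" where
  "is_unique_invariant_probability D B \<beta> \<longleftrightarrow>
     is_invariant_probability D B \<beta> \<and> (\<forall>\<beta>'. is_invariant_probability D B \<beta>' \<longrightarrow> \<beta>' = \<beta>)"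

section \<open>Real analytic submanifolds\<close>

text \<open>A multi-index is an extensional function from \<open>Basis\<close> to the naturals.\<close>

definition real_analytic_on ::
    "('a::euclidean_space \<Rightarrow> 'b::euclidean_space) \<Rightarrow> 'a set \<Rightarrow> bool" where
  "real_analytic_on f U \<longleftrightarrow>
     (\<forall>p\<in>U. \<exists>r>0. \<exists>c :: ('a \<Rightarrow> nat) \<Rightarrow> 'b. \<forall>x\<in>ball p r.
        ((\<lambda>\<alpha>. (\<Prod>b\<in>Basis. ((x - p) \<bullet> b) ^ \<alpha> b) *\<^sub>R c \<alpha>) has_sum f x)
          (Basis \<rightarrow>\<^sub>E UNIV))"

text \<open>Embedded submanifolds of dimension \<open>m\<close>, described by slice charts of the ambient space.\<close>

definition real_analytic_submanifold :: "nat \<Rightarrow> 'a::euclidean_space set \<Rightarrow> bool" where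
  "real_analytic_submanifold m M \<longleftrightarrow>
     (\<forall>p\<in>M. \<exists>U V \<Phi> \<Psi>. \<exists>L :: 'a set.
        open U \<and> p \<in> U \<and> open V \<and> homeomorphism U V \<Phi> \<Psi> \<and>
        real_analytic_on \<Phi> U \<and> real_analytic_on \<Psi> V \<and>
        subspace L \<and> dim L = m \<and> \<Phi> ` (U \<inter> M) = V \<inter> L)"

section \<open>Hausdorff measure\<close>

text \<open>
  The Hausdorff outer measure of integer dimension \<open>k\<close>, without normalising constant. For
  \<open>E \<subseteq> B\<close> the covering sets may be intersected with \<open>B\<close>, so the value is the one computed in
  the metric space \<open>B\<close>. The empty set needs a separate clause because \<open>0 ^ 0 = 1\<close>.
\<close>

definition diam_pow :: "nat \<Rightarrow> 'a::metric_space set \<Rightarrow> ennreal" where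
  "diam_pow k U = (if U = {} then 0 else ennreal (diameter U ^ k))"

definition hausdorff_measure :: "nat \<Rightarrow> 'a::metric_space set \<Rightarrow> ennreal" where
  "hausdorff_measure k E =
     (SUP \<delta>\<in>{0<..}.
        INF U\<in>{U :: nat \<Rightarrow> 'a set. E \<subseteq> (\<Union>i. U i) \<and> (\<forall>i. bounded (U i) \<and> diameter (U i) \<le> \<delta>)}.
          \<Sum>i. diam_pow k (U i))"

section \<open>Complex measures\<close>

text \<open>
  On a compact subset \<open>B\<close> of Euclidean space the complex Radon measures are exactly the complex
  measures on the Borel sets of \<open>B\<close>. In the definitions below only the space and the
  sigma-algebra of \<open>M\<close> matter.
\<close>

definition complex_measure :: "'a measure \<Rightarrow> ('a set \<Rightarrow> complex) \<Rightarrow> bool" where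
  "complex_measure M \<mu> \<longleftrightarrow>
     \<mu> {} = 0 \<and>
     (\<forall>A :: nat \<Rightarrow> 'a set. range A \<subseteq> sets M \<and> disjoint_family A \<longrightarrow>
        (\<lambda>i. \<mu> (A i)) sums \<mu> (\<Union>i. A i))"

definition total_variation :: "'a measure \<Rightarrow> ('a set \<Rightarrow> complex) \<Rightarrow> 'a set \<Rightarrow> ennreal" where
  "total_variation M \<mu> A =
     (SUP P\<in>{P :: nat \<Rightarrow> 'a set. range P \<subseteq> sets M \<and> disjoint_family P \<and> (\<Union>i. P i) = A}.
        \<Sum>i. ennreal (cmod (\<mu> (P i))))"

definition negligible_wrt :: "'a measure \<Rightarrow> ('a set \<Rightarrow> complex) \<Rightarrow> 'a set \<Rightarrow> bool" where
  "negligible_wrt M \<mu> E \<longleftrightarrow> (\<exists>N\<in>sets M. E \<subseteq> N \<and> total_variation M \<mu> N = 0)"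

text \<open>
  The positive part in the Jordan decomposition of a signed measure \<open>\<nu>\<close>; the negative part is
  the positive part of \<open>- \<nu>\<close>. Negative values of \<open>\<nu>\<close> are sent to \<open>0\<close> by \<open>ennreal\<close> and do not
  contribute to the supremum.
\<close>

definition positive_part :: "'a measure \<Rightarrow> ('a set \<Rightarrow> real) \<Rightarrow> 'a measure" where
  "positive_part M \<nu> =
     measure_of (space M) (sets M) (\<lambda>A. SUP E\<in>{E \<in> sets M. E \<subseteq> A}. ennreal (\<nu> E))"

definition signed_integral :: "'a measure \<Rightarrow> ('a set \<Rightarrow> real) \<Rightarrow> ('a \<Rightarrow> complex) \<Rightarrow> complex" where
  "signed_integral M \<nu> f =
     integral\<^sup>L (positive_part M \<nu>) f - integral\<^sup>L (positive_part M (\<lambda>A. - \<nu> A)) f"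

definition complex_measure_integral ::
    "'a measure \<Rightarrow> ('a set \<Rightarrow> complex) \<Rightarrow> ('a \<Rightarrow> complex) \<Rightarrow> complex" where
  "complex_measure_integral M \<mu> f =
     signed_integral M (\<lambda>A. Re (\<mu> A)) f + \<i> * signed_integral M (\<lambda>A. Im (\<mu> A)) f"

section \<open>Hardy space and Poisson-Szego kernel\<close>

definition hardy_norm_sq :: "(complex^'n) measure \<Rightarrow> (complex^'n \<Rightarrow> complex) \<Rightarrow> ennreal" where
  "hardy_norm_sq \<beta> f =
     (SUP \<rho>\<in>{0..<1::real}. \<integral>\<^sup>+\<zeta>. ennreal ((cmod (f (\<rho> *\<^sub>R \<zeta>)))\<^sup>2) \<partial>\<beta>)"

definition hardy_space ::
    "(complex^'n) set \<Rightarrow> (complex^'n) measure \<Rightarrow> (complex^'n \<Rightarrow> complex) set" where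
  "hardy_space D \<beta> = {f. hol_on f D \<and> hardy_norm_sq \<beta> f < \<infinity>}"

text \<open>The inner product is recovered from the norm by polarization; it is linear in \<open>f\<close>.\<close>

definition hardy_inner ::
    "(complex^'n) measure \<Rightarrow> (complex^'n \<Rightarrow> complex) \<Rightarrow> (complex^'n \<Rightarrow> complex) \<Rightarrow> complex" where
  "hardy_inner \<beta> f g =
     (\<Sum>k<4. \<i> ^ k * of_real (enn2real (hardy_norm_sq \<beta> (\<lambda>z. f z + \<i> ^ k * g z)))) / 4"

definition is_reproducing_kernel ::
    "(complex^'n) set \<Rightarrow> (complex^'n) measure \<Rightarrow> (complex^'n \<Rightarrow> complex^'n \<Rightarrow> complex) \<Rightarrow> bool" where
  "is_reproducing_kernel D \<beta> C \<longleftrightarrow>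
     (\<forall>w\<in>D. (\<lambda>z. C z w) \<in> hardy_space D \<beta> \<and>
        (\<forall>f\<in>hardy_space D \<beta>. f w = hardy_inner \<beta> f (\<lambda>z. C z w)))"

text \<open>
  A reproducing kernel is determined on \<open>D \<times> D\<close> only. Its extension to \<open>D \<times> closure D\<close> is
  continuous, hence its value at a boundary point \<open>\<zeta>\<close> is the limit from inside \<open>D\<close>.
\<close>

definition kernel_extension ::
    "(complex^'n) set \<Rightarrow> (complex^'n \<Rightarrow> complex^'n \<Rightarrow> complex) \<Rightarrow> complex^'n \<Rightarrow> complex^'n \<Rightarrow> complex" where
  "kernel_extension D C z \<zeta> = Lim (at \<zeta> within D) (\<lambda>w. C z w)"

definition poisson_szego ::
    "(complex^'n) set \<Rightarrow> (complex^'n \<Rightarrow> complex^'n \<Rightarrow> complex) \<Rightarrow> complex^'n \<Rightarrow> complex^'n \<Rightarrow> complex" where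
  "poisson_szego D C z \<zeta> = of_real ((cmod (kernel_extension D C z \<zeta>))\<^sup>2) / C z z"

definition poisson_szego_integral ::
    "(complex^'n) set \<Rightarrow> (complex^'n) set \<Rightarrow> (complex^'n \<Rightarrow> complex^'n \<Rightarrow> complex) \<Rightarrow>
     ((complex^'n) set \<Rightarrow> complex) \<Rightarrow> complex^'n \<Rightarrow> complex" where
  "poisson_szego_integral D B C \<mu> z =
     complex_measure_integral (borel_on B) \<mu> (\<lambda>\<zeta>. poisson_szego D C z \<zeta>)"

section \<open>Pluriharmonic functions and measures\<close>

text \<open>Complex-valued harmonic functions on an open subset of the plane: class C2, Laplacian zero.\<close>

definition harmonic_on :: "(complex \<Rightarrow> complex) \<Rightarrow> complex set \<Rightarrow> bool" where
  "harmonic_on g U \<longleftrightarrow>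
     (\<exists>gx gy gxx gxy gyx gyy.
        (\<forall>t\<in>U. (g has_derivative (\<lambda>h. Re h *\<^sub>R gx t + Im h *\<^sub>R gy t)) (at t) \<and>
                (gx has_derivative (\<lambda>h. Re h *\<^sub>R gxx t + Im h *\<^sub>R gxy t)) (at t) \<and>
                (gy has_derivative (\<lambda>h. Re h *\<^sub>R gyx t + Im h *\<^sub>R gyy t)) (at t)) \<and>
        continuous_on U gxx \<and> continuous_on U gxy \<and> continuous_on U gyx \<and> continuous_on U gyy \<and>
        (\<forall>t\<in>U. gxx t + gyy t = 0))"

definition pluriharmonic_on :: "(complex^'n \<Rightarrow> complex) \<Rightarrow> (complex^'n) set \<Rightarrow> bool" where
  "pluriharmonic_on u D \<longleftrightarrow>
     (\<forall>a v. v \<noteq> 0 \<longrightarrow> harmonic_on (\<lambda>t. u (a + t *s v)) {t. a + t *s v \<in> D})"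

definition pluriharmonic_measure ::
    "(complex^'n) set \<Rightarrow> (complex^'n) set \<Rightarrow> (complex^'n \<Rightarrow> complex^'n \<Rightarrow> complex) \<Rightarrow>
     ((complex^'n) set \<Rightarrow> complex) \<Rightarrow> bool" where
  "pluriharmonic_measure D B C \<mu> \<longleftrightarrow>
     complex_measure (borel_on B) \<mu> \<and> pluriharmonic_on (poisson_szego_integral D B C \<mu>) D"

end

theory Submission
  imports Defs "HOL-Complex_Analysis.Complex_Analysis"
begin

text \<open>
  The circle acts on \<open>B\<close> by scalar multiplication. The proof compares \<open>\<mu>\<close> and \<open>\<beta>\<close> on Borel sets
  \<open>G \<subseteq> B\<close> that are invariant under this action and satisfy \<open>\<beta> G = 0\<close>.

  On the one hand, every \<open>E\<close> with \<open>hausdorff_measure (m - 1) E = 0\<close> lies in such a \<open>G\<close>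
  (\<open>hausdorff_null_imp_invariant_null\<close>). The measure \<open>\<beta>\<close> is invariant under a group of isometries
  that is transitive on \<open>B\<close>, so balls of equal radius \<open>r\<close> have equal mass; as a manifold of dimension
  \<open>m\<close> contains about \<open>r ^ - m\<close> disjoint balls of radius \<open>r\<close>, this mass is \<open>O(r ^ m)\<close>
  (\<open>submanifold_separated_points\<close>, \<open>homogeneous_ball_mass_bound\<close>). A set of diameter \<open>d\<close> is moved by
  the circle through a tube that is covered by \<open>O(1 / d)\<close> balls of radius \<open>O(d)\<close>, hence of mass
  \<open>O(d ^ (m - 1))\<close>. Summing over a cover of \<open>E\<close> that makes the Hausdorff sum small, one finds
  invariant neighbourhoods of \<open>E\<close> of arbitrarily small mass; \<open>G\<close> is their intersection.

  On the other hand, \<open>\<mu>\<close> vanishes on all Borel subsets of such a \<open>G\<close>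
  (\<open>invariant_null_imp_measure_zero\<close>). Let \<open>u\<close> be the Poisson-Szego integral of \<open>\<mu>\<close>. The measures
  \<open>u (R *\<^sub>R \<zeta>) d\<beta>(\<zeta>)\<close> converge weakly to \<open>\<mu>\<close> as \<open>R\<close> tends to \<open>1\<close> (\<open>weak_limit\<close>). Let \<open>\<phi>\<close> be continuous
  of weight \<open>j\<close>, that is, \<open>\<phi> (\<alpha> *s \<zeta>) = \<alpha> powi j * \<phi> \<zeta>\<close>. By invariance of \<open>\<beta>\<close>, the integral of
  \<open>\<phi> \<zeta> * u (R *\<^sub>R \<zeta>)\<close> does not change if \<open>u (R *\<^sub>R \<zeta>)\<close> is replaced by the mean of
  \<open>\<alpha> powi j * u (R *\<^sub>R (\<alpha> *s \<zeta>))\<close> over the circle. Since \<open>u\<close> is harmonic on the disc through \<open>\<zeta>\<close>, this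
  mean is a constant times \<open>R ^ \<bar>j\<bar>\<close>, so it stays bounded up to the boundary. In the limit, the integral
  of \<open>\<phi>\<close> against \<open>\<mu>\<close> is at most a constant times the integral of \<open>cmod \<circ> \<phi>\<close> against \<open>\<beta>\<close>
  (\<open>weighted_mu_integral_bound\<close>). Multiplying \<open>\<phi>\<close> by invariant cutoff functions that decrease to the
  indicator of a compact invariant \<open>\<beta>\<close>-null set \<open>K\<close> shows that the integral of \<open>\<phi>\<close> over \<open>K\<close> against \<open>\<mu>\<close>
  vanishes. Real polynomials are finite sums of functions of pure weight, so by Stone-Weierstrass \<open>\<mu>\<close>
  vanishes on all compact subsets of \<open>K\<close>, and inner regularity gives the claim.

  The weak convergence rests on two properties of the kernel. The pairing of \<open>f (\<rho> *\<^sub>R \<zeta>)\<close> with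
  \<open>g (\<sigma> *\<^sub>R \<zeta>)\<close> on the boundary depends on \<open>\<rho> * \<sigma>\<close> only (\<open>radial_inner_depends_on_product\<close>), which
  turns the abstract reproducing property into an integral formula on smaller copies of the boundary
  (\<open>reproducing_integral\<close>) and, as the automorphisms are transitive on \<open>B\<close>, makes the Poisson-Szego
  kernel symmetric in its two boundary points (\<open>boundary_kernel_symmetric\<close>). And
  as \<open>B\<close> lies in the unit sphere, the squared distance of \<open>\<zeta>\<close> to \<open>\<xi>\<close> is \<open>2 - 2 * Re (hermitian_inner \<zeta> \<xi>)\<close>,
  the real part of an affine holomorphic function. The kernel reproduces it, so its second moment
  about \<open>\<xi>\<close> is \<open>2 * (1 - R)\<close> (\<open>boundary_kernel_concentration\<close>), and it is an approximate identity.
\<close>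

section \<open>Fourier coefficients on circles\<close>

definition unit_interval :: "real measure" where
  "unit_interval = restrict_space lborel {0..1}"

text \<open>
  The parameter runs through \<open>{0..1}\<close> as in \<^const>\<open>circlepath\<close>, so that means over the circle are
  integrals against a probability measure and contour integrals need no substitution.
\<close>

definition circle_point :: "real \<Rightarrow> complex" where
  "circle_point t = exp (2 * of_real pi * \<i> * of_real t)"

definition circle_mean :: "(complex \<Rightarrow> complex) \<Rightarrow> complex" where
  "circle_mean f = (\<integral>t. f (circle_point t) \<partial>unit_interval)"

lemma norm_circle_point [simp]: "cmod (circle_point t) = 1"
  by (simp add: circle_point_def)

lemma circle_point_nonzero [simp]: "circle_point t \<noteq> 0"
  by (simp add: circle_point_def)

lemma cnj_circle_point: "cnj (circle_point t) = 1 / circle_point t"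
proof -
  have "circle_point t * cnj (circle_point t) = 1"
    by (simp only: complex_norm_square[symmetric] norm_circle_point) simp
  then show ?thesis by (simp add: nonzero_eq_divide_eq mult.commute)
qed

lemma continuous_circle_point [continuous_intros]: "continuous_on S circle_point"
  unfolding circle_point_def by (intro continuous_intros)

lemma space_unit_interval: "space unit_interval = {0..1}"
  by (simp add: unit_interval_def space_restrict_space)

lemma prob_space_unit_interval: "emeasure unit_interval (space unit_interval) = 1"
  by (simp add: unit_interval_def space_restrict_space emeasure_restrict_space)

lemma finite_measure_unit_interval: "finite_measure unit_interval"
  by standard (simp add: prob_space_unit_interval)

lemma measure_unit_interval_space [simp]: "measure unit_interval {0..1} = 1"
  using prob_space_unit_interval by (simp add: measure_def space_unit_interval)

lemma borel_measurable_unit_interval: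
  "f \<in> borel_measurable borel \<Longrightarrow> f \<in> borel_measurable unit_interval"
  by (simp add: unit_interval_def measurable_restrict_space1)

lemma continuous_unit_interval:
  fixes f :: "real \<Rightarrow> complex"
  assumes "continuous_on {0..1} f"
  shows "integrable unit_interval f"
    and "(f has_integral (\<integral>t. f t \<partial>unit_interval)) {0..1}"
proof -
  have s: "set_integrable lborel {0..1} f"
    using assms by (rule borel_integrable_atLeastAtMost')
  then show "integrable unit_interval f"
    by (simp add: unit_interval_def integrable_restrict_space set_integrable_def)
  have "(\<integral>t. f t \<partial>unit_interval) = (LINT t:{0..1}|lborel. f t)"
    by (simp add: unit_interval_def integral_restrict_space set_lebesgue_integral_def)
  with set_borel_integral_eq_integral[OF s]
  show "(f has_integral (\<integral>t. f t \<partial>unit_interval)) {0..1}"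
    by (simp add: has_integral_integrable_integral)
qed

text \<open>
  Cauchy's formula for the derivatives at the centre, read as a formula for Fourier coefficients.
\<close>

lemma circle_mean_coefficient_pos:
  fixes g :: "complex \<Rightarrow> complex" and r :: real
  assumes "g holomorphic_on ball 0 1" "0 < r" "r < 1"
  shows "circle_mean (\<lambda>\<alpha>. g (r * \<alpha>) / \<alpha> ^ n) = r ^ n * ((deriv ^^ n) g 0 / fact n)"
proof -
  have sub: "cball 0 r \<subseteq> ball (0::complex) 1" using assms by auto
  have cont: "continuous_on (cball 0 r) g"
    by (rule continuous_on_subset[OF holomorphic_on_imp_continuous_on[OF assms(1)] sub])
  have hol: "g holomorphic_on ball 0 r"
    by (rule holomorphic_on_subset[OF assms(1)]) (use assms in auto)
  have cp: "circlepath 0 r x = r * circle_point x"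
    "exp (2 * complex_of_real pi * \<i> * complex_of_real x) = circle_point x" for x
    by (simp_all add: circlepath circle_point_def)
  have "((\<lambda>u. g u / (u - 0) ^ Suc n) has_contour_integral
     (2 * pi * \<i> / fact n * (deriv ^^ n) g 0)) (circlepath 0 r)"
    by (rule Cauchy_has_contour_integral_higher_derivative_circlepath) (use assms cont hol in auto)
  then have "((\<lambda>x. g (r * circle_point x) / (r * circle_point x) ^ Suc n *
       (2 * pi * \<i> * r * circle_point x)) has_integral (2 * pi * \<i> / fact n * (deriv ^^ n) g 0)) {0..1}"
    unfolding has_contour_integral_def
    by (rule has_integral_eq[rotated])
       (simp add: vector_derivative_circlepath01 cp)
  then have "((\<lambda>x. r ^ n / (2 * pi * \<i>) * (g (r * circle_point x) / (r * circle_point x) ^ Suc n *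
       (2 * pi * \<i> * r * circle_point x))) has_integral r ^ n / (2 * pi * \<i>) * (2 * pi * \<i> / fact n * (deriv ^^ n) g 0)) {0..1}"
    by (intro has_integral_mult_right)
  moreover have "complex_of_real r ^ n / (2 * pi * \<i>) * (g (r * circle_point x) / (r * circle_point x) ^ Suc n *
       (2 * pi * \<i> * r * circle_point x)) = g (r * circle_point x) / circle_point x ^ n" for x
    using assms by (simp add: power_mult_distrib field_simps)
  moreover have "complex_of_real r ^ n / (2 * pi * \<i>) * (2 * pi * \<i> / fact n * (deriv ^^ n) g 0)
       = r ^ n * ((deriv ^^ n) g 0 / fact n)"
    by (simp add: field_simps)
  ultimately have I: "((\<lambda>x. g (r * circle_point x) / circle_point x ^ n) has_integral
       r ^ n * ((deriv ^^ n) g 0 / fact n)) {0..1}"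
    by (simp only: of_real_power)
  have "continuous_on {0..1} (\<lambda>x. g (r * circle_point x) / circle_point x ^ n)"
    by (intro continuous_intros continuous_on_compose2[OF cont]) (use assms in \<open>auto simp: norm_mult\<close>)
  from has_integral_unique[OF continuous_unit_interval(2)[OF this] I] show ?thesis
    by (simp only: circle_mean_def)
qed

lemma circle_mean_inverse_power: "circle_mean (\<lambda>\<alpha>. c / \<alpha> ^ n) = (if n = 0 then c else 0)"
proof -
  have "(deriv ^^ n) (\<lambda>_. c) 0 = (if n = 0 then c else 0)" by simp
  with circle_mean_coefficient_pos[of "\<lambda>_. c" "1/2" n] show ?thesis by auto
qed

lemma circle_mean_coefficient:
  fixes g :: "complex \<Rightarrow> complex" and r :: real
  assumes "g holomorphic_on ball 0 1" "0 \<le> r" "r < 1"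
  shows "circle_mean (\<lambda>\<alpha>. g (r * \<alpha>) / \<alpha> ^ n) = r ^ n * ((deriv ^^ n) g 0 / fact n)"
proof (cases "r = 0")
  case True
  then show ?thesis using circle_mean_inverse_power[of "g 0" n] by auto
next
  case False
  then show ?thesis using circle_mean_coefficient_pos assms by auto
qed

text \<open>
  The product with \<open>z ^ n\<close> is holomorphic and vanishes at the centre, so its mean is zero.
\<close>

lemma circle_mean_positive_power:
  fixes g :: "complex \<Rightarrow> complex" and r :: real
  assumes "g holomorphic_on ball 0 1" "0 < r" "r < 1" "n > 0"
  shows "circle_mean (\<lambda>\<alpha>. g (r * \<alpha>) * \<alpha> ^ n) = 0"
proof -
  have "circle_mean (\<lambda>\<alpha>. g (r * \<alpha>) * (r * \<alpha>) ^ n / \<alpha> ^ 0) = 0"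
    by (subst circle_mean_coefficient_pos[of "\<lambda>z. g z * z ^ n" r 0])
       (use assms in \<open>auto intro!: holomorphic_intros\<close>)
  moreover have "circle_mean (\<lambda>\<alpha>. g (r * \<alpha>) * (r * \<alpha>) ^ n / \<alpha> ^ 0)
       = r ^ n * circle_mean (\<lambda>\<alpha>. g (r * \<alpha>) * \<alpha> ^ n)"
    unfolding circle_mean_def
    by (subst integral_mult_right_zero[symmetric]) (simp add: power_mult_distrib mult_ac)
  ultimately show ?thesis using assms by auto
qed

lemma holomorphic_circle_cont:
  fixes g :: "complex \<Rightarrow> complex" and r :: real
  assumes "g holomorphic_on ball 0 1" "0 \<le> r" "r < 1"
  shows "continuous_on {0..1} (\<lambda>t. g (r * circle_point t))"
proof -
  have "continuous_on (ball 0 1) g" by (rule holomorphic_on_imp_continuous_on[OF assms(1)])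
  then show ?thesis
    by (rule continuous_on_compose2) (use assms in \<open>auto intro!: continuous_intros simp: norm_mult\<close>)
qed

text \<open>
  Parseval's identity with two radii. What matters below is that the right-hand coefficients see the
  radii only through \<open>\<rho> * \<sigma>\<close>, and that for \<open>g = h\<close> they are nonnegative.
\<close>

lemma circle_mean_product_sums:
  fixes g h :: "complex \<Rightarrow> complex" and \<rho> \<sigma> :: real
  assumes g: "g holomorphic_on ball 0 1" and h: "h holomorphic_on ball 0 1"
    and r: "0 \<le> \<rho>" "\<rho> < 1" "0 \<le> \<sigma>" "\<sigma> < 1"
  shows "(\<lambda>n. (deriv ^^ n) g 0 / fact n * cnj ((deriv ^^ n) h 0 / fact n) * of_real (\<rho> * \<sigma>) ^ n)
     sums circle_mean (\<lambda>\<alpha>. g (\<rho> * \<alpha>) * cnj (h (\<sigma> * \<alpha>)))"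
proof -
  define a b where "a n = (deriv ^^ n) g 0 / fact n" and "b n = (deriv ^^ n) h 0 / fact n" for n
  have ps: "(\<lambda>n. a n * w ^ n) sums g w" if "w \<in> ball 0 1" for w
    using holomorphic_power_series[OF g that] by (simp add: a_def)
  have summ: "summable (\<lambda>n. norm (a n * of_real \<rho> ^ n))"
  proof (rule powser_insidea)
    show "summable (\<lambda>n. a n * (of_real ((1 + \<rho>) / 2)) ^ n)"
      using ps[of "of_real ((1 + \<rho>) / 2)"] r by (auto simp del: of_real_add of_real_divide simp: sums_iff)
    show "norm (of_real \<rho> :: complex) < norm (of_real ((1 + \<rho>) / 2) :: complex)"
      using r by (simp del: of_real_add of_real_divide)
  qed
  define F where "F n t = a n * of_real \<rho> ^ n * circle_point t ^ n * cnj (h (\<sigma> * circle_point t))" for n t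
  have hc: "continuous_on {0..1} (\<lambda>t. h (\<sigma> * circle_point t))"
    using holomorphic_circle_cont[OF h r(3,4)] .
  have "bounded ((\<lambda>t. h (\<sigma> * circle_point t)) ` {0..1})"
    by (intro compact_imp_bounded compact_continuous_image hc) auto
  then obtain M where "\<forall>x\<in>(\<lambda>t. h (\<sigma> * circle_point t)) ` {0..1}. norm x \<le> M"
    by (auto simp only: bounded_iff)
  then have M: "\<And>t. t \<in> {0..1} \<Longrightarrow> norm (h (\<sigma> * circle_point t)) \<le> M"
    by (simp only: ball_simps)
  have M0: "M \<ge> 0" using order_trans[OF norm_ge_zero M[of 0]] by simp
  have Fb: "norm (F n t) \<le> norm (a n * of_real \<rho> ^ n) * M" if "t \<in> {0..1}" for n t
    unfolding F_def using M[OF that] by (simp add: norm_mult norm_power mult_left_mono)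
  have Fc: "continuous_on {0..1} (F n)" for n
    unfolding F_def by (intro continuous_intros hc)
  interpret finite_measure unit_interval by (rule finite_measure_unit_interval)
  have "(\<lambda>n. integral\<^sup>L unit_interval (F n)) sums (\<integral>t. (\<Sum>n. F n t) \<partial>unit_interval)"
  proof (rule sums_integral)
    show "integrable unit_interval (F n)" for n by (rule continuous_unit_interval(1)[OF Fc])
    have s: "summable (\<lambda>n. norm (a n * of_real \<rho> ^ n) * M)" using summ by (rule summable_mult2)
    show "AE t in unit_interval. summable (\<lambda>n. norm (F n t))"
      by (rule AE_I2) (rule summable_comparison_test'[OF s], use Fb in \<open>auto simp: space_unit_interval\<close>)
    show "summable (\<lambda>n. \<integral>t. norm (F n t) \<partial>unit_interval)"
    proof (rule summable_comparison_test'[OF s, of 0])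
      fix n
      have "(\<integral>t. norm (F n t) \<partial>unit_interval) \<le> (\<integral>t. norm (a n * of_real \<rho> ^ n) * M \<partial>unit_interval)"
        by (intro integral_mono integrable_norm continuous_unit_interval(1)[OF Fc] integrable_const)
           (use Fb in \<open>auto simp: space_unit_interval\<close>)
      then show "norm (\<integral>t. norm (F n t) \<partial>unit_interval) \<le> norm (a n * of_real \<rho> ^ n) * M"
        by (simp add: space_unit_interval)
    qed
  qed
  moreover have "(\<integral>t. (\<Sum>n. F n t) \<partial>unit_interval) = circle_mean (\<lambda>\<alpha>. g (\<rho> * \<alpha>) * cnj (h (\<sigma> * \<alpha>)))"
    unfolding circle_mean_def
  proof (rule Bochner_Integration.integral_cong[OF refl])
    fix t
    have "(\<lambda>n. a n * (\<rho> * circle_point t) ^ n) sums g (\<rho> * circle_point t)"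
      by (rule ps) (use r in \<open>auto simp: norm_mult\<close>)
    then have "(\<lambda>n. a n * (\<rho> * circle_point t) ^ n * cnj (h (\<sigma> * circle_point t))) sums
        (g (\<rho> * circle_point t) * cnj (h (\<sigma> * circle_point t)))" by (rule sums_mult2)
    then show "(\<Sum>n. F n t) = g (\<rho> * circle_point t) * cnj (h (\<sigma> * circle_point t))"
      by (simp add: F_def sums_iff power_mult_distrib mult_ac)
  qed
  moreover have "integral\<^sup>L unit_interval (F n) = a n * cnj (b n) * of_real (\<rho> * \<sigma>) ^ n" for n
  proof -
    have "cnj (circle_mean (\<lambda>\<alpha>. h (\<sigma> * \<alpha>) / \<alpha> ^ n)) = cnj (\<sigma> ^ n * b n)"
      using circle_mean_coefficient[OF h r(3,4), of n] by (simp add: b_def)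
    also have "cnj (circle_mean (\<lambda>\<alpha>. h (\<sigma> * \<alpha>) / \<alpha> ^ n)) =
       (\<integral>t. circle_point t ^ n * cnj (h (\<sigma> * circle_point t)) \<partial>unit_interval)"
      unfolding circle_mean_def Bochner_Integration.integral_cnj[symmetric]
      by (intro Bochner_Integration.integral_cong refl) (simp add: cnj_circle_point power_one_over field_simps)
    finally have *: "(\<integral>t. circle_point t ^ n * cnj (h (\<sigma> * circle_point t)) \<partial>unit_interval) = cnj (\<sigma> ^ n * b n)" .
    have "integral\<^sup>L unit_interval (F n) =
        (\<integral>t. a n * of_real \<rho> ^ n * (circle_point t ^ n * cnj (h (\<sigma> * circle_point t))) \<partial>unit_interval)"
      by (simp add: F_def[abs_def] mult_ac)
    also have "\<dots> = a n * of_real \<rho> ^ n * cnj (\<sigma> ^ n * b n)"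
      by (subst integral_mult_right_zero) (simp add: *)
    finally show ?thesis by (simp add: power_mult_distrib mult_ac)
  qed
  ultimately show ?thesis by (simp add: a_def b_def)
qed

section \<open>Harmonic functions on the disc\<close>

text \<open>
  The mean value inequality along \<open>v\<close>, applied to the increment of \<open>g\<close> in direction \<open>w\<close>. If \<open>v\<close> and \<open>w\<close>
  change roles, the second difference is the same while \<open>L w\<close> becomes the other mixed derivative.
\<close>

lemma second_difference_bound:
  fixes g :: "complex \<Rightarrow> complex" and s :: real
  assumes g: "\<And>z. z \<in> ball t \<delta> \<Longrightarrow> (g has_derivative D z) (at z)"
    and F: "\<And>h. norm h < \<delta> \<Longrightarrow> norm (D (t + h) v - D t v - L h) \<le> \<epsilon> * norm h"
    and L: "linear L" and v: "norm v = 1" and w: "norm w = 1" and s: "0 < s" "2 * s < \<delta>" and e: "\<epsilon> \<ge> 0"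
  shows "norm (g (t + s *\<^sub>R v + s *\<^sub>R w) - g (t + s *\<^sub>R v) - g (t + s *\<^sub>R w) + g t - s\<^sup>2 *\<^sub>R L w) \<le> 3 * \<epsilon> * s\<^sup>2"
proof -
  interpret L: linear L by (rule L)
  define \<phi> where "\<phi> x = g (t + x *\<^sub>R v + s *\<^sub>R w) - g (t + x *\<^sub>R v) - (x * s) *\<^sub>R L w" for x
  have small: "norm (x *\<^sub>R v) \<le> s" "norm (x *\<^sub>R v + s *\<^sub>R w) \<le> 2 * s" if "x \<in> {0..s}" for x
  proof -
    show "norm (x *\<^sub>R v) \<le> s" using that v by simp
    then show "norm (x *\<^sub>R v + s *\<^sub>R w) \<le> 2 * s"
      using norm_triangle_ineq[of "x *\<^sub>R v" "s *\<^sub>R w"] w s by simp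
  qed
  have lin: "linear (D z)" if "z \<in> ball t \<delta>" for z
    using has_derivative_linear g that by blast
  have deriv: "(\<phi> has_derivative (\<lambda>k. k *\<^sub>R (D (t + x *\<^sub>R v + s *\<^sub>R w) v - D (t + x *\<^sub>R v) v - s *\<^sub>R L w))) (at x within {0..s})"
    if x: "x \<in> {0..s}" for x
  proof -
    have b1: "t + x *\<^sub>R v + s *\<^sub>R w \<in> ball t \<delta>" and b2: "t + x *\<^sub>R v \<in> ball t \<delta>"
      using small[OF x] s by (auto simp: dist_norm norm_minus_commute add_ac)
    have d1: "((\<lambda>x. g (t + x *\<^sub>R v + s *\<^sub>R w)) has_derivative (\<lambda>k. D (t + x *\<^sub>R v + s *\<^sub>R w) (k *\<^sub>R v))) (at x within {0..s})"
      by (rule has_derivative_compose[where f = "\<lambda>x. t + x *\<^sub>R v + s *\<^sub>R w" and g = g and g' = "D (t + x *\<^sub>R v + s *\<^sub>R w)", OF _ g[OF b1]]) (auto intro!: derivative_eq_intros)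
    have d2: "((\<lambda>x. g (t + x *\<^sub>R v)) has_derivative (\<lambda>k. D (t + x *\<^sub>R v) (k *\<^sub>R v))) (at x within {0..s})"
      by (rule has_derivative_compose[where f = "\<lambda>x. t + x *\<^sub>R v" and g = g and g' = "D (t + x *\<^sub>R v)", OF _ g[OF b2]]) (auto intro!: derivative_eq_intros)
    show ?thesis unfolding \<phi>_def
      by (rule derivative_eq_intros d1[unfolded linear_cmul[OF lin[OF b1]]] d2[unfolded linear_cmul[OF lin[OF b2]]] refl | simp)+
         (simp add: algebra_simps)
  qed
  have bound: "onorm (\<lambda>k. k *\<^sub>R (D (t + x *\<^sub>R v + s *\<^sub>R w) v - D (t + x *\<^sub>R v) v - s *\<^sub>R L w)) \<le> 3 * \<epsilon> * s"
    if x: "x \<in> {0..s}" for x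
  proof -
    have "norm (D (t + (x *\<^sub>R v + s *\<^sub>R w)) v - D t v - L (x *\<^sub>R v + s *\<^sub>R w)) \<le> \<epsilon> * (2 * s)"
      by (rule order_trans[OF F]) (use small(2)[OF x] s e in \<open>auto intro!: mult_left_mono\<close>)
    moreover have "norm (D (t + (x *\<^sub>R v)) v - D t v - L (x *\<^sub>R v)) \<le> \<epsilon> * s"
      by (rule order_trans[OF F]) (use small(1)[OF x] s e in \<open>auto intro!: mult_left_mono\<close>)
    ultimately have "norm ((D (t + (x *\<^sub>R v + s *\<^sub>R w)) v - D t v - L (x *\<^sub>R v + s *\<^sub>R w)) -
        (D (t + (x *\<^sub>R v)) v - D t v - L (x *\<^sub>R v))) \<le> 3 * \<epsilon> * s"
      by (intro order_trans[OF norm_triangle_ineq4]) simp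
    then have "norm (D (t + x *\<^sub>R v + s *\<^sub>R w) v - D (t + x *\<^sub>R v) v - s *\<^sub>R L w) \<le> 3 * \<epsilon> * s"
      by (simp add: L.add L.scaleR add.assoc algebra_simps)
    then show ?thesis
      by (intro onorm_le) (simp add: mult.commute mult_left_mono)
  qed
  have "norm (\<phi> s - \<phi> 0) \<le> 3 * \<epsilon> * s * norm (s - 0)"
    by (rule differentiable_bound[OF _ deriv bound]) (use s in auto)
  then show ?thesis
    using s by (simp add: \<phi>_def power2_eq_square algebra_simps)
qed

lemma mixed_partials_commute:
  fixes g gx gy :: "complex \<Rightarrow> complex"
  assumes U: "open U" "t \<in> U"
    and g: "\<And>z. z \<in> U \<Longrightarrow> (g has_derivative (\<lambda>h. Re h *\<^sub>R gx z + Im h *\<^sub>R gy z)) (at z)"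
    and gx: "(gx has_derivative (\<lambda>h. Re h *\<^sub>R a + Im h *\<^sub>R b)) (at t)"
    and gy: "(gy has_derivative (\<lambda>h. Re h *\<^sub>R c + Im h *\<^sub>R d)) (at t)"
  shows "b = c"
proof (rule ccontr)
  assume "b \<noteq> c"
  define \<epsilon> where "\<epsilon> = norm (b - c) / 12"
  have e: "\<epsilon> > 0" using \<open>b \<noteq> c\<close> by (simp add: \<epsilon>_def)
  obtain d0 where d0: "d0 > 0" "ball t d0 \<subseteq> U" using U openE by blast
  obtain d1 where d1: "d1 > 0" "\<And>y. norm (y - t) < d1 \<Longrightarrow>
      norm (gx y - gx t - (Re (y - t) *\<^sub>R a + Im (y - t) *\<^sub>R b)) \<le> \<epsilon> * norm (y - t)"
    using gx e unfolding has_derivative_at_alt by blast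
  obtain d2 where d2: "d2 > 0" "\<And>y. norm (y - t) < d2 \<Longrightarrow>
      norm (gy y - gy t - (Re (y - t) *\<^sub>R c + Im (y - t) *\<^sub>R d)) \<le> \<epsilon> * norm (y - t)"
    using gy e unfolding has_derivative_at_alt by blast
  define \<delta> where "\<delta> = min d0 (min d1 d2)"
  have \<delta>: "\<delta> > 0" "\<delta> \<le> d0" "\<delta> \<le> d1" "\<delta> \<le> d2" using d0(1) d1(1) d2(1) by (auto simp: \<delta>_def)
  define s where "s = \<delta> / 3"
  have s: "0 < s" "2 * s < \<delta>" using \<delta> by (auto simp: s_def)
  have gb: "(g has_derivative (\<lambda>h. Re h *\<^sub>R gx z + Im h *\<^sub>R gy z)) (at z)" if "z \<in> ball t \<delta>" for z
    by (rule g) (use that d0(2) \<delta> in auto)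
  have l1: "linear (\<lambda>h. Re h *\<^sub>R a + Im h *\<^sub>R b)" and l2: "linear (\<lambda>h. Re h *\<^sub>R c + Im h *\<^sub>R d)"
    using gx gy has_derivative_linear by blast+
  let ?S = "g (t + s *\<^sub>R 1 + s *\<^sub>R \<i>) - g (t + s *\<^sub>R 1) - g (t + s *\<^sub>R \<i>) + g t"
  have n1: "norm (?S - s\<^sup>2 *\<^sub>R (Re \<i> *\<^sub>R a + Im \<i> *\<^sub>R b)) \<le> 3 * \<epsilon> * s\<^sup>2"
    by (rule second_difference_bound[OF gb]) (use d1(2)[of "t + _"] l1 s e \<delta> in auto)
  have n2: "norm (g (t + s *\<^sub>R \<i> + s *\<^sub>R 1) - g (t + s *\<^sub>R \<i>) - g (t + s *\<^sub>R 1) + g t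
      - s\<^sup>2 *\<^sub>R (Re 1 *\<^sub>R c + Im 1 *\<^sub>R d)) \<le> 3 * \<epsilon> * s\<^sup>2"
    by (rule second_difference_bound[OF gb]) (use d2(2)[of "t + _"] l2 s e \<delta> in auto)
  have n3: "g (t + s *\<^sub>R \<i> + s *\<^sub>R 1) - g (t + s *\<^sub>R \<i>) - g (t + s *\<^sub>R 1) + g t = ?S"
    by (simp add: algebra_simps)
  have "norm (?S - s\<^sup>2 *\<^sub>R b) \<le> 3 * \<epsilon> * s\<^sup>2" using n1 by simp
  moreover have "norm (?S - s\<^sup>2 *\<^sub>R c) \<le> 3 * \<epsilon> * s\<^sup>2" using n2[unfolded n3] by simp
  ultimately have "norm ((?S - s\<^sup>2 *\<^sub>R c) - (?S - s\<^sup>2 *\<^sub>R b)) \<le> 3 * \<epsilon> * s\<^sup>2 + 3 * \<epsilon> * s\<^sup>2"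
    by (rule order_trans[OF norm_triangle_ineq4 add_mono, rotated])
  also have "(?S - s\<^sup>2 *\<^sub>R c) - (?S - s\<^sup>2 *\<^sub>R b) = s\<^sup>2 *\<^sub>R (b - c)" by (simp add: algebra_simps)
  finally have "s\<^sup>2 * norm (b - c) \<le> s\<^sup>2 * (6 * \<epsilon>)" by (simp add: mult_ac)
  then have "norm (b - c) \<le> 6 * \<epsilon>" using s by (simp add: mult_le_cancel_left_pos)
  with e show False by (simp add: \<epsilon>_def)
qed

text \<open>
  The Cauchy-Riemann equations for \<open>gx - \<i> * gy\<close> are the symmetry of the second derivative and
  Laplace's equation.
\<close>

lemma holomorphic_wirtinger_derivative:
  fixes g gx gy :: "complex \<Rightarrow> complex"
  assumes U: "open U"
    and g: "\<And>z. z \<in> U \<Longrightarrow> (g has_derivative (\<lambda>h. Re h *\<^sub>R gx z + Im h *\<^sub>R gy z)) (at z)"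
    and gx: "\<And>z. z \<in> U \<Longrightarrow> (gx has_derivative (\<lambda>h. Re h *\<^sub>R gxx z + Im h *\<^sub>R gxy z)) (at z)"
    and gy: "\<And>z. z \<in> U \<Longrightarrow> (gy has_derivative (\<lambda>h. Re h *\<^sub>R gyx z + Im h *\<^sub>R gyy z)) (at z)"
    and laplace: "\<And>z. z \<in> U \<Longrightarrow> gxx z + gyy z = 0"
  shows "(\<lambda>z. gx z - \<i> * gy z) holomorphic_on U"
proof -
  have "((\<lambda>z. gx z - \<i> * gy z) has_field_derivative (gxx z - \<i> * gyx z)) (at z)" if z: "z \<in> U" for z
  proof -
    have sym: "gxy z = gyx z" by (rule mixed_partials_commute[OF U z g gx[OF z] gy[OF z]])
    have lap: "gyy z = - gxx z" using laplace[OF z] by (simp add: add_eq_0_iff)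
    show ?thesis
      unfolding has_field_derivative_def
      by (rule has_derivative_eq_rhs, rule has_derivative_diff[OF gx[OF z] has_derivative_mult_right[OF gy[OF z]]])
         (auto simp: sym lap fun_eq_iff complex_eq_iff algebra_simps)
  qed
  then show ?thesis using U by (auto simp: holomorphic_on_open)
qed

lemma harmonic_on_imp_continuous_on:
  assumes "harmonic_on h U" shows "continuous_on U h"
proof -
  from assms[unfolded harmonic_on_def] obtain gx gy where
    "\<forall>t\<in>U. (h has_derivative (\<lambda>h. Re h *\<^sub>R gx t + Im h *\<^sub>R gy t)) (at t)"
    by - (elim exE conjE, rule that, fast)
  then show ?thesis
    by (intro continuous_at_imp_continuous_on ballI has_derivative_continuous) (rule bspec)
qed

text \<open>
  \<open>G\<close> and \<open>H\<close> are primitives of the Wirtinger derivatives of \<open>h\<close> and of its conjugate. The first partial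
  derivatives of \<open>G z + cnj (H z)\<close> are then those of \<open>h\<close>, and a constant makes up for the difference.
\<close>

lemma harmonic_decomposition:
  assumes h: "harmonic_on h U" and U: "ball 0 1 \<subseteq> U"
  obtains G H where "G holomorphic_on ball 0 1" "H holomorphic_on ball 0 1"
    "\<And>z. z \<in> ball 0 1 \<Longrightarrow> h z = G z + cnj (H z)"
proof -
  let ?B = "ball (0::complex) 1"
  from h[unfolded harmonic_on_def] obtain gx gy gxx gxy gyx gyy where
    hd: "\<forall>t\<in>U. (h has_derivative (\<lambda>h. Re h *\<^sub>R gx t + Im h *\<^sub>R gy t)) (at t) \<and>
                (gx has_derivative (\<lambda>h. Re h *\<^sub>R gxx t + Im h *\<^sub>R gxy t)) (at t) \<and>
                (gy has_derivative (\<lambda>h. Re h *\<^sub>R gyx t + Im h *\<^sub>R gyy t)) (at t)"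
    and lap': "\<forall>t\<in>U. gxx t + gyy t = 0"
    by - (elim exE conjE, rule that, assumption+)
  have d: "(h has_derivative (\<lambda>h. Re h *\<^sub>R gx t + Im h *\<^sub>R gy t)) (at t)"
    "(gx has_derivative (\<lambda>h. Re h *\<^sub>R gxx t + Im h *\<^sub>R gxy t)) (at t)"
    "(gy has_derivative (\<lambda>h. Re h *\<^sub>R gyx t + Im h *\<^sub>R gyy t)) (at t)"
    and lap: "gxx t + gyy t = 0" if "t \<in> ?B" for t
    using bspec[OF hd subsetD[OF U that]] bspec[OF lap' subsetD[OF U that]] by - (elim conjE, assumption)+
  have P: "(\<lambda>z. gx z - \<i> * gy z) holomorphic_on ?B"
    by (rule holomorphic_wirtinger_derivative[where g = h and gxx = gxx and gxy = gxy and gyx = gyx and gyy = gyy])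
       (rule open_ball d lap | assumption)+
  have cd: "((\<lambda>z. cnj (f z)) has_derivative (\<lambda>h. Re h *\<^sub>R cnj a + Im h *\<^sub>R cnj b)) (at t)"
    if "(f has_derivative (\<lambda>h. Re h *\<^sub>R a + Im h *\<^sub>R b)) (at t)" for f a b t
    using has_derivative_cnj[OF that] by simp
  have Q: "(\<lambda>z. cnj (gx z) - \<i> * cnj (gy z)) holomorphic_on ?B"
  proof (rule holomorphic_wirtinger_derivative[where g = "\<lambda>z. cnj (h z)" and gxx = "\<lambda>z. cnj (gxx z)"
        and gxy = "\<lambda>z. cnj (gxy z)" and gyx = "\<lambda>z. cnj (gyx z)" and gyy = "\<lambda>z. cnj (gyy z)"])
    show "cnj (gxx z) + cnj (gyy z) = 0" if "z \<in> ?B" for z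
      using lap[OF that] by (simp flip: complex_cnj_add)
  qed (rule open_ball cd d | assumption)+
  have P2: "(\<lambda>z. (gx z - \<i> * gy z) / 2) holomorphic_on ?B" "(\<lambda>z. (cnj (gx z) - \<i> * cnj (gy z)) / 2) holomorphic_on ?B"
    using P Q by (auto intro!: holomorphic_intros)
  obtain G where G: "\<And>z. z \<in> ?B \<Longrightarrow> (G has_field_derivative (gx z - \<i> * gy z) / 2) (at z within ?B)"
    by (rule holomorphic_convex_primitive'[OF convex_ball open_ball P2(1)], rule that) blast
  obtain H where H: "\<And>z. z \<in> ?B \<Longrightarrow> (H has_field_derivative (cnj (gx z) - \<i> * cnj (gy z)) / 2) (at z within ?B)"
    by (rule holomorphic_convex_primitive'[OF convex_ball open_ball P2(2)], rule that) blast
  have "((\<lambda>z. h z - (G z + cnj (H z))) has_derivative (\<lambda>_. 0)) (at z within ?B)" if z: "z \<in> ?B" for z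
  proof -
    have G': "(G has_derivative (*) ((gx z - \<i> * gy z) / 2)) (at z within ?B)"
      and H': "(H has_derivative (*) ((cnj (gx z) - \<i> * cnj (gy z)) / 2)) (at z within ?B)"
      using G[OF z] H[OF z] by (auto simp: has_field_derivative_def)
    show ?thesis
      by (rule has_derivative_eq_rhs,
          rule has_derivative_diff[OF has_derivative_at_withinI[OF d(1)[OF z]]
             has_derivative_add[OF G' has_derivative_cnj[OF H']]])
         (auto simp: fun_eq_iff complex_eq_iff field_simps)
  qed
  then obtain c where c: "\<forall>z\<in>?B. h z - (G z + cnj (H z)) = c"
    using has_derivative_zero_constant[OF convex_ball, of 0 1 "\<lambda>z. h z - (G z + cnj (H z))"] by blast
  show thesis
  proof (rule that[of "\<lambda>z. G z + c" "H"])
    have "G holomorphic_on ?B"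
      unfolding holomorphic_on_def field_differentiable_def using G by blast
    then show "(\<lambda>z. G z + c) holomorphic_on ?B"
      by (intro holomorphic_intros)
    show "H holomorphic_on ?B"
      unfolding holomorphic_on_def field_differentiable_def using H by blast
    show "h z = G z + c + cnj (H z)" if "z \<in> ?B" for z
      using bspec[OF c that] by (simp add: algebra_simps)
  qed
qed

lemma circle_mean_add_cnj:
  assumes "continuous_on {0..1} (\<lambda>t. f (circle_point t))" "continuous_on {0..1} (\<lambda>t. g (circle_point t))"
  shows "circle_mean (\<lambda>\<alpha>. f \<alpha> + cnj (g \<alpha>)) = circle_mean f + cnj (circle_mean g)"
  unfolding circle_mean_def
  by (subst Bochner_Integration.integral_add)
     (auto intro!: continuous_unit_interval(1) continuous_intros assms)

text \<open>
  Only one of the two holomorphic summands has a Fourier coefficient of a given nonzero index, and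
  that coefficient is homogeneous in the radius.
\<close>

lemma circle_mean_harmonic:
  assumes h: "harmonic_on h U" and U: "ball 0 1 \<subseteq> U"
  shows "\<exists>\<kappa>. \<forall>r. 0 < r \<and> r < 1 \<longrightarrow> circle_mean (\<lambda>\<alpha>. \<alpha> powi j * h (of_real r * \<alpha>)) = \<kappa> * of_real r ^ nat \<bar>j\<bar>"
proof -
  obtain G H where GH: "G holomorphic_on ball 0 1" "H holomorphic_on ball 0 1"
    "\<And>z. z \<in> ball 0 1 \<Longrightarrow> h z = G z + cnj (H z)"
    using harmonic_decomposition[OF h U] by blast
  have split: "circle_mean (\<lambda>\<alpha>. \<alpha> powi j * h (of_real r * \<alpha>)) =
      circle_mean (\<lambda>\<alpha>. \<alpha> powi j * G (of_real r * \<alpha>)) + cnj (circle_mean (\<lambda>\<alpha>. H (of_real r * \<alpha>) * \<alpha> powi (- j)))"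
    if r: "0 < r" "r < 1" for r :: real
  proof -
    have "circle_mean (\<lambda>\<alpha>. \<alpha> powi j * h (of_real r * \<alpha>)) =
       circle_mean (\<lambda>\<alpha>. \<alpha> powi j * G (of_real r * \<alpha>) + cnj (H (of_real r * \<alpha>) * \<alpha> powi (- j)))"
      unfolding circle_mean_def
    proof (rule Bochner_Integration.integral_cong[OF refl])
      fix t
      have "complex_of_real r * circle_point t \<in> ball 0 1" using r by (simp add: norm_mult)
      moreover have "cnj (circle_point t powi (- j)) = circle_point t powi j"
        by (simp add: power_int_minus cnj_circle_point power_int_divide_distrib)
      ultimately show "circle_point t powi j * h (of_real r * circle_point t) =
         circle_point t powi j * G (of_real r * circle_point t) +
         cnj (H (of_real r * circle_point t) * circle_point t powi - j)"
        by (simp add: GH(3) algebra_simps)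
    qed
    also have "\<dots> = circle_mean (\<lambda>\<alpha>. \<alpha> powi j * G (of_real r * \<alpha>)) + cnj (circle_mean (\<lambda>\<alpha>. H (of_real r * \<alpha>) * \<alpha> powi (- j)))"
      by (rule circle_mean_add_cnj)
         (use r in \<open>auto intro!: continuous_intros holomorphic_circle_cont GH\<close>)
    finally show ?thesis .
  qed
  show ?thesis
  proof (cases "j > 0")
    case True
    define n where "n = nat j"
    have n: "j = int n" "n > 0" using True by (auto simp: n_def)
    have "circle_mean (\<lambda>\<alpha>. \<alpha> powi j * h (of_real r * \<alpha>)) = cnj ((deriv ^^ n) H 0 / fact n) * of_real r ^ nat \<bar>j\<bar>"
      if r: "0 < r" "r < 1" for r :: real
      using split[OF r] circle_mean_positive_power[OF GH(1) r n(2)] circle_mean_coefficient_pos[OF GH(2) r, of n]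
      by (simp add: n power_int_minus mult_ac divide_inverse)
    then show ?thesis by blast
  next
    case False
    define n where "n = nat (- j)"
    have n: "j = - int n" using False by (auto simp: n_def)
    have "circle_mean (\<lambda>\<alpha>. \<alpha> powi j * h (of_real r * \<alpha>)) =
       ((deriv ^^ n) G 0 / fact n + (if n = 0 then cnj (H 0) else 0)) * of_real r ^ nat \<bar>j\<bar>"
      if r: "0 < r" "r < 1" for r :: real
      using split[OF r] circle_mean_positive_power[OF GH(2) r, of n] circle_mean_coefficient_pos[OF GH(2) r, of 0] circle_mean_coefficient_pos[OF GH(1) r, of n]
      by (simp add: n power_int_minus mult_ac divide_inverse)
    then show ?thesis by blast
  qed
qed

text \<open>
  By homogeneity in the radius the mean over any circle is controlled by the circle of radius \<open>1/2\<close>.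
  The bound does not degenerate as \<open>R\<close> tends to \<open>1\<close>, although \<open>h\<close> may be unbounded there.
\<close>

lemma circle_mean_harmonic_bound:
  fixes R :: real
  assumes h: "harmonic_on h U" and U: "ball 0 1 \<subseteq> U" and R: "0 < R" "R < 1"
    and M: "\<And>z. norm z = 1 / 2 \<Longrightarrow> norm (h z) \<le> M"
  shows "norm (circle_mean (\<lambda>\<alpha>. \<alpha> powi j * h (of_real R * \<alpha>))) \<le> 2 ^ nat \<bar>j\<bar> * M"
proof -
  obtain \<kappa> where \<kappa>: "\<And>r. 0 < r \<and> r < 1 \<Longrightarrow> circle_mean (\<lambda>\<alpha>. \<alpha> powi j * h (of_real r * \<alpha>)) = \<kappa> * of_real r ^ nat \<bar>j\<bar>"
    using circle_mean_harmonic[OF h U] by blast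
  interpret finite_measure unit_interval by (rule finite_measure_unit_interval)
  have M0: "M \<ge> 0" using order_trans[OF norm_ge_zero M[of "1/2"]] by simp
  have "norm (circle_mean (\<lambda>\<alpha>. \<alpha> powi j * h (of_real (1/2) * \<alpha>))) \<le> M"
  proof -
    have "norm (circle_mean (\<lambda>\<alpha>. \<alpha> powi j * h (of_real (1/2) * \<alpha>))) \<le> (\<integral>t. M \<partial>unit_interval)"
      unfolding circle_mean_def
    proof (rule Bochner_Integration.integral_norm_bound_integral)
      have "continuous_on U h" using h by (rule harmonic_on_imp_continuous_on)
      then have "continuous_on {0..1} (\<lambda>t. circle_point t powi j * h (of_real (1/2) * circle_point t))"
        by (intro continuous_intros) (use U in \<open>auto simp: norm_mult intro!: continuous_intros elim!: continuous_on_compose2\<close>)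
      then show "integrable unit_interval (\<lambda>t. circle_point t powi j * h (of_real (1/2) * circle_point t))"
        by (rule continuous_unit_interval(1))
    qed (auto simp: norm_mult norm_power_int intro!: M)
    then show ?thesis by (simp add: space_unit_interval)
  qed
  then have "norm \<kappa> * (1/2) ^ nat \<bar>j\<bar> \<le> M"
    using \<kappa>[of "1/2"] by (simp add: norm_mult norm_power norm_divide)
  then have "norm \<kappa> \<le> 2 ^ nat \<bar>j\<bar> * M"
    by (simp add: power_one_over field_simps)
  moreover have "norm (circle_mean (\<lambda>\<alpha>. \<alpha> powi j * h (of_real R * \<alpha>))) \<le> norm \<kappa> * 1"
    using \<kappa>[of R] R by (simp add: norm_mult norm_power mult_left_le power_le_one)
  ultimately show ?thesis by simp
qed

section \<open>Jordan parts of a complex measure\<close>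

text \<open>
  Real-valued set functions that satisfy the conditions of \<^const>\<open>complex_measure\<close>; the real and imaginary
  parts of a complex measure are of this kind.
\<close>

definition signed_measure :: "'a measure \<Rightarrow> ('a set \<Rightarrow> real) \<Rightarrow> bool" where
  "signed_measure M \<nu> \<longleftrightarrow>
     \<nu> {} = 0 \<and>
     (\<forall>A :: nat \<Rightarrow> 'a set. range A \<subseteq> sets M \<and> disjoint_family A \<longrightarrow>
        (\<lambda>i. \<nu> (A i)) sums \<nu> (\<Union>i. A i))"

text \<open>
  The set function from which \<^const>\<open>positive_part\<close> is built.
\<close>

definition positive_variation :: "'a measure \<Rightarrow> ('a set \<Rightarrow> real) \<Rightarrow> 'a set \<Rightarrow> ennreal" where
  "positive_variation M \<nu> A = (SUP E\<in>{E \<in> sets M. E \<subseteq> A}. ennreal (\<nu> E))"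

lemma signed_measureD:
  assumes "signed_measure M \<nu>"
  shows "\<nu> {} = 0"
    and "range A \<subseteq> sets M \<Longrightarrow> disjoint_family A \<Longrightarrow> (\<lambda>i. \<nu> (A i)) sums \<nu> (\<Union>i. A i)"
  using assms unfolding signed_measure_def by auto

lemma signed_measure_uminus: "signed_measure M \<nu> \<Longrightarrow> signed_measure M (\<lambda>A. - \<nu> A)"
  unfolding signed_measure_def by (auto intro: sums_minus)

lemma signed_measure_Un:
  assumes \<nu>: "signed_measure M \<nu>" and "A \<in> sets M" "B \<in> sets M" "A \<inter> B = {}"
  shows "\<nu> (A \<union> B) = \<nu> A + \<nu> B"
proof -
  have "(\<lambda>i. \<nu> (binaryset A B i)) sums \<nu> (\<Union>i. binaryset A B i)"
    by (rule signed_measureD(2)[OF \<nu>])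
       (use assms in \<open>auto simp: range_binaryset_eq disjoint_family_on_def binaryset_def\<close>)
  moreover have "(\<lambda>i. \<nu> (binaryset A B i)) sums (\<nu> A + \<nu> B)"
    by (rule binaryset_sums) (rule signed_measureD(1)[OF \<nu>])
  ultimately show ?thesis unfolding UN_binaryset_eq by (rule sums_unique2)
qed

lemma signed_measure_split:
  assumes \<nu>: "signed_measure M \<nu>" and "A \<in> sets M" "E \<in> sets M"
  shows "\<nu> A = \<nu> (A \<inter> E) + \<nu> (A - E)"
proof -
  have "(A \<inter> E) \<union> (A - E) = A" "(A \<inter> E) \<inter> (A - E) = {}" by blast+
  then show ?thesis
    using signed_measure_Un[OF \<nu>, of "A \<inter> E" "A - E"] assms(2,3) by simp
qed

lemma positive_variation_upper: "E \<in> sets M \<Longrightarrow> E \<subseteq> A \<Longrightarrow> ennreal (\<nu> E) \<le> positive_variation M \<nu> A"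
  unfolding positive_variation_def by (rule SUP_upper) auto

lemma positive_variation_mono: "A \<subseteq> B \<Longrightarrow> positive_variation M \<nu> A \<le> positive_variation M \<nu> B"
  unfolding positive_variation_def by (rule SUP_subset_mono) auto

lemma ennreal_add_le: "ennreal (a + b) \<le> ennreal a + ennreal b"
proof -
  have "ennreal (a + b) \<le> ennreal (max 0 a + max 0 b)" by (rule ennreal_leI) simp
  also have "\<dots> = ennreal (max 0 a) + ennreal (max 0 b)" by (rule ennreal_plus) auto
  also have "\<dots> = ennreal a + ennreal b" by (simp add: max_def ennreal_neg)
  finally show ?thesis .
qed

lemma positive_variation_subadditive:
  assumes \<nu>: "signed_measure M \<nu>" and E: "E \<in> sets M"
  shows "positive_variation M \<nu> A \<le> positive_variation M \<nu> (A \<inter> E) + positive_variation M \<nu> (A - E)"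
  unfolding positive_variation_def[of M \<nu> A]
proof (rule SUP_least)
  fix F assume F: "F \<in> {F \<in> sets M. F \<subseteq> A}"
  then have "ennreal (\<nu> F) = ennreal (\<nu> (F \<inter> E) + \<nu> (F - E))"
    using signed_measure_split[OF \<nu> _ E] by simp
  also have "\<dots> \<le> ennreal (\<nu> (F \<inter> E)) + ennreal (\<nu> (F - E))"
    by (rule ennreal_add_le)
  also have "\<dots> \<le> positive_variation M \<nu> (A \<inter> E) + positive_variation M \<nu> (A - E)"
    by (intro add_mono positive_variation_upper) (use F E in auto)
  finally show "ennreal (\<nu> F) \<le> positive_variation M \<nu> (A \<inter> E) + positive_variation M \<nu> (A - E)" .
qed

lemma positive_variation_superadditive:
  assumes \<nu>: "signed_measure M \<nu>" and AB: "A \<inter> B = {}"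
  shows "positive_variation M \<nu> A + positive_variation M \<nu> B \<le> positive_variation M \<nu> (A \<union> B)"
proof -
  have nonneg: "\<exists>E'\<in>sets M. E' \<subseteq> A \<and> ennreal (\<nu> E') = ennreal (\<nu> E) \<and> \<nu> E' \<ge> 0"
    if "E \<in> sets M" "E \<subseteq> A" for A E
  proof (cases "\<nu> E \<ge> 0")
    case True then show ?thesis using that by auto
  next
    case False then show ?thesis
      using signed_measureD(1)[OF \<nu>] by (intro bexI[of _ "{}"]) (auto simp: ennreal_neg)
  qed
  have pair: "ennreal (\<nu> E) + ennreal (\<nu> F) \<le> positive_variation M \<nu> (A \<union> B)"
    if EF: "E \<in> sets M" "E \<subseteq> A" "F \<in> sets M" "F \<subseteq> B" for E F
  proof -
    obtain E' where E': "E' \<in> sets M" "E' \<subseteq> A" "ennreal (\<nu> E') = ennreal (\<nu> E)" "\<nu> E' \<ge> 0"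
      using nonneg[OF EF(1,2)] by blast
    obtain F' where F': "F' \<in> sets M" "F' \<subseteq> B" "ennreal (\<nu> F') = ennreal (\<nu> F)" "\<nu> F' \<ge> 0"
      using nonneg[OF EF(3,4)] by blast
    have "ennreal (\<nu> E) + ennreal (\<nu> F) = ennreal (\<nu> E' + \<nu> F')"
      by (simp only: E'(3)[symmetric] F'(3)[symmetric] ennreal_plus[OF E'(4) F'(4)])
    also have "\<nu> E' + \<nu> F' = \<nu> (E' \<union> F')"
      by (rule signed_measure_Un[OF \<nu> E'(1) F'(1), symmetric]) (use E'(2) F'(2) AB in blast)
    also have "ennreal \<dots> \<le> positive_variation M \<nu> (A \<union> B)"
      by (rule positive_variation_upper) (use E' F' in auto)
    finally show ?thesis .
  qed
  have ne: "{E \<in> sets M. E \<subseteq> X} \<noteq> {}" for X by blast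
  have "ennreal (\<nu> E) + positive_variation M \<nu> B \<le> positive_variation M \<nu> (A \<union> B)"
    if "E \<in> sets M" "E \<subseteq> A" for E
    unfolding positive_variation_def[of M \<nu> B] ennreal_SUP_add_right[OF ne]
    by (rule SUP_least) (use pair that in auto)
  then show ?thesis
    unfolding positive_variation_def[of M \<nu> A] ennreal_SUP_add_left[OF ne, symmetric]
    by (intro SUP_least) auto
qed

lemma ennreal_sums_le:
  fixes f :: "nat \<Rightarrow> real"
  assumes "f sums s" shows "ennreal s \<le> (\<Sum>i. ennreal (f i))"
proof (rule LIMSEQ_le_const2)
  show "(\<lambda>n. ennreal (\<Sum>i<n. f i)) \<longlonglongrightarrow> ennreal s"
    using assms unfolding sums_def by (rule tendsto_ennrealI)
  have "ennreal (\<Sum>i<n. f i) \<le> (\<Sum>i<n. ennreal (f i))" for n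
  proof (induction n)
    case (Suc n)
    have "ennreal (sum f {..<n} + f n) \<le> ennreal (sum f {..<n}) + ennreal (f n)"
      by (rule ennreal_add_le)
    also have "\<dots> \<le> (\<Sum>i<n. ennreal (f i)) + ennreal (f n)" using Suc by (rule add_right_mono)
    finally show ?case by simp
  qed simp
  then have "ennreal (\<Sum>i<n. f i) \<le> (\<Sum>i. ennreal (f i))" for n
    by (rule order_trans) (rule sum_le_suminf, auto)
  then show "\<exists>N. \<forall>n\<ge>N. ennreal (\<Sum>i<n. f i) \<le> (\<Sum>i. ennreal (f i))" by simp
qed

lemma positive_variation_empty: "signed_measure M \<nu> \<Longrightarrow> positive_variation M \<nu> {} = 0"
  using signed_measureD(1)[of M \<nu>] by (auto simp: positive_variation_def intro!: antisym SUP_least)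

lemma positive_variation_countably_additive:
  assumes \<nu>: "signed_measure M \<nu>"
  shows "countably_additive (sets M) (positive_variation M \<nu>)"
  unfolding countably_additive_def
proof (intro allI impI antisym)
  fix A :: "nat \<Rightarrow> 'a set"
  assume A: "range A \<subseteq> sets M" and disj: "disjoint_family A"
  have fin: "(\<Sum>i<n. positive_variation M \<nu> (A i)) \<le> positive_variation M \<nu> (\<Union>i<n. A i)" for n
  proof (induction n)
    case (Suc n)
    have "A i \<inter> A n = {}" if "i < n" for i
      using disj that by (auto simp: disjoint_family_on_def)
    then have "(\<Union>i<n. A i) \<inter> A n = {}" by blast
    from positive_variation_superadditive[OF \<nu> this]
    have "positive_variation M \<nu> (\<Union>i<n. A i) + positive_variation M \<nu> (A n) \<le> positive_variation M \<nu> (\<Union>i<Suc n. A i)"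
      by (simp add: lessThan_Suc Un_commute)
    with add_right_mono[OF Suc, of "positive_variation M \<nu> (A n)"] show ?case
      by (simp only: sum.lessThan_Suc)
  qed simp
  show "(\<Sum>i. positive_variation M \<nu> (A i)) \<le> positive_variation M \<nu> (\<Union>i. A i)"
    unfolding suminf_eq_SUP
    by (rule SUP_least) (rule order_trans[OF fin positive_variation_mono], auto)
  show "positive_variation M \<nu> (\<Union>i. A i) \<le> (\<Sum>i. positive_variation M \<nu> (A i))"
    unfolding positive_variation_def[of M \<nu> "\<Union>i. A i"]
  proof (rule SUP_least)
    fix E assume E: "E \<in> {E \<in> sets M. E \<subseteq> (\<Union>i. A i)}"
    have "(\<lambda>i. \<nu> (E \<inter> A i)) sums \<nu> (\<Union>i. E \<inter> A i)"
      by (rule signed_measureD(2)[OF \<nu>]) (use E A disj in \<open>auto simp: disjoint_family_on_def\<close>)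
    also have "(\<Union>i. E \<inter> A i) = E" using E by auto
    finally have "ennreal (\<nu> E) \<le> (\<Sum>i. ennreal (\<nu> (E \<inter> A i)))" by (rule ennreal_sums_le)
    also have "\<dots> \<le> (\<Sum>i. positive_variation M \<nu> (A i))"
      by (intro suminf_le positive_variation_upper) (use E A in auto)
    finally show "ennreal (\<nu> E) \<le> (\<Sum>i. positive_variation M \<nu> (A i))" .
  qed
qed

text \<open>
  If \<open>\<nu> F\<close> is large compared with \<open>\<nu> A\<close>, then both \<open>F\<close> and \<open>A - F\<close> have measure at least \<open>1\<close> in modulus, and
  one of them still has infinite variation.
\<close>

lemma infinite_variation_split:
  assumes \<nu>: "signed_measure M \<nu>" and A: "A \<in> sets M" "positive_variation M \<nu> A = \<infinity>"
  shows "\<exists>E\<in>sets M. E \<subseteq> A \<and> positive_variation M \<nu> E = \<infinity> \<and> \<bar>\<nu> (A - E)\<bar> \<ge> 1"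
proof -
  have "ennreal (1 + \<bar>\<nu> A\<bar>) < positive_variation M \<nu> A" using A(2) by simp
  then obtain F where F: "F \<in> sets M" "F \<subseteq> A" "ennreal (1 + \<bar>\<nu> A\<bar>) < ennreal (\<nu> F)"
    unfolding positive_variation_def less_SUP_iff by blast
  then have F1: "\<nu> F > 1 + \<bar>\<nu> A\<bar>" by (subst (asm) ennreal_less_iff) auto
  have AF: "A \<inter> F = F" "A - (A - F) = F" using F(2) by auto
  have "\<nu> A = \<nu> F + \<nu> (A - F)" using signed_measure_split[OF \<nu> A(1) F(1)] AF by simp
  then have F2: "\<bar>\<nu> (A - F)\<bar> \<ge> 1" using F1 by linarith
  have "positive_variation M \<nu> F + positive_variation M \<nu> (A - F) = \<infinity>"
    using positive_variation_subadditive[OF \<nu> F(1), of A] A(2) AF by (simp add: top_unique)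
  then consider "positive_variation M \<nu> F = \<infinity>" | "positive_variation M \<nu> (A - F) = \<infinity>" by auto
  then show ?thesis
  proof cases
    case 1 then show ?thesis using F F2 by blast
  next
    case 2 then show ?thesis using F F1 A(1) AF by (intro bexI[of _ "A - F"]) auto
  qed
qed

text \<open>
  Otherwise one could peel off infinitely many disjoint sets of measure at least \<open>1\<close> in modulus, but
  the measures of disjoint sets form a convergent series.
\<close>

lemma positive_variation_finite:
  assumes \<nu>: "signed_measure M \<nu>" and A: "A \<in> sets M"
  shows "positive_variation M \<nu> A < \<infinity>"
proof (rule ccontr)
  assume "\<not> positive_variation M \<nu> A < \<infinity>"
  then have inf: "positive_variation M \<nu> A = \<infinity>" by (simp flip: less_top)
  have "\<exists>f. \<forall>n. (f n \<in> sets M \<and> positive_variation M \<nu> (f n) = \<infinity>) \<and> (f (Suc n) \<subseteq> f n \<and> \<bar>\<nu> (f n - f (Suc n))\<bar> \<ge> 1)"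
  proof (rule dependent_nat_choice)
    show "\<exists>x. x \<in> sets M \<and> positive_variation M \<nu> x = \<infinity>" using A inf by blast
    show "\<exists>y. (y \<in> sets M \<and> positive_variation M \<nu> y = \<infinity>) \<and> y \<subseteq> x \<and> 1 \<le> \<bar>\<nu> (x - y)\<bar>"
      if "x \<in> sets M \<and> positive_variation M \<nu> x = \<infinity>" for x n
      using infinite_variation_split[OF \<nu>, of x] that by blast
  qed
  then obtain f where f: "\<And>n. f n \<in> sets M" "\<And>n. f (Suc n) \<subseteq> f n" "\<And>n. \<bar>\<nu> (f n - f (Suc n))\<bar> \<ge> 1"
    by blast
  have dec: "f n \<subseteq> f m" if "m \<le> n" for m n using lift_Suc_antimono_le[of f, OF f(2) that] .
  have "disjoint_family (\<lambda>n. f n - f (Suc n))"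
    unfolding disjoint_family_on_def
  proof (intro ballI impI)
    fix m n :: nat assume "m \<noteq> n"
    then consider "Suc m \<le> n" | "Suc n \<le> m" by linarith
    then show "(f m - f (Suc m)) \<inter> (f n - f (Suc n)) = {}"
      by cases (use dec in blast)+
  qed
  then have "(\<lambda>n. \<nu> (f n - f (Suc n))) sums \<nu> (\<Union>n. f n - f (Suc n))"
    by (intro signed_measureD(2)[OF \<nu>]) (use f(1) in auto)
  then have "(\<lambda>n. \<nu> (f n - f (Suc n))) \<longlonglongrightarrow> 0"
    by (rule summable_LIMSEQ_zero[OF sums_summable])
  from LIMSEQ_D[OF this, of 1] obtain n where "norm (\<nu> (f n - f (Suc n)) - 0) < 1"
    by auto
  with f(3)[of n] show False by simp
qed

lemma sets_positive_part [simp]: "sets (positive_part M \<nu>) = sets M"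
  unfolding positive_part_def by (rule sets.sets_measure_of_eq)

lemma space_positive_part [simp]: "space (positive_part M \<nu>) = space M"
  unfolding positive_part_def by (rule sets.space_measure_of_eq)

lemma emeasure_positive_part:
  assumes \<nu>: "signed_measure M \<nu>" and A: "A \<in> sets M"
  shows "emeasure (positive_part M \<nu>) A = positive_variation M \<nu> A"
proof (rule emeasure_measure_of[OF _ _ _ _ ])
  show "positive_part M \<nu> = measure_of (space M) (sets M) (positive_variation M \<nu>)"
    unfolding positive_part_def positive_variation_def[abs_def] ..
  show "positive (sets (positive_part M \<nu>)) (positive_variation M \<nu>)"
    using positive_variation_empty[OF \<nu>] by (simp add: positive_def)
  show "countably_additive (sets (positive_part M \<nu>)) (positive_variation M \<nu>)"
    using positive_variation_countably_additive[OF \<nu>] by simp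
qed (use A sets.space_closed in auto)

lemma finite_measure_positive_part: "signed_measure M \<nu> \<Longrightarrow> finite_measure (positive_part M \<nu>)"
  using positive_variation_finite[of M \<nu> "space M"]
  by (intro finite_measureI) (simp add: emeasure_positive_part less_top)

text \<open>
  Writing \<open>\<nu> E = \<nu> A - \<nu> (A - E)\<close> turns the supremum that defines the positive part on \<open>A\<close> into \<open>\<nu> A\<close> plus
  the supremum that defines the negative part.
\<close>

lemma jordan_decomposition:
  assumes \<nu>: "signed_measure M \<nu>" and A: "A \<in> sets M"
  shows "\<nu> A = measure (positive_part M \<nu>) A - measure (positive_part M (\<lambda>A. - \<nu> A)) A"
proof -
  have le: "measure (positive_part M \<nu>) A \<le> \<nu> A + measure (positive_part M (\<lambda>A. - \<nu> A)) A"
    if \<nu>: "signed_measure M \<nu>" for \<nu>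
  proof -
    interpret p: finite_measure "positive_part M \<nu>" by (rule finite_measure_positive_part[OF \<nu>])
    interpret n: finite_measure "positive_part M (\<lambda>A. - \<nu> A)"
      by (rule finite_measure_positive_part[OF signed_measure_uminus[OF \<nu>]])
    have bound: "\<nu> E \<le> \<nu> A + measure (positive_part M (\<lambda>A. - \<nu> A)) A" if "E \<in> sets M" "E \<subseteq> A" for E
    proof -
      have "ennreal (- \<nu> (A - E)) \<le> emeasure (positive_part M (\<lambda>A. - \<nu> A)) A"
        unfolding emeasure_positive_part[OF signed_measure_uminus[OF \<nu>] A]
        by (rule positive_variation_upper[where \<nu> = "\<lambda>A. - \<nu> A"]) (use that A in auto)
      then have "- \<nu> (A - E) \<le> measure (positive_part M (\<lambda>A. - \<nu> A)) A"
        by (simp add: n.emeasure_eq_measure)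
      moreover have "\<nu> A = \<nu> E + \<nu> (A - E)"
        using signed_measure_split[OF \<nu> A that(1)] that(2) by (simp add: Int_absorb1)
      ultimately show ?thesis by simp
    qed
    have "0 \<le> \<nu> A + measure (positive_part M (\<lambda>A. - \<nu> A)) A"
      using bound[of "{}"] signed_measureD(1)[OF \<nu>] by simp
    moreover have "emeasure (positive_part M \<nu>) A \<le> ennreal (\<nu> A + measure (positive_part M (\<lambda>A. - \<nu> A)) A)"
      unfolding emeasure_positive_part[OF \<nu> A] positive_variation_def
      by (intro SUP_least ennreal_leI) (use bound in auto)
    ultimately show ?thesis by (simp add: p.emeasure_eq_measure)
  qed
  from le[OF \<nu>] le[OF signed_measure_uminus[OF \<nu>]] show ?thesis by simp
qed

text \<open>
  The positive and negative parts of the real and imaginary parts, indexed such that the \<open>k\<close>-th one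
  enters with the factor \<open>\<i> ^ k\<close>. Integrals against a complex measure become sums of four ordinary
  integrals.
\<close>

definition complex_part :: "'a measure \<Rightarrow> ('a set \<Rightarrow> complex) \<Rightarrow> nat \<Rightarrow> 'a measure" where
  "complex_part M \<mu> k = positive_part M (\<lambda>A. Re ((- \<i>) ^ k * \<mu> A))"

lemma sets_complex_part [simp]: "sets (complex_part M \<mu> k) = sets M"
  and space_complex_part [simp]: "space (complex_part M \<mu> k) = space M"
  by (simp_all add: complex_part_def)

lemma complex_measure_imp_signed:
  assumes "complex_measure M \<mu>" shows "signed_measure M (\<lambda>A. Re (c * \<mu> A))"
  using assms unfolding complex_measure_def signed_measure_def
  by (simp del: times_complex.sel add: sums_Re sums_mult)

lemma finite_measure_complex_part: "complex_measure M \<mu> \<Longrightarrow> finite_measure (complex_part M \<mu> k)"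
  unfolding complex_part_def by (intro finite_measure_positive_part complex_measure_imp_signed)

lemma sum_lessThan_4: "(\<Sum>k<4. f k) = f 0 + f 1 + f 2 + f (3::nat)" for f :: "nat \<Rightarrow> complex"
  by (simp add: eval_nat_numeral)

lemma complex_measure_eq_sum:
  assumes \<mu>: "complex_measure M \<mu>" and A: "A \<in> sets M"
  shows "\<mu> A = (\<Sum>k<4. \<i> ^ k * measure (complex_part M \<mu> k) A)"
proof -
  have "Re (\<mu> A) = measure (complex_part M \<mu> 0) A - measure (complex_part M \<mu> 2) A"
    using jordan_decomposition[OF complex_measure_imp_signed[OF \<mu>, of 1] A] by (simp add: complex_part_def)
  moreover have "Im (\<mu> A) = measure (complex_part M \<mu> 1) A - measure (complex_part M \<mu> 3) A"
    using jordan_decomposition[OF complex_measure_imp_signed[OF \<mu>, of "- \<i>"] A]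
    by (simp add: complex_part_def power3_eq_cube)
  ultimately show ?thesis
    unfolding sum_lessThan_4 by (simp add: complex_eq_iff power3_eq_cube)
qed

lemma complex_measure_integral_eq_sum:
  "complex_measure_integral M \<mu> f = (\<Sum>k<4. \<i> ^ k * integral\<^sup>L (complex_part M \<mu> k) f)"
  unfolding sum_lessThan_4
  by (simp add: complex_measure_integral_def signed_integral_def complex_part_def power3_eq_cube algebra_simps)

section \<open>Separated points on real analytic manifolds\<close>

lemma power_difference_bound:
  fixes x y :: real
  assumes "\<bar>x\<bar> \<le> s" "\<bar>y\<bar> \<le> s" "\<bar>x - y\<bar> \<le> d"
  shows "\<bar>x ^ k - y ^ k\<bar> * s \<le> real k * s ^ k * d"
proof (induction k)
  case (Suc k)
  have s: "0 \<le> s" using assms by linarith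
  have "\<bar>x ^ Suc k - y ^ Suc k\<bar> * s = \<bar>x * (x ^ k - y ^ k) + (x - y) * y ^ k\<bar> * s"
    by (simp add: algebra_simps)
  also have "\<dots> \<le> (\<bar>x\<bar> * \<bar>x ^ k - y ^ k\<bar> + \<bar>x - y\<bar> * \<bar>y\<bar> ^ k) * s"
    by (intro mult_right_mono order_trans[OF abs_triangle_ineq]) (simp_all add: abs_mult power_abs s)
  also have "\<dots> = \<bar>x\<bar> * (\<bar>x ^ k - y ^ k\<bar> * s) + \<bar>x - y\<bar> * (\<bar>y\<bar> ^ k * s)"
    by (simp add: algebra_simps)
  also have "\<dots> \<le> s * (real k * s ^ k * d) + d * (s ^ k * s)"
  proof (rule add_mono)
    show "\<bar>x\<bar> * (\<bar>x ^ k - y ^ k\<bar> * s) \<le> s * (real k * s ^ k * d)"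
      by (rule mult_mono) (use assms Suc s in auto)
    show "\<bar>x - y\<bar> * (\<bar>y\<bar> ^ k * s) \<le> d * (s ^ k * s)"
      by (rule mult_mono) (use assms s in \<open>auto intro!: mult_right_mono power_mono\<close>)
  qed
  finally show ?case by (simp add: algebra_simps)
qed simp

text \<open>
  The factor \<open>s\<close> on the left avoids exponents of the form \<open>n - 1\<close>.
\<close>

lemma monomial_difference_bound:
  fixes x y :: "'b \<Rightarrow> real"
  assumes "finite A" and xy: "\<And>b. b \<in> A \<Longrightarrow> \<bar>x b\<bar> \<le> s" "\<And>b. b \<in> A \<Longrightarrow> \<bar>y b\<bar> \<le> s" "\<And>b. b \<in> A \<Longrightarrow> \<bar>x b - y b\<bar> \<le> d"
    and s: "0 \<le> s"
  shows "\<bar>(\<Prod>b\<in>A. x b ^ a b) - (\<Prod>b\<in>A. y b ^ a b)\<bar> * s \<le> real (\<Sum>b\<in>A. a b) * s ^ (\<Sum>b\<in>A. a b) * d"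
  using assms
proof (induction A rule: finite_induct)
  case (insert b A)
  let ?P = "\<Prod>b\<in>A. x b ^ a b" and ?Q = "\<Prod>b\<in>A. y b ^ a b" and ?n = "\<Sum>b\<in>A. a b"
  have P: "\<bar>?P\<bar> \<le> s ^ ?n"
    unfolding abs_prod power_sum power_abs by (intro prod_mono) (use insert in \<open>auto intro!: power_mono\<close>)
  have d: "0 \<le> d" using insert.prems(3)[of b] by auto
  have IH: "\<bar>?P - ?Q\<bar> * s \<le> real ?n * s ^ ?n * d" by (rule insert.IH) (use insert.prems in auto)
  have pw: "\<bar>x b ^ a b - y b ^ a b\<bar> * s \<le> real (a b) * s ^ a b * d"
    by (rule power_difference_bound) (use insert.prems in auto)
  have "\<bar>x b ^ a b * ?P - y b ^ a b * ?Q\<bar> * s = \<bar>?P * (x b ^ a b - y b ^ a b) + y b ^ a b * (?P - ?Q)\<bar> * s"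
    by (simp add: algebra_simps)
  also have "\<dots> \<le> (\<bar>?P\<bar> * \<bar>x b ^ a b - y b ^ a b\<bar> + \<bar>y b\<bar> ^ a b * \<bar>?P - ?Q\<bar>) * s"
    by (intro mult_right_mono order_trans[OF abs_triangle_ineq]) (simp_all add: abs_mult power_abs s)
  also have "\<dots> = \<bar>?P\<bar> * (\<bar>x b ^ a b - y b ^ a b\<bar> * s) + \<bar>y b\<bar> ^ a b * (\<bar>?P - ?Q\<bar> * s)"
    by (simp add: algebra_simps)
  also have "\<dots> \<le> s ^ ?n * (real (a b) * s ^ a b * d) + s ^ a b * (real ?n * s ^ ?n * d)"
    by (intro add_mono mult_mono power_mono P pw IH) (use insert.prems s d in auto)
  finally show ?case using insert.hyps by (simp add: algebra_simps power_add)
qed simp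

lemma summable_on_finite_sum:
  fixes f :: "'e \<Rightarrow> 'i \<Rightarrow> real"
  assumes "finite E" "\<And>e. e \<in> E \<Longrightarrow> f e summable_on I"
  shows "(\<lambda>i. \<Sum>e\<in>E. f e i) summable_on I"
  using assms by (induction E rule: finite_induct) (auto intro: summable_on_add)

lemma summable_on_imp_abs_summable_on:
  fixes f :: "'i \<Rightarrow> 'b::euclidean_space"
  assumes "f summable_on I"
  shows "(\<lambda>i. norm (f i)) summable_on I"
proof -
  have "(\<lambda>i. \<Sum>e\<in>Basis. norm (f i \<bullet> e)) summable_on I"
  proof (rule summable_on_finite_sum[OF finite_Basis])
    fix e :: 'b
    have "(\<lambda>i. f i \<bullet> e) summable_on I"
      using summable_on_bounded_linear[OF bounded_linear_inner_left assms] by (simp add: o_def)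
    then show "(\<lambda>i. norm (f i \<bullet> e)) summable_on I"
      by (rule summable_on_iff_abs_summable_on_real[THEN iffD1])
  qed
  then show ?thesis
    by (rule summable_on_comparison_test) (auto intro: norm_le_l1)
qed

text \<open>
  Evaluating the power series at a point with all coordinates \<open>\<rho>\<close> shows that the coefficients, weighted
  by \<open>\<rho> ^ n\<close> in degree \<open>n\<close>, are summable. On the cube of half the size the Lipschitz constants of the monomials gain a
  factor \<open>2 ^ - n\<close> in degree \<open>n\<close>, which absorbs the factor \<open>n\<close> from differentiation.
\<close>

lemma real_analytic_locally_lipschitz:
  fixes f :: "'a::euclidean_space \<Rightarrow> 'b::euclidean_space"
  assumes "real_analytic_on f U" "p \<in> U"
  obtains \<delta> K where "\<delta> > 0" "K > 0" "\<And>x y. x \<in> ball p \<delta> \<Longrightarrow> y \<in> ball p \<delta> \<Longrightarrow> norm (f x - f y) \<le> K * norm (x - y)"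
proof -
  let ?I = "(Basis :: 'a set) \<rightarrow>\<^sub>E (UNIV :: nat set)"
  let ?t = "\<lambda>x \<alpha>. (\<Prod>b\<in>Basis. ((x - p) \<bullet> b) ^ \<alpha> b) :: real"
  from assms obtain r c where r: "r > 0" and
    hs: "\<And>x. x \<in> ball p r \<Longrightarrow> ((\<lambda>\<alpha>. ?t x \<alpha> *\<^sub>R c \<alpha>) has_sum f x) ?I"
    unfolding real_analytic_on_def by blast
  \<comment> \<open>the cube with half side \<open>\<rho>\<close> around \<open>p\<close> lies in the ball of radius \<open>r\<close>\<close>
  define \<rho> where "\<rho> = r / (2 * DIM('a))"
  have \<rho>: "\<rho> > 0" "\<rho> * DIM('a) < r" using r by (auto simp: \<rho>_def)
  define x0 where "x0 = p + (\<Sum>b\<in>Basis. \<rho> *\<^sub>R b)"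
  have x0b: "(x0 - p) \<bullet> b = \<rho>" if "b \<in> Basis" for b
    using that by (simp add: x0_def inner_sum_left inner_Basis if_distrib[of "\<lambda>x. _ * x"] cong: if_cong)
  have "norm (x0 - p) \<le> (\<Sum>b\<in>(Basis :: 'a set). \<rho>)"
    unfolding x0_def using \<rho> by (auto intro!: order_trans[OF norm_sum] sum_mono)
  then have "x0 \<in> ball p r" using \<rho> by (auto simp: dist_norm norm_minus_commute mult.commute)
  from hs[OF this] have "(\<lambda>\<alpha>. ?t x0 \<alpha> *\<^sub>R c \<alpha>) summable_on ?I" by (auto simp: summable_on_def)
  then have "(\<lambda>\<alpha>. norm (?t x0 \<alpha> *\<^sub>R c \<alpha>)) summable_on ?I" by (rule summable_on_imp_abs_summable_on)
  define deg where "deg \<alpha> = (\<Sum>b\<in>Basis. \<alpha> b)" for \<alpha> :: "'a \<Rightarrow> nat"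
  have t0: "norm (?t x0 \<alpha> *\<^sub>R c \<alpha>) = \<rho> ^ deg \<alpha> * norm (c \<alpha>)" for \<alpha>
    using \<rho> by (simp add: x0b deg_def power_sum abs_prod power_abs)
  then have W: "(\<lambda>\<alpha>. \<rho> ^ deg \<alpha> * norm (c \<alpha>)) summable_on ?I"
    using \<open>(\<lambda>\<alpha>. norm (?t x0 \<alpha> *\<^sub>R c \<alpha>)) summable_on ?I\<close> by (simp only: t0)
  define S where "S = infsum (\<lambda>\<alpha>. \<rho> ^ deg \<alpha> * norm (c \<alpha>)) ?I"
  have S: "S \<ge> 0" unfolding S_def using \<rho> by (intro infsum_nonneg) auto
  have "DIM('a) \<ge> 1" by (simp add: Suc_leI)
  then have Ble: "real DIM('a) \<ge> 1" by linarith
  have "\<rho> * 1 \<le> \<rho> * real DIM('a)" by (rule mult_left_mono[OF Ble]) (use \<rho> in simp)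
  then have \<rho>r: "\<rho> \<le> r" using \<rho>(2) by linarith
  show thesis
  proof (rule that[of "\<rho> / 2" "2 / \<rho> * S + 1"])
    show "\<rho> / 2 > 0" "2 / \<rho> * S + 1 > 0" using \<rho> S by (auto intro: add_nonneg_pos)
    fix x y assume xy: "x \<in> ball p (\<rho> / 2)" "y \<in> ball p (\<rho> / 2)"
    have in_r: "x \<in> ball p r" "y \<in> ball p r" using xy \<rho> \<rho>r by auto
    have coord: "\<bar>(z - p) \<bullet> b\<bar> \<le> \<rho> / 2" if "z \<in> ball p (\<rho> / 2)" "b \<in> Basis" for z b
      using Basis_le_norm[OF that(2), of "z - p"] that(1) by (auto simp: dist_norm norm_minus_commute)
    have termwise: "norm (?t x \<alpha> *\<^sub>R c \<alpha> - ?t y \<alpha> *\<^sub>R c \<alpha>) \<le> 2 / \<rho> * norm (x - y) * (\<rho> ^ deg \<alpha> * norm (c \<alpha>))" for \<alpha>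
    proof -
      have "\<bar>?t x \<alpha> - ?t y \<alpha>\<bar> * (\<rho> / 2) \<le> real (deg \<alpha>) * (\<rho> / 2) ^ deg \<alpha> * norm (x - y)"
        unfolding deg_def
      proof (rule monomial_difference_bound)
        fix b :: 'a assume b: "b \<in> Basis"
        show "\<bar>(x - p) \<bullet> b - (y - p) \<bullet> b\<bar> \<le> norm (x - y)"
          using Basis_le_norm[OF b, of "x - y"] by (simp add: inner_diff_left)
      qed (use coord xy \<rho> in auto)
      also have "\<dots> \<le> 2 ^ deg \<alpha> * (\<rho> / 2) ^ deg \<alpha> * norm (x - y)"
        using \<rho> by (intro mult_right_mono) (auto simp: less_imp_le of_nat_less_two_power)
      also have "\<dots> = \<rho> ^ deg \<alpha> * norm (x - y)" by (simp flip: power_mult_distrib)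
      finally have "\<bar>?t x \<alpha> - ?t y \<alpha>\<bar> \<le> 2 / \<rho> * norm (x - y) * \<rho> ^ deg \<alpha>"
        using \<rho> by (simp add: field_simps)
      from mult_right_mono[OF this norm_ge_zero[of "c \<alpha>"]] show ?thesis
        by (simp flip: scaleR_diff_left add: mult.assoc)
    qed
    have D: "((\<lambda>\<alpha>. ?t x \<alpha> *\<^sub>R c \<alpha> - ?t y \<alpha> *\<^sub>R c \<alpha>) has_sum (f x - f y)) ?I"
      using has_sum_add[OF hs[OF in_r(1)] has_sum_uminus[THEN iffD2], of "\<lambda>\<alpha>. ?t y \<alpha> *\<^sub>R c \<alpha>" "- f y"] hs[OF in_r(2)] by simp
    have sum2: "(\<lambda>\<alpha>. 2 / \<rho> * norm (x - y) * (\<rho> ^ deg \<alpha> * norm (c \<alpha>))) summable_on ?I"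
      by (rule summable_on_cmult_right[OF W])
    have "norm (f x - f y) \<le> infsum (\<lambda>\<alpha>. 2 / \<rho> * norm (x - y) * (\<rho> ^ deg \<alpha> * norm (c \<alpha>))) ?I"
      by (rule norm_infsum_le[OF D has_sum_infsum[OF sum2] termwise])
    also have "\<dots> = 2 / \<rho> * norm (x - y) * S" unfolding S_def by (rule infsum_cmult_right')
    also have "\<dots> \<le> (2 / \<rho> * S + 1) * norm (x - y)" by (simp add: algebra_simps)
    finally show "norm (f x - f y) \<le> (2 / \<rho> * S + 1) * norm (x - y)" .
  qed
qed

text \<open>
  The preimage under a slice chart of a grid with \<open>N ^ m\<close> points in an \<open>m\<close>-dimensional subspace. The chart
  is Lipschitz, so the preimages of points at distance \<open>t / N\<close> cannot be much closer than that.
\<close>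

lemma submanifold_separated_points:
  fixes M :: "'a::euclidean_space set"
  assumes M: "real_analytic_submanifold m M" and p: "p \<in> M"
  obtains \<sigma> where "\<sigma> > 0" "\<And>N::nat. N \<ge> 1 \<Longrightarrow> \<exists>P\<subseteq>M. finite P \<and> card P = N ^ m \<and> (\<forall>x\<in>P. \<forall>y\<in>P. x \<noteq> y \<longrightarrow> dist x y \<ge> \<sigma> / N)"
proof -
  from M[unfolded real_analytic_submanifold_def, rule_format, OF p]
  obtain U V \<Phi> \<Psi> and L :: "'a set" where
    U: "open U" "p \<in> U" and V: "open V" and hom: "homeomorphism U V \<Phi> \<Psi>"
    and an: "real_analytic_on \<Phi> U" and L: "subspace L" "dim L = m" and im: "\<Phi> ` (U \<inter> M) = V \<inter> L"
    by - (elim exE conjE, rule that, assumption+)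
  obtain \<delta> K where \<delta>: "\<delta> > 0" and K: "K > 0"
    and lip: "\<And>x y. x \<in> ball p \<delta> \<Longrightarrow> y \<in> ball p \<delta> \<Longrightarrow> norm (\<Phi> x - \<Phi> y) \<le> K * norm (x - y)"
    using real_analytic_locally_lipschitz[OF an U(2)] by blast
  have \<Phi>p: "\<Phi> p \<in> V" "\<Phi> p \<in> L" using im U p by auto
  have \<Psi>\<Phi>: "\<Psi> (\<Phi> x) = x" if "x \<in> U" for x using hom that by (simp add: homeomorphism_def)
  have "continuous_on V \<Psi>" using hom by (simp add: homeomorphism_def)
  then have "open (\<Psi> -` ball p \<delta> \<inter> V)" using V continuous_on_open_vimage[OF V, of \<Psi>] by blast
  moreover have "\<Phi> p \<in> \<Psi> -` ball p \<delta> \<inter> V" using \<Phi>p \<Psi>\<Phi>[OF U(2)] \<delta> by simp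
  ultimately obtain \<eta> where \<eta>: "\<eta> > 0" "ball (\<Phi> p) \<eta> \<subseteq> \<Psi> -` ball p \<delta> \<inter> V"
    by (rule openE)
  obtain Bs where Bs: "Bs \<subseteq> L" "pairwise orthogonal Bs" "\<And>x. x \<in> Bs \<Longrightarrow> norm x = 1" "independent Bs" "card Bs = dim L" "span Bs = L"
    using orthonormal_basis_subspace[OF L(1)] by blast
  have finB: "finite Bs" using Bs(4) by (rule independent_imp_finite)
  define t where "t = \<eta> / (m + 1)"
  have t: "t > 0" "t * m < \<eta>" using \<eta>(1) by (auto simp: t_def field_simps)
  show thesis
  proof (rule that[of "t / K"])
    show "t / K > 0" using t K by simp
    fix N :: nat assume N: "N \<ge> 1"
    define q where "q \<kappa> = \<Phi> p + (\<Sum>b\<in>Bs. (t * real (\<kappa> b) / N) *\<^sub>R b)" for \<kappa> :: "'a \<Rightarrow> nat"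
    let ?I = "Bs \<rightarrow>\<^sub>E {..<N}"
    have qV: "q \<kappa> \<in> ball (\<Phi> p) \<eta>" if "\<kappa> \<in> ?I" for \<kappa>
    proof -
      have "norm (\<Sum>b\<in>Bs. (t * real (\<kappa> b) / N) *\<^sub>R b) \<le> (\<Sum>b\<in>Bs. t)"
      proof (intro order_trans[OF norm_sum] sum_mono)
        fix b assume b: "b \<in> Bs"
        then have "real (\<kappa> b) \<le> N" using that by (force simp: PiE_iff less_imp_le)
        then show "norm ((t * real (\<kappa> b) / N) *\<^sub>R b) \<le> t"
          using Bs(3)[OF b] t N by (simp add: field_simps)
      qed
      also have "\<dots> < \<eta>" using t Bs(5) L(2) by (simp add: mult.commute)
      finally show ?thesis by (simp add: q_def dist_norm)
    qed
    have qL: "q \<kappa> \<in> L" for \<kappa>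
      unfolding q_def by (intro subspace_add subspace_sum subspace_mul L(1) \<Phi>p(2)) (use Bs(1) in auto)
    have qdiff: "norm (q \<kappa> - q \<kappa>') \<ge> t / N" if distinct: "\<kappa> \<in> ?I" "\<kappa>' \<in> ?I" "\<kappa> \<noteq> \<kappa>'" for \<kappa> \<kappa>'
    proof -
      obtain b where b: "b \<in> Bs" "\<kappa> b \<noteq> \<kappa>' b"
        using PiE_ext[OF distinct(1,2)] distinct(3) by blast
      have coef: "(\<Sum>b\<in>Bs. (t * real (\<kappa> b) / N) *\<^sub>R b) \<bullet> b = t * real (\<kappa> b) / N" for \<kappa>
      proof -
        have "(\<Sum>b'\<in>Bs. (t * real (\<kappa> b') / N) *\<^sub>R b') \<bullet> b = (\<Sum>b'\<in>Bs. if b' = b then t * real (\<kappa> b) / N else 0)"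
          unfolding inner_sum_left
        proof (rule sum.cong[OF refl])
          fix b' assume b': "b' \<in> Bs"
          show "(t * real (\<kappa> b') / N) *\<^sub>R b' \<bullet> b = (if b' = b then t * real (\<kappa> b) / N else 0)"
            using Bs(2) b b' Bs(3)[OF b(1)] by (auto simp: pairwise_def orthogonal_def dot_square_norm)
        qed
        then show ?thesis using finB b by simp
      qed
      have "(q \<kappa> - q \<kappa>') \<bullet> b = t / N * (real (\<kappa> b) - real (\<kappa>' b))"
        by (simp add: q_def inner_diff_left inner_add_left coef right_diff_distrib diff_divide_distrib)
      then have "\<bar>(q \<kappa> - q \<kappa>') \<bullet> b\<bar> = t / N * \<bar>real (\<kappa> b) - real (\<kappa>' b)\<bar>"
        using t N by (simp add: abs_mult)
      moreover have "t / N * 1 \<le> t / N * \<bar>real (\<kappa> b) - real (\<kappa>' b)\<bar>"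
        by (rule mult_left_mono) (use b(2) t N in linarith, use t in simp)
      ultimately have "\<bar>(q \<kappa> - q \<kappa>') \<bullet> b\<bar> \<ge> t / N" by simp
      moreover have "\<bar>(q \<kappa> - q \<kappa>') \<bullet> b\<bar> \<le> norm (q \<kappa> - q \<kappa>')"
        using Cauchy_Schwarz_ineq2[of "q \<kappa> - q \<kappa>'" b] Bs(3)[OF b(1)] by simp
      ultimately show ?thesis by linarith
    qed
    have preim: "\<Psi> (q \<kappa>) \<in> M \<inter> ball p \<delta> \<and> \<Phi> (\<Psi> (q \<kappa>)) = q \<kappa>" if "\<kappa> \<in> ?I" for \<kappa>
    proof -
      have "q \<kappa> \<in> V \<inter> L" using qV[OF that] \<eta>(2) qL by auto
      then obtain y where "y \<in> U" "y \<in> M" "q \<kappa> = \<Phi> y" using im by blast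
      then show ?thesis using \<Psi>\<Phi> qV[OF that] \<eta>(2) by auto
    qed
    have dist: "dist (\<Psi> (q \<kappa>)) (\<Psi> (q \<kappa>')) \<ge> t / K / N" if "\<kappa> \<in> ?I" "\<kappa>' \<in> ?I" "\<kappa> \<noteq> \<kappa>'" for \<kappa> \<kappa>'
    proof -
      have "norm (q \<kappa> - q \<kappa>') \<le> K * norm (\<Psi> (q \<kappa>) - \<Psi> (q \<kappa>'))"
        using lip[of "\<Psi> (q \<kappa>)" "\<Psi> (q \<kappa>')"] preim[OF that(1)] preim[OF that(2)] by simp
      with qdiff[OF that] have "t / N \<le> K * norm (\<Psi> (q \<kappa>) - \<Psi> (q \<kappa>'))" by (rule order_trans)
      then show ?thesis using K N by (simp add: dist_norm field_simps)
    qed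
    have pos: "t / K / N > 0" using t K N by simp
    have inj: "inj_on (\<lambda>\<kappa>. \<Psi> (q \<kappa>)) ?I"
    proof (rule inj_onI, rule ccontr)
      fix \<kappa> \<kappa>' assume "\<kappa> \<in> ?I" "\<kappa>' \<in> ?I" "\<Psi> (q \<kappa>) = \<Psi> (q \<kappa>')" "\<kappa> \<noteq> \<kappa>'"
      with dist[of \<kappa> \<kappa>'] pos show False by simp
    qed
    show "\<exists>P\<subseteq>M. finite P \<and> card P = N ^ m \<and> (\<forall>x\<in>P. \<forall>y\<in>P. x \<noteq> y \<longrightarrow> dist x y \<ge> t / K / N)"
    proof (intro exI[of _ "(\<lambda>\<kappa>. \<Psi> (q \<kappa>)) ` ?I"] conjI)
      show "(\<lambda>\<kappa>. \<Psi> (q \<kappa>)) ` ?I \<subseteq> M" using preim by auto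
      show "finite ((\<lambda>\<kappa>. \<Psi> (q \<kappa>)) ` ?I)" using finB by (intro finite_imageI finite_PiE) auto
      show "card ((\<lambda>\<kappa>. \<Psi> (q \<kappa>)) ` ?I) = N ^ m"
        using card_image[OF inj] finB Bs(5) L(2) by (simp add: card_PiE)
      show "\<forall>x\<in>(\<lambda>\<kappa>. \<Psi> (q \<kappa>)) ` ?I. \<forall>y\<in>(\<lambda>\<kappa>. \<Psi> (q \<kappa>)) ` ?I. x \<noteq> y \<longrightarrow> dist x y \<ge> t / K / N"
      proof (intro ballI impI)
        fix x y assume "x \<in> (\<lambda>\<kappa>. \<Psi> (q \<kappa>)) ` ?I" "y \<in> (\<lambda>\<kappa>. \<Psi> (q \<kappa>)) ` ?I" "x \<noteq> y"
        then obtain \<kappa> \<kappa>' where "\<kappa> \<in> ?I" "\<kappa>' \<in> ?I" "x = \<Psi> (q \<kappa>)" "y = \<Psi> (q \<kappa>')" by blast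
        with \<open>x \<noteq> y\<close> show "dist x y \<ge> t / K / N" using dist[of \<kappa> \<kappa>'] by auto
      qed
    qed
  qed
qed

section \<open>Ball masses and circle-invariant null sets\<close>

lemma space_borel_on: "space (borel_on B) = B"
  by (simp add: borel_on_def space_restrict_space)

lemma sets_borel_on_Int: "A \<in> sets borel \<Longrightarrow> B \<inter> A \<in> sets (borel_on B)"
  by (auto simp: borel_on_def sets_restrict_space)

text \<open>
  About \<open>r ^ - m\<close> balls of radius \<open>r\<close> around separated points are disjoint, and all have the same mass.
\<close>

lemma homogeneous_ball_mass_bound:
  fixes \<beta> :: "'a::euclidean_space measure"
  assumes sets: "sets \<beta> = sets (borel_on B)" and one: "emeasure \<beta> (space \<beta>) = 1"
    and man: "real_analytic_submanifold m B" and p: "p \<in> B"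
    and hom: "\<And>\<zeta> r. \<zeta> \<in> B \<Longrightarrow> measure \<beta> (B \<inter> ball \<zeta> r) = measure \<beta> (B \<inter> ball p r)"
  obtains c where "c > 0" "\<And>\<zeta> r. \<zeta> \<in> B \<Longrightarrow> r > 0 \<Longrightarrow> measure \<beta> (B \<inter> ball \<zeta> r) \<le> c * r ^ m"
proof -
  interpret finite_measure \<beta> by standard (simp add: one)
  have ms: "B \<inter> ball \<zeta> r \<in> sets \<beta>" for \<zeta> r unfolding sets by (rule sets_borel_on_Int) auto
  have le1: "measure \<beta> A \<le> 1" for A
    using bounded_measure[of A] one by (simp add: measure_def)
  obtain \<sigma> where \<sigma>: "\<sigma> > 0" and sep: "\<And>N::nat. N \<ge> 1 \<Longrightarrow> \<exists>P\<subseteq>B. finite P \<and> card P = N ^ m \<and> (\<forall>x\<in>P. \<forall>y\<in>P. x \<noteq> y \<longrightarrow> dist x y \<ge> \<sigma> / N)"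
    using submanifold_separated_points[OF man p] by blast
  have bound: "measure \<beta> (B \<inter> ball p r) \<le> (4 / \<sigma>) ^ m * r ^ m" if r: "r > 0" for r
  proof (cases "r \<ge> \<sigma> / 2")
    case True
    then have "4 / \<sigma> * r \<ge> 1" using \<sigma> by (simp add: field_simps)
    then have "(4 / \<sigma>) ^ m * r ^ m \<ge> 1" by (simp flip: power_mult_distrib)
    then show ?thesis using le1 order_trans by blast
  next
    case False
    \<comment> \<open>the finest grid whose points have distance at least \<open>2 * r\<close>\<close>
    define N where "N = nat \<lfloor>\<sigma> / (2 * r)\<rfloor>"
    have big: "\<sigma> / (2 * r) > 1" using False r by (simp add: field_simps)
    then have N1: "N \<ge> 1" unfolding N_def by linarith
    have Nle: "real N \<le> \<sigma> / (2 * r)" using big unfolding N_def by linarith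
    have Nge: "real N + 1 > \<sigma> / (2 * r)" using big unfolding N_def by linarith
    have N4: "\<sigma> / (4 * r) \<le> real N"
    proof -
      have "\<sigma> < 2 * r * (real N + 1)" using Nge r by (simp add: field_simps)
      moreover have "r * 1 \<le> r * real N" by (rule mult_left_mono) (use N1 r in auto)
      ultimately have "\<sigma> \<le> 4 * r * real N" by (simp add: algebra_simps)
      then show ?thesis using r by (simp add: field_simps)
    qed
    obtain P where P: "P \<subseteq> B" "finite P" "card P = N ^ m" "\<forall>x\<in>P. \<forall>y\<in>P. x \<noteq> y \<longrightarrow> dist x y \<ge> \<sigma> / N"
      using sep[OF N1] by blast
    have "2 * r \<le> \<sigma> / N" using Nle N1 r by (simp add: field_simps)
    then have disj: "disjoint_family_on (\<lambda>x. B \<inter> ball x r) P"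
      unfolding disjoint_family_on_def
    proof (intro ballI impI)
      fix x y assume "x \<in> P" "y \<in> P" "x \<noteq> y" "2 * r \<le> \<sigma> / N"
      then have "dist x y \<ge> 2 * r" using P(4) by fastforce
      then show "(B \<inter> ball x r) \<inter> (B \<inter> ball y r) = {}"
      proof -
        have False if "z \<in> ball x r" "z \<in> ball y r" for z
          using that dist_triangle2[of x y z] \<open>dist x y \<ge> 2 * r\<close> by simp
        then show ?thesis by blast
      qed
    qed
    have "real N ^ m * measure \<beta> (B \<inter> ball p r) = (\<Sum>x\<in>P. measure \<beta> (B \<inter> ball x r))"
      using hom P(1,3) by (simp add: subset_eq)
    also have "\<dots> = measure \<beta> (\<Union>x\<in>P. B \<inter> ball x r)"
      by (rule finite_measure_finite_Union[symmetric]) (use P(2) ms disj in auto)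
    also have "\<dots> \<le> 1" by (rule le1)
    finally have "measure \<beta> (B \<inter> ball p r) \<le> (1 / real N) ^ m"
      using N1 by (simp add: field_simps power_one_over)
    also have "\<dots> \<le> (4 / \<sigma> * r) ^ m"
    proof (rule power_mono)
      have "1 \<le> real N * (4 / \<sigma> * r)" using N4 \<sigma> r by (simp add: field_simps)
      then show "1 / real N \<le> 4 / \<sigma> * r" using N1 by (simp add: field_simps)
    qed simp
    finally show ?thesis by (simp only: power_mult_distrib)
  qed
  show thesis by (rule that[of "(4 / \<sigma>) ^ m"]) (use \<sigma> bound hom in auto)
qed

lemma norm_scalar_mult [simp]: "norm (\<alpha> *s (z :: complex^'n)) = cmod \<alpha> * norm z"
proof -
  have "(\<Sum>i\<in>UNIV. (cmod (\<alpha> * z $ i))\<^sup>2) = (cmod \<alpha>)\<^sup>2 * (\<Sum>i\<in>UNIV. (cmod (z $ i))\<^sup>2)"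
    by (simp add: norm_mult power_mult_distrib sum_distrib_left)
  then show ?thesis by (simp add: norm_vec_def L2_set_def real_sqrt_mult)
qed

lemma dist_scalar_mult: "dist (\<alpha> *s x) (\<alpha> *s (y :: complex^'n)) = cmod \<alpha> * dist x y"
  by (simp add: dist_norm flip: vector_ssub_ldistrib)

lemma dist_cis_le: "cmod (cis a - cis b) \<le> \<bar>a - b\<bar>"
proof -
  have "cmod (cis a - cis b) = cmod (cis b * (cis (a - b) - 1))"
    by (simp add: algebra_simps cis_mult)
  also have "\<dots> = cmod (cis (a - b) - 1)" by (simp add: norm_mult)
  also have "\<dots> = 2 * \<bar>sin ((a - b) / 2)\<bar>"
  proof -
    have half: "2 * ((a - b) / 2) = a - b" by simp
    have "(cmod (cis (a - b) - 1))\<^sup>2 = (cos (a - b) - 1)\<^sup>2 + (sin (a - b))\<^sup>2" by (simp add: cmod_power2)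
    also have "\<dots> = 2 - 2 * cos (a - b)" using sin_cos_squared_add3[of "a - b"] by (simp add: power2_eq_square algebra_simps)
    also have "\<dots> = (2 * \<bar>sin ((a - b) / 2)\<bar>)\<^sup>2"
      using cos_double_sin[of "(a - b) / 2", unfolded half] by (simp add: power_mult_distrib)
    finally show ?thesis by (rule power2_eq_imp_eq) auto
  qed
  also have "\<dots> \<le> \<bar>a - b\<bar>" using abs_sin_x_le_abs_x[of "(a - b) / 2"] by simp
  finally show ?thesis .
qed

definition circle_tube :: "(complex^'n) set \<Rightarrow> complex^'n \<Rightarrow> real \<Rightarrow> (complex^'n) set" where
  "circle_tube B x d = {z \<in> B. \<exists>\<alpha>. cmod \<alpha> = 1 \<and> dist z (\<alpha> *s x) < d}"

definition circle_invariant :: "(complex^'n) set \<Rightarrow> bool" where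
  "circle_invariant A \<longleftrightarrow> (\<forall>z\<in>A. \<forall>\<alpha>. cmod \<alpha> = 1 \<longrightarrow> \<alpha> *s z \<in> A)"

lemma circle_invariant_tube:
  assumes "circle_invariant B" shows "circle_invariant (circle_tube B x d)"
  unfolding circle_invariant_def
proof (intro ballI allI impI)
  fix z \<gamma> assume z: "z \<in> circle_tube B x d" and \<gamma>: "cmod \<gamma> = 1"
  then obtain \<alpha> where \<alpha>: "cmod \<alpha> = 1" "dist z (\<alpha> *s x) < d" and zB: "z \<in> B" by (auto simp: circle_tube_def)
  have "dist (\<gamma> *s z) ((\<gamma> * \<alpha>) *s x) < d"
    using dist_scalar_mult[of \<gamma> z "\<alpha> *s x"] \<gamma> \<alpha> by (simp add: vector_smult_assoc)
  moreover have "\<gamma> *s z \<in> B" using assms zB \<gamma> by (auto simp: circle_invariant_def)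
  moreover have "cmod (\<gamma> * \<alpha>) = 1" using \<gamma> \<alpha> by (simp add: norm_mult)
  ultimately show "\<gamma> *s z \<in> circle_tube B x d" unfolding circle_tube_def by blast
qed

lemma sets_circle_tube: "circle_tube B x d \<in> sets (borel_on B)"
proof -
  have "circle_tube B x d = B \<inter> (\<Union>\<alpha>\<in>{\<alpha>. cmod \<alpha> = 1}. ball (\<alpha> *s x) d)"
    by (auto simp: circle_tube_def dist_commute)
  also have "\<dots> \<in> sets (borel_on B)" by (intro sets_borel_on_Int borel_open open_UN ballI open_ball)
  finally show ?thesis .
qed

text \<open>
  Equidistant points on the circle through \<open>x\<close> with spacing at most \<open>d\<close>.
\<close>

lemma circle_tube_cover:
  assumes x: "norm x = 1" and d: "d > 0"
  shows "circle_tube B x (2 * d) \<subseteq> (\<Union>k<nat \<lceil>2 * pi / d\<rceil>. B \<inter> ball (cis (2 * pi * k / nat \<lceil>2 * pi / d\<rceil>) *s x) (3 * d))"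
proof
  fix z assume "z \<in> circle_tube B x (2 * d)"
  then obtain \<alpha> where \<alpha>: "cmod \<alpha> = 1" "dist z (\<alpha> *s x) < 2 * d" and zB: "z \<in> B" by (auto simp: circle_tube_def)
  define N where "N = nat \<lceil>2 * pi / d\<rceil>"
  have "2 * pi / d > 0" using d by simp
  then have N: "N > 0" "real N \<ge> 2 * pi / d" unfolding N_def by linarith+
  obtain \<theta> where \<theta>: "0 \<le> \<theta>" "\<theta> < 2 * pi" "\<alpha> = cis \<theta>"
    using Arg2pi_ge_0[of \<alpha>] Arg2pi_lt_2pi[of \<alpha>] Arg2pi_eq[of \<alpha>] \<alpha>(1) by (intro that[of "Arg2pi \<alpha>"]) (auto simp: cis_conv_exp)
  define k where "k = nat \<lfloor>\<theta> * N / (2 * pi)\<rfloor>"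
  have t: "0 \<le> \<theta> * N / (2 * pi)" "\<theta> * N / (2 * pi) < N" using \<theta> N by (auto simp: field_simps)
  have k: "real k \<le> \<theta> * N / (2 * pi)" "\<theta> * N / (2 * pi) < real k + 1" using t unfolding k_def by linarith+
  have kN: "k < N" using k t by linarith
  have "\<theta> - 2 * pi * k / N = 2 * pi / N * (\<theta> * N / (2 * pi) - k)" using N(1) by (simp add: field_simps)
  then have "\<bar>\<theta> - 2 * pi * k / N\<bar> = 2 * pi / N * \<bar>\<theta> * N / (2 * pi) - k\<bar>" by (simp add: abs_mult)
  also have "\<dots> \<le> 2 * pi / N * 1" by (rule mult_left_mono) (use k in auto)
  finally have "\<bar>\<theta> - 2 * pi * k / N\<bar> \<le> 2 * pi / N" by simp
  also have "\<dots> \<le> d" using N d by (simp add: field_simps)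
  finally have "cmod (\<alpha> - cis (2 * pi * k / N)) \<le> d" using dist_cis_le[of \<theta> "2 * pi * k / N"] \<theta>(3) by simp
  moreover have "dist (\<alpha> *s x) (cis (2 * pi * k / N) *s x) = cmod (\<alpha> - cis (2 * pi * k / N))"
    using x by (simp add: dist_norm flip: vector_sub_rdistrib)
  ultimately have "dist (cis (2 * pi * k / N) *s x) z < 3 * d"
    using \<alpha>(2) dist_triangle[of "cis (2 * pi * k / N) *s x" z "\<alpha> *s x"] by (simp add: dist_commute)
  then show "z \<in> (\<Union>k<nat \<lceil>2 * pi / d\<rceil>. B \<inter> ball (cis (2 * pi * k / nat \<lceil>2 * pi / d\<rceil>) *s x) (3 * d))"
    using kN zB unfolding N_def by auto
qed

text \<open>
  There are \<open>O(1 / d)\<close> balls in the cover, each of mass \<open>O(d ^ m)\<close>: sweeping a set along circles costs one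
  power of \<open>d\<close>, which is why the Hausdorff measure of dimension \<open>m - 1\<close> appears.
\<close>

lemma circle_tube_mass_bound:
  fixes \<beta> :: "(complex^'n) measure"
  assumes sets: "sets \<beta> = sets (borel_on B)" and one: "emeasure \<beta> (space \<beta>) = 1"
    and sph: "B \<subseteq> sphere 0 1" and inv: "circle_invariant B"
    and c: "c > 0" "\<And>\<zeta> r. \<zeta> \<in> B \<Longrightarrow> r > 0 \<Longrightarrow> measure \<beta> (B \<inter> ball \<zeta> r) \<le> c * r ^ m"
    and x: "x \<in> B" and d: "0 < d" "d \<le> 1"
  shows "emeasure \<beta> (circle_tube B x (2 * d)) \<le> ennreal ((8 * c * 3 ^ m + 1) * d ^ (m - 1))"
proof -
  interpret finite_measure \<beta> by standard (simp add: one)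
  have "measure \<beta> (circle_tube B x (2 * d)) \<le> (8 * c * 3 ^ m + 1) * d ^ (m - 1)"
  proof (cases m)
    case 0
    have "measure \<beta> (circle_tube B x (2 * d)) \<le> 1" using bounded_measure one by (simp add: measure_def)
    then show ?thesis using 0 c by simp
  next
    case (Suc k)
    define N where "N = nat \<lceil>2 * pi / d\<rceil>"
    have "2 * pi \<le> 7" using pi_less_4 pi_approx by simp
    then have "2 * pi / d \<le> 7 / d" using d by (intro divide_right_mono) auto
    moreover have "1 \<le> 1 / d" using d by simp
    moreover have "7 / d + 1 / d = 8 / d" by (simp flip: add_divide_distrib)
    ultimately have "2 * pi / d + 1 \<le> 8 / d" by linarith
    moreover have "2 * pi / d > 0" using d by simp
    ultimately have N: "real N \<le> 8 / d" unfolding N_def by linarith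
    have inB: "cis t *s x \<in> B" for t using inv x by (auto simp: circle_invariant_def)
    have "measure \<beta> (circle_tube B x (2 * d)) \<le> measure \<beta> (\<Union>k<N. B \<inter> ball (cis (2 * pi * k / N) *s x) (3 * d))"
      unfolding N_def
      by (intro finite_measure_mono circle_tube_cover) (use sph x d sets in \<open>auto intro!: sets_borel_on_Int\<close>)
    also have "\<dots> \<le> (\<Sum>k<N. measure \<beta> (B \<inter> ball (cis (2 * pi * k / N) *s x) (3 * d)))"
      by (rule finite_measure_subadditive_finite) (use sets in \<open>auto intro!: sets_borel_on_Int\<close>)
    also have "\<dots> \<le> (\<Sum>k<N. c * (3 * d) ^ m)"
      by (rule sum_mono, rule c(2)) (use inB d in auto)
    also have "\<dots> = real N * (c * (3 * d) ^ m)" by simp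
    also have "\<dots> \<le> 8 / d * (c * (3 * d) ^ m)" by (rule mult_right_mono[OF N]) (use c d in auto)
    also have "\<dots> = 8 * c * 3 ^ m * d ^ (m - 1)" using Suc d by (simp add: power_mult_distrib)
    also have "\<dots> \<le> (8 * c * 3 ^ m + 1) * d ^ (m - 1)" using d by (intro mult_right_mono) auto
    finally show ?thesis .
  qed
  then show ?thesis by (simp add: emeasure_eq_measure ennreal_leI)
qed

text \<open>
  Covering sets may have diameter \<open>0\<close>, while tubes need a positive width; this provides a width slightly
  larger than the diameter.
\<close>

lemma power_approx_above:
  fixes D e :: real
  assumes "0 \<le> D" "D \<le> 1 / 2" "e > 0"
  obtains d where "0 < d" "d \<le> 1" "D \<le> d" "d ^ k \<le> D ^ k + e"
proof -
  have "((\<lambda>t. t ^ k) \<longlongrightarrow> D ^ k) (at_right D)" by (intro tendsto_intros)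
  then have "eventually (\<lambda>t. t ^ k < D ^ k + e) (at_right D)"
    using assms by (intro order_tendstoD) auto
  then obtain b where b: "b > D" "\<And>t. t > D \<Longrightarrow> t < b \<Longrightarrow> t ^ k < D ^ k + e"
    unfolding eventually_at_right_field by blast
  define d where "d = min 1 ((D + b) / 2)"
  show thesis
    by (rule that[of d]) (use b(1) assms b(2)[of d] in \<open>auto simp: d_def min_def less_imp_le field_simps\<close>)
qed

lemma hausdorff_null_cover:
  assumes "hausdorff_measure k E = 0" "(e::ennreal) > 0" "(\<delta>::real) > 0"
  obtains U where "E \<subseteq> (\<Union>i. U i)" "\<And>i. bounded (U i)" "\<And>i. diameter (U i) \<le> \<delta>" "(\<Sum>i. diam_pow k (U i)) < e"
proof -
  have "(INF U\<in>{U. E \<subseteq> (\<Union>i. U i) \<and> (\<forall>i. bounded (U i) \<and> diameter (U i) \<le> \<delta>)}. \<Sum>i. diam_pow k (U i)) \<le> hausdorff_measure k E"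
    unfolding hausdorff_measure_def by (rule SUP_upper) (use assms in auto)
  also have "\<dots> < e" using assms by simp
  finally show thesis unfolding INF_less_iff using that by blast
qed

lemma hausdorff_null_imp_small_tubes:
  fixes \<beta> :: "(complex^'n) measure"
  assumes sets: "sets \<beta> = sets (borel_on B)" and one: "emeasure \<beta> (space \<beta>) = 1"
    and sph: "B \<subseteq> sphere 0 1" and inv: "circle_invariant B"
    and c: "c > 0" "\<And>\<zeta> r. \<zeta> \<in> B \<Longrightarrow> r > 0 \<Longrightarrow> measure \<beta> (B \<inter> ball \<zeta> r) \<le> c * r ^ m"
    and E: "E \<subseteq> B" "hausdorff_measure (m - 1) E = 0" and e: "e > 0"
  shows "\<exists>G\<in>sets \<beta>. E \<subseteq> G \<and> circle_invariant G \<and> emeasure \<beta> G \<le> ennreal (8 * c * 3 ^ m + 1) * (3 * ennreal e)"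
proof -
  let ?C = "8 * c * 3 ^ m + 1"
  have C: "?C > 0" using c by (simp add: add_pos_pos)
  \<comment> \<open>diameters at most \<open>1 / 2\<close> leave room for widths \<open>d i \<le> 1\<close>\<close>
  obtain U where U: "E \<subseteq> (\<Union>i. U i)" "\<And>i. bounded (U i)" "\<And>i. diameter (U i) \<le> 1 / 2" "(\<Sum>i. diam_pow (m - 1) (U i)) < ennreal e"
    using hausdorff_null_cover[OF E(2), of "ennreal e" "1 / 2"] e by auto
  have "\<exists>d. 0 < d \<and> d \<le> 1 \<and> diameter (U i) \<le> d \<and> d ^ (m - 1) \<le> diameter (U i) ^ (m - 1) + e * (1 / 2) ^ i" for i :: nat
    using power_approx_above[of "diameter (U i)" "e * (1 / 2) ^ i" "m - 1"] diameter_ge_0[OF U(2)] U(3) e by (metis mult_pos_pos zero_less_divide_1_iff zero_less_numeral zero_less_power)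
  then obtain d where d: "\<And>i. 0 < d i" "\<And>i. d i \<le> 1" "\<And>i. diameter (U i) \<le> d i" "\<And>i. d i ^ (m - 1) \<le> diameter (U i) ^ (m - 1) + e * (1 / 2) ^ i"
    by metis
  define x where "x i = (SOME x. x \<in> U i \<inter> E)" for i
  define I where "I = {i. U i \<inter> E \<noteq> {}}"
  have x: "x i \<in> U i" "x i \<in> E" if "i \<in> I" for i
    using that someI_ex[of "\<lambda>x. x \<in> U i \<inter> E"] by (auto simp: x_def I_def)
  define G where "G i = (if i \<in> I then circle_tube B (x i) (2 * d i) else {})" for i
  have Gs: "G i \<in> sets \<beta>" for i by (simp add: G_def sets sets_circle_tube)
  have cov: "E \<subseteq> (\<Union>i. G i)"
  proof
    fix z assume z: "z \<in> E"
    then obtain i where i: "z \<in> U i" using U(1) by auto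
    then have iI: "i \<in> I" using z by (auto simp: I_def)
    have "dist z (x i) \<le> diameter (U i)" by (rule diameter_bounded_bound[OF U(2) i x(1)[OF iI]])
    then have "dist z (1 *s x i) < 2 * d i" using d(1)[of i] d(3)[of i] by simp
    then have "z \<in> circle_tube B (x i) (2 * d i)"
      unfolding circle_tube_def using z E(1) by (auto intro!: exI[of _ 1])
    then show "z \<in> (\<Union>i. G i)" using iI by (auto simp: G_def)
  qed
  have mass: "emeasure \<beta> (G i) \<le> ennreal ?C * (diam_pow (m - 1) (U i) + ennreal (e * (1 / 2) ^ i))" for i
  proof (cases "i \<in> I")
    case True
    have ne: "U i \<noteq> {}" using True by (auto simp: I_def)
    have "emeasure \<beta> (G i) \<le> ennreal (?C * d i ^ (m - 1))"
      unfolding G_def using True circle_tube_mass_bound[OF sets one sph inv c _ d(1,2)] x(2)[OF True] E(1) by auto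
    also have "\<dots> \<le> ennreal (?C * (diameter (U i) ^ (m - 1) + e * (1 / 2) ^ i))"
      using C d(4) by (intro ennreal_leI mult_left_mono) auto
    also have "\<dots> = ennreal ?C * (diam_pow (m - 1) (U i) + ennreal (e * (1 / 2) ^ i))"
      using C e ne diameter_ge_0[OF U(2)] by (simp add: diam_pow_def ennreal_mult ennreal_plus)
    finally show ?thesis .
  qed (simp add: G_def)
  have "emeasure \<beta> (\<Union>i. G i) \<le> (\<Sum>i. emeasure \<beta> (G i))"
    by (rule emeasure_subadditive_countably) (use Gs in auto)
  also have "\<dots> \<le> (\<Sum>i. ennreal ?C * (diam_pow (m - 1) (U i) + ennreal (e * (1 / 2) ^ i)))"
    by (intro suminf_le mass) auto
  also have "\<dots> = ennreal ?C * ((\<Sum>i. diam_pow (m - 1) (U i)) + (\<Sum>i. ennreal (e * (1 / 2) ^ i)))"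
    by (simp add: suminf_add)
  also have "(\<Sum>i. ennreal (e * (1 / 2) ^ i)) = ennreal (e * 2)"
    using sums_mult[OF geometric_sums[of "1/2::real"], of e] e by (intro suminf_ennreal_eq) auto
  also have "ennreal ?C * ((\<Sum>i. diam_pow (m - 1) (U i)) + ennreal (e * 2)) \<le> ennreal ?C * (ennreal e + ennreal (e * 2))"
    using U(4) by (intro mult_left_mono add_right_mono) auto
  also have "ennreal e + ennreal (e * 2) = 3 * ennreal e"
  proof -
    have "ennreal e + ennreal (e * 2) = ennreal (e + e * 2)" using e by (subst ennreal_plus) auto
    also have "e + e * 2 = 3 * e" by simp
    also have "ennreal (3 * e) = 3 * ennreal e" using e by (simp add: ennreal_mult)
    finally show ?thesis .
  qed
  finally have "emeasure \<beta> (\<Union>i. G i) \<le> ennreal ?C * (3 * ennreal e)" .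
  moreover have "circle_invariant (\<Union>i. G i)"
  proof -
    have "circle_invariant (G i)" for i
      using circle_invariant_tube[OF inv] by (simp add: G_def) (simp add: circle_invariant_def)
    then show ?thesis unfolding circle_invariant_def by blast
  qed
  ultimately show ?thesis using cov Gs by (intro bexI[of _ "\<Union>i. G i"]) auto
qed

lemma hausdorff_null_imp_invariant_null:
  fixes \<beta> :: "(complex^'n) measure"
  assumes sets: "sets \<beta> = sets (borel_on B)" and one: "emeasure \<beta> (space \<beta>) = 1"
    and sph: "B \<subseteq> sphere 0 1" and inv: "circle_invariant B"
    and c: "c > 0" "\<And>\<zeta> r. \<zeta> \<in> B \<Longrightarrow> r > 0 \<Longrightarrow> measure \<beta> (B \<inter> ball \<zeta> r) \<le> c * r ^ m"
    and E: "E \<subseteq> B" "hausdorff_measure (m - 1) E = 0"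
  obtains G where "G \<in> sets \<beta>" "E \<subseteq> G" "circle_invariant G" "emeasure \<beta> G = 0"
proof -
  let ?C = "8 * c * 3 ^ m + 1"
  have "\<forall>n::nat. \<exists>G\<in>sets \<beta>. E \<subseteq> G \<and> circle_invariant G \<and> emeasure \<beta> G \<le> ennreal ?C * (3 * ennreal (1 / Suc n))"
    using hausdorff_null_imp_small_tubes[OF sets one sph inv c E] by simp
  then obtain G where G: "\<And>n. G n \<in> sets \<beta>" "\<And>n. E \<subseteq> G n" "\<And>n. circle_invariant (G n)"
    "\<And>n. emeasure \<beta> (G n) \<le> ennreal ?C * (3 * ennreal (1 / Suc n))" by metis
  have GI: "(\<Inter>n. G n) \<in> sets \<beta>" using G(1) by auto
  have "emeasure \<beta> (\<Inter>n. G n) \<le> ennreal ?C * (3 * ennreal (1 / Suc n))" for n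
    by (rule order_trans[OF emeasure_mono G(4)]) (use G(1) in auto)
  moreover have "(\<lambda>n. ennreal ?C * (3 * ennreal (1 / Suc n))) \<longlonglongrightarrow> ennreal ?C * (3 * ennreal 0)"
    by (intro tendsto_intros ennreal_tendsto_cmult tendsto_ennrealI lim_1_over_n LIMSEQ_Suc[OF lim_1_over_n]) auto
  ultimately have "emeasure \<beta> (\<Inter>n. G n) \<le> 0"
    using LIMSEQ_le_const by fastforce
  then show thesis
    by (intro that[of "\<Inter>n. G n"]) (use GI G(2,3) in \<open>auto simp: circle_invariant_def\<close>)
qed

section \<open>Circular domains and their slices\<close>

lemma scaleR_eq_scalar_mult: "r *\<^sub>R (z :: complex^'n) = complex_of_real r *s z"
  by (simp add: vec_eq_iff) (simp add: scaleR_conv_of_real)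

lemma continuous_on_scalar_mult [continuous_intros]:
  fixes g :: "_ \<Rightarrow> complex^'n"
  assumes "continuous_on S f" "continuous_on S g"
  shows "continuous_on S (\<lambda>x. f x *s g x)"
  unfolding vector_scalar_mult_def
  by (intro continuous_on_vec_lambda continuous_on_mult continuous_on_component assms)

lemma bounded_linear_scalar_mult_left: "bounded_linear (\<lambda>t. t *s (z :: complex^'n))"
  by (rule bounded_linear_intro[of _ "norm z"])
     (auto simp: vector_sadd_rdistrib scaleR_eq_scalar_mult scaleR_conv_of_real vector_smult_assoc)

text \<open>
  One-variable theory enters through the complex lines through the origin.
\<close>

lemma hol_on_slice:
  assumes f: "hol_on f S" and U: "open U" "\<And>t. t \<in> U \<Longrightarrow> t *s z \<in> S"
  shows "(\<lambda>t. f (t *s z)) holomorphic_on U"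
proof -
  have "\<exists>d. ((\<lambda>t. f (t *s z)) has_field_derivative d) (at t)" if t: "t \<in> U" for t
  proof -
    obtain L where L: "Vector_Spaces.linear (*s) (*) L" "(f has_derivative L) (at (t *s z))"
      using f U(2)[OF t] unfolding hol_on_def by blast
    have "((\<lambda>t. t *s z) has_derivative (\<lambda>h. h *s z)) (at t)"
      by (rule bounded_linear_imp_has_derivative[OF bounded_linear_scalar_mult_left])
    from has_derivative_compose[OF this L(2)]
    have "((\<lambda>t. f (t *s z)) has_derivative (\<lambda>h. L (h *s z))) (at t)" .
    moreover have "L (h *s z) = L z * h" for h
      using L(1) by (simp add: Vector_Spaces.linear_iff mult.commute)
    ultimately show ?thesis by (auto simp: has_field_derivative_def)
  qed
  then show ?thesis using U(1) by (auto simp: holomorphic_on_open)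
qed

lemma hol_on_imp_continuous_on: "hol_on f S \<Longrightarrow> continuous_on S f"
  unfolding hol_on_def by (meson continuous_at_imp_continuous_on has_derivative_continuous)

lemma clinear_add: "Vector_Spaces.linear (*s) (*) L \<Longrightarrow> Vector_Spaces.linear (*s) (*) L' \<Longrightarrow>
    Vector_Spaces.linear (*s) (*) (\<lambda>z. L z + c * (L' z :: complex))"
  by (auto simp: Vector_Spaces.linear_iff algebra_simps)

lemma hol_on_add:
  assumes "hol_on f S" "hol_on g S" shows "hol_on (\<lambda>z. f z + c * g z) S"
  unfolding hol_on_def
proof
  fix z assume "z \<in> S"
  with assms obtain L L' where L: "Vector_Spaces.linear (*s) (*) L" "(f has_derivative L) (at z)"
    "Vector_Spaces.linear (*s) (*) L'" "(g has_derivative L') (at z)" unfolding hol_on_def by blast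
  have "((\<lambda>z. f z + c * g z) has_derivative (\<lambda>h. L h + c * L' h)) (at z)"
    by (intro has_derivative_add has_derivative_mult_right L)
  then show "\<exists>L. Vector_Spaces.linear (*s) (*) L \<and> ((\<lambda>z. f z + c * g z) has_derivative L) (at z)"
    using clinear_add[OF L(1,3)] by blast
qed

lemma hol_on_mult:
  assumes "hol_on f S" "hol_on g S" shows "hol_on (\<lambda>z. f z * g z) S"
  unfolding hol_on_def
proof
  fix z assume "z \<in> S"
  with assms obtain L L' where L: "Vector_Spaces.linear (*s) (*) L" "(f has_derivative L) (at z)"
    "Vector_Spaces.linear (*s) (*) L'" "(g has_derivative L') (at z)" unfolding hol_on_def by blast
  have "((\<lambda>z. f z * g z) has_derivative (\<lambda>h. f z * L' h + L h * g z)) (at z)"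
    by (rule has_derivative_mult[OF L(2) L(4)])
  moreover have "Vector_Spaces.linear (*s) (*) (\<lambda>h. f z * L' h + L h * g z)"
    using L(1,3) by (auto simp: Vector_Spaces.linear_iff algebra_simps)
  ultimately show "\<exists>L. Vector_Spaces.linear (*s) (*) L \<and> ((\<lambda>z. f z * g z) has_derivative L) (at z)"
    by blast
qed

lemma hol_on_const: "hol_on (\<lambda>_. c) (S :: (complex^'n) set)"
proof -
  have "Vector_Spaces.linear (*s) (*) (\<lambda>_ :: complex^'n. 0 :: complex)"
    by (auto simp: Vector_Spaces.linear_iff vec.vector_space_axioms vector_space_over_itself.vector_space_axioms)
  then show ?thesis unfolding hol_on_def by (blast intro: has_derivative_const)
qed

lemma clinear_imp_bounded_linear:
  fixes T :: "complex^'n \<Rightarrow> complex^'m"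
  assumes "Vector_Spaces.linear (*s) (*s) T" shows "bounded_linear T"
proof -
  have "linear T"
    using assms by (intro linearI) (auto simp: Vector_Spaces.linear_iff scaleR_eq_scalar_mult)
  then show ?thesis by (rule linear_conv_bounded_linear[THEN iffD1])
qed

lemma hol_on_compose_linear:
  assumes f: "hol_on f S" and T: "Vector_Spaces.linear (*s) (*s) T" "\<And>z. z \<in> S' \<Longrightarrow> T z \<in> S"
  shows "hol_on (\<lambda>z. f (T z)) S'"
  unfolding hol_on_def
proof
  fix z assume "z \<in> S'"
  then obtain L where L: "Vector_Spaces.linear (*s) (*) L" "(f has_derivative L) (at (T z))"
    using f T(2) unfolding hol_on_def by blast
  have "((\<lambda>z. f (T z)) has_derivative (\<lambda>h. L (T h))) (at z)"
    by (rule has_derivative_compose[OF bounded_linear_imp_has_derivative[OF clinear_imp_bounded_linear[OF T(1)]] L(2)])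
  moreover have "Vector_Spaces.linear (*s) (*) (\<lambda>h. L (T h))"
    using L(1) T(1) by (auto simp: Vector_Spaces.linear_iff)
  ultimately show "\<exists>L. Vector_Spaces.linear (*s) (*) L \<and> ((\<lambda>z. f (T z)) has_derivative L) (at z)" by blast
qed

lemma clinear_scalar: "Vector_Spaces.linear (*s) (*s) (\<lambda>z :: complex^'n. c *s z)"
  by (auto simp: Vector_Spaces.linear_iff vec.vector_space_axioms vector_add_ldistrib vector_smult_assoc mult.commute)

lemma hol_on_hermitian_inner: "hol_on (\<lambda>z. hermitian_inner z \<xi>) S"
proof -
  have lin: "Vector_Spaces.linear (*s) (*) (\<lambda>z. hermitian_inner z \<xi>)"
    by (auto simp: Vector_Spaces.linear_iff vec.vector_space_axioms vector_space_over_itself.vector_space_axioms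
        hermitian_inner_def sum_distrib_left sum.distrib algebra_simps)
  then have "bounded_linear (\<lambda>z. hermitian_inner z \<xi>)"
    by (intro linear_conv_bounded_linear[THEN iffD1] linearI)
       (auto simp: Vector_Spaces.linear_iff scaleR_eq_scalar_mult scaleR_conv_of_real)
  then show ?thesis unfolding hol_on_def using lin bounded_linear_imp_has_derivative by blast
qed

lemma inner_eq_Re_hermitian_inner: "x \<bullet> y = Re (hermitian_inner x y)"
  by (simp add: inner_vec_def hermitian_inner_def inner_complex_def)

lemma unitary_norm: "T \<in> unitary_maps \<Longrightarrow> norm (T x) = norm x"
  by (simp add: unitary_maps_def norm_eq_sqrt_inner inner_eq_Re_hermitian_inner)

text \<open>
  The domain, its invariant measure and its kernel; complex measures on \<open>B\<close> are added further below.
\<close>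

locale circular_domain =
  fixes D B :: "(complex^'n) set" and \<beta> :: "(complex^'n) measure" and C :: "complex^'n \<Rightarrow> complex^'n \<Rightarrow> complex"
  assumes open_D: "open D" and convex_D: "convex D" and circular_D: "circular D" and nonempty_D: "D \<noteq> {}"
    and closed_B: "closed B" and B_frontier: "B \<subseteq> frontier D" and B_sphere: "B \<subseteq> sphere 0 1"
    and unitary: "linear_automorphisms D \<subseteq> unitary_maps"
    and transitive: "\<And>\<zeta>. \<zeta> \<in> B \<Longrightarrow> (\<lambda>T. T \<zeta>) ` linear_automorphisms D = B"
    and invariant: "is_invariant_probability D B \<beta>"
    and kernel: "is_reproducing_kernel D \<beta> C"
begin

lemma sets_\<beta>: "sets \<beta> = sets (borel_on B)" and emeasure_space_\<beta>: "emeasure \<beta> (space \<beta>) = 1"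
  and distr_\<beta>: "T \<in> linear_automorphisms D \<Longrightarrow> distr \<beta> (borel_on B) T = \<beta>"
  using invariant by (auto simp: is_invariant_probability_def)

lemma space_\<beta>: "space \<beta> = B"
  using sets_eq_imp_space_eq[OF sets_\<beta>] by (simp add: space_borel_on)

sublocale finite_measure \<beta>
  by standard (simp add: emeasure_space_\<beta>)

lemma measure_space_\<beta>: "measure \<beta> B = 1"
  using emeasure_space_\<beta> by (simp add: measure_def space_\<beta>)

lemma nonempty_B: "B \<noteq> {}"
  using emeasure_space_\<beta> by (auto simp: space_\<beta>)

lemma compact_B: "compact B"
  using closed_B B_sphere by (meson bounded_subset compact_eq_bounded_closed compact_sphere)

lemma norm_B: "\<zeta> \<in> B \<Longrightarrow> norm \<zeta> = 1"
  using B_sphere by auto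

lemma zero_mem_D: "0 \<in> D"
proof -
  obtain z where z: "z \<in> D" using nonempty_D by blast
  have "(- 1) *s z \<in> D" using circular_D z unfolding circular_def by (metis norm_minus_cancel norm_one)
  then have "(1/2) *\<^sub>R z + (1/2) *\<^sub>R ((- 1) *s z) \<in> D"
    using convex_D z by (intro convexD) auto
  then show ?thesis by (simp add: scaleR_eq_scalar_mult)
qed

lemma automorphism_maps_B: "T \<in> linear_automorphisms D \<Longrightarrow> \<zeta> \<in> B \<Longrightarrow> T \<zeta> \<in> B"
  using transitive by blast

text \<open>
  Since rotations are linear automorphisms, \<open>\<beta>\<close> is invariant under them.
\<close>

lemma rotation_automorphism:
  assumes "cmod \<alpha> = 1" shows "(\<lambda>z. \<alpha> *s z) \<in> linear_automorphisms D"
proof -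
  have a: "\<alpha> \<noteq> 0" "cmod (inverse \<alpha>) = 1" using assms by (auto simp: norm_inverse)
  have "bij (\<lambda>z :: complex^'n. \<alpha> *s z)"
    by (rule bij_betw_byWitness[of _ "\<lambda>z. inverse \<alpha> *s z"]) (use a in \<open>auto simp: vector_smult_assoc\<close>)
  moreover have "(\<lambda>z. \<alpha> *s z) ` D = D"
  proof (intro antisym subsetI)
    fix z assume "z \<in> D"
    then have "inverse \<alpha> *s z \<in> D" using circular_D a by (auto simp: circular_def)
    then show "z \<in> (\<lambda>z. \<alpha> *s z) ` D" by (rule image_eqI[rotated]) (use a in \<open>simp add: vector_smult_assoc\<close>)
  qed (use circular_D assms in \<open>auto simp: circular_def\<close>)
  ultimately show ?thesis by (simp add: linear_automorphisms_def clinear_scalar)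
qed

lemma circle_invariant_B: "circle_invariant B"
  unfolding circle_invariant_def using automorphism_maps_B[OF rotation_automorphism] by blast

lemma rotate_mem_B: "\<zeta> \<in> B \<Longrightarrow> cmod \<alpha> = 1 \<Longrightarrow> \<alpha> *s \<zeta> \<in> B"
  using circle_invariant_B by (auto simp: circle_invariant_def)

lemma scaleR_mem_D:
  assumes "z \<in> closure D" "0 \<le> r" "r < 1" shows "r *\<^sub>R z \<in> D"
proof -
  have "z - (1 - r) *\<^sub>R (z - 0) \<in> interior D"
    by (rule mem_interior_closure_convex_shrink[OF convex_D])
       (use assms zero_mem_D open_D in \<open>auto simp: interior_open\<close>)
  then show ?thesis using open_D by (simp add: interior_open algebra_simps)
qed

lemma scaleR_B_mem_D: "\<zeta> \<in> B \<Longrightarrow> 0 \<le> r \<Longrightarrow> r < 1 \<Longrightarrow> r *\<^sub>R \<zeta> \<in> D"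
  using scaleR_mem_D B_frontier by (auto simp: frontier_def)

lemma scaleR_D_mem_D: "z \<in> D \<Longrightarrow> 0 \<le> r \<Longrightarrow> r < 1 \<Longrightarrow> r *\<^sub>R z \<in> D"
  using scaleR_mem_D closure_subset by blast

lemma disc_mem_D:
  assumes "\<zeta> \<in> B" "cmod t < 1" shows "t *s \<zeta> \<in> D"
proof (cases "t = 0")
  case True then show ?thesis using zero_mem_D by simp
next
  case False
  then have "(t / cmod t) *s \<zeta> \<in> B" by (intro rotate_mem_B assms) (simp add: norm_divide)
  then have "cmod t *\<^sub>R ((t / cmod t) *s \<zeta>) \<in> D" by (rule scaleR_B_mem_D) (use assms in auto)
  then show ?thesis using False by (simp add: scaleR_eq_scalar_mult vector_smult_assoc)
qed

lemma slice_holomorphic: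
  assumes "hol_on f D" "\<zeta> \<in> B" shows "(\<lambda>t. f (t *s \<zeta>)) holomorphic_on ball 0 1"
  by (rule hol_on_slice[OF assms(1)]) (use assms disc_mem_D in auto)

lemma measurable_\<beta>I: "f \<in> borel_measurable borel \<Longrightarrow> f \<in> borel_measurable \<beta>"
  using measurable_cong_sets[OF sets_\<beta> refl] by (auto simp: borel_on_def intro: measurable_restrict_space1)

lemma continuous_imp_measurable_\<beta>:
  assumes "continuous_on B f" shows "f \<in> borel_measurable \<beta>"
  using borel_measurable_continuous_on_restrict[OF assms] measurable_cong_sets[OF sets_\<beta> refl]
  by (auto simp: borel_on_def)

lemma bounded_on_B:
  fixes f :: "complex^'n \<Rightarrow> 'b::real_normed_vector"
  assumes "continuous_on B f" obtains M where "M \<ge> 0" "\<And>\<zeta>. \<zeta> \<in> B \<Longrightarrow> norm (f \<zeta>) \<le> M"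
proof -
  have "bounded (f ` B)" by (intro compact_imp_bounded compact_continuous_image assms compact_B)
  then obtain M where M: "\<forall>x\<in>f ` B. norm x \<le> M" by (auto simp only: bounded_iff)
  show thesis by (rule that[of "max M 0"]) (use M in \<open>auto simp: max.coboundedI1\<close>)
qed

lemma integrable_continuous_\<beta>:
  fixes f :: "complex^'n \<Rightarrow> 'b::{banach,second_countable_topology}"
  assumes "continuous_on B f" shows "integrable \<beta> f"
proof -
  obtain M where M: "\<And>\<zeta>. \<zeta> \<in> B \<Longrightarrow> norm (f \<zeta>) \<le> M" using bounded_on_B[OF assms] by blast
  show ?thesis
    by (rule integrable_const_bound[of _ M]) (use M continuous_imp_measurable_\<beta>[OF assms] in \<open>auto simp: space_\<beta>\<close>)
qed

lemma continuous_dilate: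
  assumes "hol_on f D" "0 \<le> r" "r < 1" shows "continuous_on B (\<lambda>\<zeta>. f (r *\<^sub>R \<zeta>))"
  by (rule continuous_on_compose2[OF hol_on_imp_continuous_on[OF assms(1)]])
     (use scaleR_B_mem_D assms in \<open>auto intro!: continuous_intros\<close>)

lemma measurable_automorphism:
  assumes "T \<in> linear_automorphisms D" shows "T \<in> measurable \<beta> (borel_on B)"
proof -
  have "bounded_linear T" using assms by (auto simp: linear_automorphisms_def intro: clinear_imp_bounded_linear)
  then have "continuous_on UNIV T" by (rule linear_continuous_on)
  then have "T \<in> measurable \<beta> borel" by (intro measurable_\<beta>I borel_measurable_continuous_onI)
  then show ?thesis unfolding borel_on_def
    by (intro measurable_restrict_space2) (auto simp: space_\<beta> automorphism_maps_B[OF assms])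
qed

lemma integral_automorphism:
  fixes f :: "complex^'n \<Rightarrow> 'b::{banach,second_countable_topology}"
  assumes T: "T \<in> linear_automorphisms D" and f: "f \<in> borel_measurable \<beta>"
  shows "(\<integral>\<zeta>. f (T \<zeta>) \<partial>\<beta>) = (\<integral>\<zeta>. f \<zeta> \<partial>\<beta>)"
proof -
  have "f \<in> borel_measurable (borel_on B)" using f measurable_cong_sets[OF sets_\<beta> refl] by blast
  from integral_distr[OF measurable_automorphism[OF T] this] distr_\<beta>[OF T] show ?thesis by simp
qed

text \<open>
  Linear automorphisms are isometries because they are unitary.
\<close>

lemma measure_ball_homogeneous:
  assumes "\<zeta> \<in> B" "\<xi> \<in> B" shows "measure \<beta> (B \<inter> ball \<zeta> r) = measure \<beta> (B \<inter> ball \<xi> r)"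
proof -
  obtain T where T: "T \<in> linear_automorphisms D" "\<zeta> = T \<xi>" using transitive[OF assms(2)] assms(1) by blast
  have lin: "Vector_Spaces.linear (*s) (*s) T" using T(1) by (simp add: linear_automorphisms_def)
  have dist: "dist (T \<xi>) (T x) = dist \<xi> x" for x
  proof -
    have "T \<xi> - T x = T (\<xi> - x)"
      using bounded_linear.linear[OF clinear_imp_bounded_linear[OF lin]] by (simp add: linear_diff)
    then show ?thesis using unitary T(1) by (auto simp: dist_norm unitary_norm)
  qed
  have "measure \<beta> (B \<inter> ball \<zeta> r) = measure (distr \<beta> (borel_on B) T) (B \<inter> ball \<zeta> r)"
    by (simp add: distr_\<beta>[OF T(1)])
  also have "\<dots> = measure \<beta> (T -` (B \<inter> ball \<zeta> r) \<inter> space \<beta>)"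
    by (rule measure_distr[OF measurable_automorphism[OF T(1)]]) (auto intro!: sets_borel_on_Int)
  also have "T -` (B \<inter> ball \<zeta> r) \<inter> space \<beta> = B \<inter> ball \<xi> r"
    using automorphism_maps_B[OF T(1)] dist by (auto simp: T(2) space_\<beta>)
  finally show ?thesis .
qed

end

section \<open>The Hardy inner product as a limit of radial pairings\<close>

text \<open>
  A sequence of radii increasing to \<open>1\<close> along which limits at the boundary are taken. Its first member
  is \<open>0\<close>; where a positive radius is needed the index is shifted by one.
\<close>

definition radius :: "nat \<Rightarrow> real" where
  "radius n = real n / (real n + 1)"

lemma radius_bounds: "0 \<le> radius n" "radius n < 1"
  by (auto simp: radius_def field_simps)

lemma radius_mono: "m \<le> n \<Longrightarrow> radius m \<le> radius n"
  by (simp add: radius_def field_simps)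

lemma radius_tendsto: "radius \<longlonglongrightarrow> 1"
proof -
  have "(\<lambda>n. 1 - 1 / real (Suc n)) \<longlonglongrightarrow> 1 - 0"
    by (intro tendsto_diff tendsto_const LIMSEQ_Suc[OF lim_1_over_n])
  moreover have "1 - 1 / real (Suc n) = radius n" for n by (simp add: radius_def field_simps)
  ultimately show ?thesis by simp
qed

lemma polarization_pointwise: "(\<Sum>k<4. \<i> ^ k * of_real ((cmod (a + \<i> ^ k * b))\<^sup>2)) / 4 = a * cnj b"
  unfolding sum_lessThan_4 complex_norm_square
  by (simp add: algebra_simps power3_eq_cube)

context circular_domain
begin

text \<open>
  Invariance of \<open>\<beta>\<close> under rotations and Fubini's theorem. This is how one-variable facts on circles
  enter integrals over \<open>B\<close>.
\<close>

lemma integral_circle_average: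
  assumes h: "h \<in> borel_measurable \<beta>" and M: "\<And>\<zeta>. \<zeta> \<in> B \<Longrightarrow> norm (h \<zeta>) \<le> M"
  shows "(\<integral>\<zeta>. h \<zeta> \<partial>\<beta>) = (\<integral>\<zeta>. circle_mean (\<lambda>\<alpha>. h (\<alpha> *s \<zeta>)) \<partial>\<beta>)"
    and "(\<lambda>\<zeta>. circle_mean (\<lambda>\<alpha>. h (\<alpha> *s \<zeta>))) \<in> borel_measurable \<beta>"
proof -
  interpret U: finite_measure unit_interval by (rule finite_measure_unit_interval)
  interpret P: pair_sigma_finite unit_interval \<beta> ..
  interpret PF: finite_measure "unit_interval \<Otimes>\<^sub>M \<beta>" by (rule finite_measure_pair_measure) unfold_locales
  have rot: "(\<lambda>p. circle_point (fst p) *s snd p) \<in> measurable (unit_interval \<Otimes>\<^sub>M \<beta>) \<beta>"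
  proof -
    have c: "(\<lambda>p. fst p *s snd p) \<in> borel_measurable (borel :: (complex \<times> (complex^'n)) measure)"
      by (intro borel_measurable_continuous_onI continuous_intros)
    have "(\<lambda>p. (circle_point (fst p), snd p)) \<in> borel_measurable (unit_interval \<Otimes>\<^sub>M \<beta>)"
    proof (rule borel_measurable_Pair)
      have "circle_point \<in> borel_measurable unit_interval"
        by (intro borel_measurable_unit_interval borel_measurable_continuous_onI continuous_circle_point)
      then show "(\<lambda>p. circle_point (fst p)) \<in> borel_measurable (unit_interval \<Otimes>\<^sub>M \<beta>)"
        by (rule measurable_compose[OF measurable_fst])
      have "(\<lambda>x. x) \<in> borel_measurable \<beta>" by (rule measurable_\<beta>I) simp
      then show "snd \<in> borel_measurable (unit_interval \<Otimes>\<^sub>M \<beta>)"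
        using measurable_compose[OF measurable_snd] by blast
    qed
    from measurable_compose[OF this c]
    have "(\<lambda>p. circle_point (fst p) *s snd p) \<in> borel_measurable (unit_interval \<Otimes>\<^sub>M \<beta>)" by simp
    then have "(\<lambda>p. circle_point (fst p) *s snd p) \<in> measurable (unit_interval \<Otimes>\<^sub>M \<beta>) (borel_on B)"
      unfolding borel_on_def
      by (intro measurable_restrict_space2) (auto simp: space_pair_measure space_\<beta> rotate_mem_B)
    then show ?thesis using measurable_cong_sets[OF refl sets_\<beta>] by blast
  qed
  have hm: "(\<lambda>p. h (circle_point (fst p) *s snd p)) \<in> borel_measurable (unit_interval \<Otimes>\<^sub>M \<beta>)"
    by (rule measurable_compose[OF rot h])
  have int: "integrable (unit_interval \<Otimes>\<^sub>M \<beta>) (\<lambda>(t, \<zeta>). h (circle_point t *s \<zeta>))"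
    by (rule PF.integrable_const_bound[of _ M])
       (use hm M rotate_mem_B in \<open>auto simp: case_prod_beta space_pair_measure space_\<beta>\<close>)
  have "(\<integral>\<zeta>. h \<zeta> \<partial>\<beta>) = (\<integral>t. (\<integral>\<zeta>. h (circle_point t *s \<zeta>) \<partial>\<beta>) \<partial>unit_interval)"
    using integral_automorphism[OF rotation_automorphism h] by (simp add: space_unit_interval)
  also have "\<dots> = (\<integral>\<zeta>. (\<integral>t. h (circle_point t *s \<zeta>) \<partial>unit_interval) \<partial>\<beta>)"
    by (rule P.Fubini_integral[symmetric, OF int])
  finally show "(\<integral>\<zeta>. h \<zeta> \<partial>\<beta>) = (\<integral>\<zeta>. circle_mean (\<lambda>\<alpha>. h (\<alpha> *s \<zeta>)) \<partial>\<beta>)"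
    by (simp add: circle_mean_def)
  have "(\<lambda>\<zeta>. \<integral>t. h (circle_point t *s \<zeta>) \<partial>unit_interval) \<in> borel_measurable \<beta>"
  proof (rule U.borel_measurable_lebesgue_integral)
    have "(\<lambda>p. h (circle_point (snd p) *s fst p)) \<in> borel_measurable (\<beta> \<Otimes>\<^sub>M unit_interval)"
      using measurable_pair_swap[OF hm] by (simp add: case_prod_beta)
    then show "(\<lambda>(\<zeta>, t). h (circle_point t *s \<zeta>)) \<in> borel_measurable (\<beta> \<Otimes>\<^sub>M unit_interval)"
      by (simp add: case_prod_beta)
  qed
  then show "(\<lambda>\<zeta>. circle_mean (\<lambda>\<alpha>. h (\<alpha> *s \<zeta>))) \<in> borel_measurable \<beta>"
    by (simp add: circle_mean_def)
qed

definition radial_inner :: "(complex^'n \<Rightarrow> complex) \<Rightarrow> (complex^'n \<Rightarrow> complex) \<Rightarrow> real \<Rightarrow> real \<Rightarrow> complex" where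
  "radial_inner f g \<rho> \<sigma> = (\<integral>\<zeta>. f (\<rho> *\<^sub>R \<zeta>) * cnj (g (\<sigma> *\<^sub>R \<zeta>)) \<partial>\<beta>)"

definition radial_norm_sq :: "(complex^'n \<Rightarrow> complex) \<Rightarrow> real \<Rightarrow> real" where
  "radial_norm_sq f \<rho> = (\<integral>\<zeta>. (cmod (f (\<rho> *\<^sub>R \<zeta>)))\<^sup>2 \<partial>\<beta>)"

lemma slice_mean_sums:
  assumes f: "hol_on f D" and g: "hol_on g D" and \<zeta>: "\<zeta> \<in> B" and r: "0 \<le> \<rho>" "\<rho> < 1" "0 \<le> \<sigma>" "\<sigma> < 1"
  shows "(\<lambda>n. (deriv ^^ n) (\<lambda>t. f (t *s \<zeta>)) 0 / fact n * cnj ((deriv ^^ n) (\<lambda>t. g (t *s \<zeta>)) 0 / fact n) * of_real (\<rho> * \<sigma>) ^ n)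
     sums circle_mean (\<lambda>\<alpha>. f (\<rho> *\<^sub>R (\<alpha> *s \<zeta>)) * cnj (g (\<sigma> *\<^sub>R (\<alpha> *s \<zeta>))))"
  using circle_mean_product_sums[OF slice_holomorphic[OF f \<zeta>] slice_holomorphic[OF g \<zeta>] r]
  by (simp add: scaleR_eq_scalar_mult vector_smult_assoc)

lemma radial_inner_circle_mean:
  assumes f: "hol_on f D" and g: "hol_on g D" and r: "0 \<le> \<rho>" "\<rho> < 1" "0 \<le> \<sigma>" "\<sigma> < 1"
  shows "radial_inner f g \<rho> \<sigma> = (\<integral>\<zeta>. circle_mean (\<lambda>\<alpha>. f (\<rho> *\<^sub>R (\<alpha> *s \<zeta>)) * cnj (g (\<sigma> *\<^sub>R (\<alpha> *s \<zeta>)))) \<partial>\<beta>)"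
    and "integrable \<beta> (\<lambda>\<zeta>. circle_mean (\<lambda>\<alpha>. f (\<rho> *\<^sub>R (\<alpha> *s \<zeta>)) * cnj (g (\<sigma> *\<^sub>R (\<alpha> *s \<zeta>)))))"
proof -
  let ?h = "\<lambda>\<zeta>. f (\<rho> *\<^sub>R \<zeta>) * cnj (g (\<sigma> *\<^sub>R \<zeta>))"
  have c: "continuous_on B ?h" by (intro continuous_intros continuous_dilate f g r)
  obtain M where M: "M \<ge> 0" "\<And>\<zeta>. \<zeta> \<in> B \<Longrightarrow> norm (?h \<zeta>) \<le> M" using bounded_on_B[OF c] by blast
  note av = integral_circle_average[OF continuous_imp_measurable_\<beta>[OF c] M(2)]
  show "radial_inner f g \<rho> \<sigma> = (\<integral>\<zeta>. circle_mean (\<lambda>\<alpha>. ?h (\<alpha> *s \<zeta>)) \<partial>\<beta>)"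
    unfolding radial_inner_def by (rule av(1))
  interpret U: finite_measure unit_interval by (rule finite_measure_unit_interval)
  have "norm (circle_mean (\<lambda>\<alpha>. ?h (\<alpha> *s \<zeta>))) \<le> M" if \<zeta>: "\<zeta> \<in> B" for \<zeta>
  proof -
    have "continuous_on {0..1} (\<lambda>t. ?h (circle_point t *s \<zeta>))"
      by (rule continuous_on_compose2[OF c]) (use rotate_mem_B[OF \<zeta>] in \<open>auto intro!: continuous_intros\<close>)
    then have "norm (circle_mean (\<lambda>\<alpha>. ?h (\<alpha> *s \<zeta>))) \<le> (\<integral>t. M \<partial>unit_interval)"
      unfolding circle_mean_def
      by (intro Bochner_Integration.integral_norm_bound_integral continuous_unit_interval(1))
         (use M(2) rotate_mem_B[OF \<zeta>] in auto)
    then show ?thesis by (simp add: space_unit_interval)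
  qed
  then show "integrable \<beta> (\<lambda>\<zeta>. circle_mean (\<lambda>\<alpha>. ?h (\<alpha> *s \<zeta>)))"
    by (intro integrable_const_bound[of _ M] av(2)) (auto simp: space_\<beta>)
qed

text \<open>
  On each disc through the origin both pairings have the same power series expansion, by
  \<open>slice_mean_sums\<close>.
\<close>

lemma radial_inner_depends_on_product:
  assumes f: "hol_on f D" and g: "hol_on g D" and r: "0 \<le> \<rho>" "\<rho> < 1" "0 \<le> \<sigma>" "\<sigma> < 1"
    and r': "0 \<le> \<rho>'" "\<rho>' < 1" "0 \<le> \<sigma>'" "\<sigma>' < 1" and eq: "\<rho> * \<sigma> = \<rho>' * \<sigma>'"
  shows "radial_inner f g \<rho> \<sigma> = radial_inner f g \<rho>' \<sigma>'"
  unfolding radial_inner_circle_mean(1)[OF f g r] radial_inner_circle_mean(1)[OF f g r']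
proof (rule Bochner_Integration.integral_cong[OF refl])
  fix \<zeta> assume "\<zeta> \<in> space \<beta>"
  then have \<zeta>: "\<zeta> \<in> B" by (simp add: space_\<beta>)
  show "circle_mean (\<lambda>\<alpha>. f (\<rho> *\<^sub>R (\<alpha> *s \<zeta>)) * cnj (g (\<sigma> *\<^sub>R (\<alpha> *s \<zeta>)))) =
        circle_mean (\<lambda>\<alpha>. f (\<rho>' *\<^sub>R (\<alpha> *s \<zeta>)) * cnj (g (\<sigma>' *\<^sub>R (\<alpha> *s \<zeta>))))"
    by (rule sums_unique2[OF slice_mean_sums[OF f g \<zeta> r, unfolded eq] slice_mean_sums[OF f g \<zeta> r']])
qed

lemma radial_inner_self:
  "hol_on f D \<Longrightarrow> 0 \<le> \<rho> \<Longrightarrow> \<rho> < 1 \<Longrightarrow> radial_inner f f \<rho> \<rho> = of_real (radial_norm_sq f \<rho>)"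
  unfolding radial_inner_def radial_norm_sq_def by (simp only: complex_norm_square[symmetric] integral_complex_of_real)

text \<open>
  The slice means are power series in the squared radius with nonnegative coefficients.
\<close>

lemma radial_norm_sq_mono:
  assumes f: "hol_on f D" and r: "0 \<le> \<rho>" "\<rho> \<le> \<sigma>" "\<sigma> < 1"
  shows "radial_norm_sq f \<rho> \<le> radial_norm_sq f \<sigma>"
proof -
  have \<rho>: "0 \<le> \<rho>" "\<rho> < 1" and \<sigma>: "0 \<le> \<sigma>" "\<sigma> < 1" using r by auto
  let ?m = "\<lambda>\<rho> \<zeta>. circle_mean (\<lambda>\<alpha>. f (\<rho> *\<^sub>R (\<alpha> *s \<zeta>)) * cnj (f (\<rho> *\<^sub>R (\<alpha> *s \<zeta>))))"
  have "Re (?m \<rho> \<zeta>) \<le> Re (?m \<sigma> \<zeta>)" if \<zeta>: "\<zeta> \<in> B" for \<zeta>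
  proof -
    define a where "a n = (deriv ^^ n) (\<lambda>t. f (t *s \<zeta>)) 0 / fact n" for n
    have s: "(\<lambda>n. (cmod (a n))\<^sup>2 * (\<rho> * \<rho>) ^ n) sums Re (?m \<rho> \<zeta>)" if "0 \<le> \<rho>" "\<rho> < 1" for \<rho>
      using sums_Re[OF slice_mean_sums[OF f f \<zeta> that that]]
      by (simp add: a_def[symmetric] complex_norm_square[symmetric] flip: of_real_power of_real_mult)
    show ?thesis
      by (rule sums_le[OF _ s[OF \<rho>] s[OF \<sigma>]]) (use r in \<open>auto intro!: mult_left_mono power_mono mult_mono\<close>)
  qed
  then have "Re (radial_inner f f \<rho> \<rho>) \<le> Re (radial_inner f f \<sigma> \<sigma>)"
    unfolding radial_inner_circle_mean(1)[OF f f \<rho> \<rho>] radial_inner_circle_mean(1)[OF f f \<sigma> \<sigma>]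
      integral_Re[OF radial_inner_circle_mean(2)[OF f f \<rho> \<rho>], symmetric] integral_Re[OF radial_inner_circle_mean(2)[OF f f \<sigma> \<sigma>], symmetric]
    by (intro integral_mono integrable_Re radial_inner_circle_mean(2) f \<rho> \<sigma>) (auto simp: space_\<beta>)
  then show ?thesis using radial_inner_self[OF f \<rho>] radial_inner_self[OF f \<sigma>] by simp
qed

lemma radial_norm_sq_nonneg: "0 \<le> radial_norm_sq f \<rho>"
  unfolding radial_norm_sq_def by (rule Bochner_Integration.integral_nonneg) simp

lemma hardy_norm_sq_eq:
  assumes f: "hol_on f D" shows "hardy_norm_sq \<beta> f = (SUP \<rho>\<in>{0..<1}. ennreal (radial_norm_sq f \<rho>))"
  unfolding hardy_norm_sq_def radial_norm_sq_def
  by (intro SUP_cong refl nn_integral_eq_integral integrable_continuous_\<beta>)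
     (use f in \<open>auto intro!: continuous_intros continuous_dilate\<close>)

lemma hardy_space_iff:
  "f \<in> hardy_space D \<beta> \<longleftrightarrow> hol_on f D \<and> (\<exists>M. \<forall>\<rho>. 0 \<le> \<rho> \<and> \<rho> < 1 \<longrightarrow> radial_norm_sq f \<rho> \<le> M)"
proof (cases "hol_on f D")
  case True
  have "hardy_norm_sq \<beta> f < \<infinity> \<longleftrightarrow> (\<exists>M. \<forall>\<rho>. 0 \<le> \<rho> \<and> \<rho> < 1 \<longrightarrow> radial_norm_sq f \<rho> \<le> M)"
  proof
    assume fin: "hardy_norm_sq \<beta> f < \<infinity>"
    have "radial_norm_sq f \<rho> \<le> enn2real (hardy_norm_sq \<beta> f)" if "0 \<le> \<rho>" "\<rho> < 1" for \<rho>
    proof -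
      have "ennreal (radial_norm_sq f \<rho>) \<le> hardy_norm_sq \<beta> f"
        unfolding hardy_norm_sq_eq[OF True] by (rule SUP_upper) (use that in auto)
      also have "\<dots> = ennreal (enn2real (hardy_norm_sq \<beta> f))" using fin by (simp add: less_top)
      finally show ?thesis by simp
    qed
    then show "\<exists>M. \<forall>\<rho>. 0 \<le> \<rho> \<and> \<rho> < 1 \<longrightarrow> radial_norm_sq f \<rho> \<le> M" by blast
  next
    assume "\<exists>M. \<forall>\<rho>. 0 \<le> \<rho> \<and> \<rho> < 1 \<longrightarrow> radial_norm_sq f \<rho> \<le> M"
    then obtain M where "\<And>\<rho>. 0 \<le> \<rho> \<Longrightarrow> \<rho> < 1 \<Longrightarrow> radial_norm_sq f \<rho> \<le> M" by blast
    then have "hardy_norm_sq \<beta> f \<le> ennreal M"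
      unfolding hardy_norm_sq_eq[OF True] by (intro SUP_least ennreal_leI) auto
    then show "hardy_norm_sq \<beta> f < \<infinity>" by (simp add: le_less_trans)
  qed
  then show ?thesis using True by (simp add: hardy_space_def)
qed (simp add: hardy_space_def)

text \<open>
  The supremum over all radii is a limit by monotonicity.
\<close>

lemma hardy_norm_sq_limit:
  assumes f: "f \<in> hardy_space D \<beta>"
  shows "(\<lambda>n. radial_norm_sq f (radius n)) \<longlonglongrightarrow> enn2real (hardy_norm_sq \<beta> f)"
proof -
  have h: "hol_on f D" and fin: "hardy_norm_sq \<beta> f < \<infinity>" using f by (auto simp: hardy_space_def)
  have inc: "incseq (\<lambda>n. ennreal (radial_norm_sq f (radius n)))"
    by (intro incseq_def[THEN iffD2] allI impI ennreal_leI radial_norm_sq_mono[OF h] radius_mono) (auto simp: radius_bounds)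
  have "(SUP n. ennreal (radial_norm_sq f (radius n))) = hardy_norm_sq \<beta> f"
    unfolding hardy_norm_sq_eq[OF h]
  proof (intro antisym SUP_least)
    show "ennreal (radial_norm_sq f (radius n)) \<le> (SUP \<rho>\<in>{0..<1}. ennreal (radial_norm_sq f \<rho>))" for n
      by (rule SUP_upper) (auto simp: radius_bounds)
    fix \<rho> :: real assume \<rho>: "\<rho> \<in> {0..<1}"
    then have "eventually (\<lambda>n. \<rho> < radius n) sequentially"
      by (intro order_tendstoD(1)[OF radius_tendsto]) auto
    then obtain n where "\<rho> < radius n" by (auto simp: eventually_sequentially)
    then have "ennreal (radial_norm_sq f \<rho>) \<le> ennreal (radial_norm_sq f (radius n))"
      using \<rho> by (intro ennreal_leI radial_norm_sq_mono[OF h]) (auto simp: radius_bounds)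
    then show "ennreal (radial_norm_sq f \<rho>) \<le> (SUP n. ennreal (radial_norm_sq f (radius n)))"
      by (rule SUP_upper2[OF UNIV_I])
  qed
  with LIMSEQ_SUP[OF inc] have "(\<lambda>n. ennreal (radial_norm_sq f (radius n))) \<longlonglongrightarrow> hardy_norm_sq \<beta> f" by simp
  also have "hardy_norm_sq \<beta> f = ennreal (enn2real (hardy_norm_sq \<beta> f))" using fin by (simp add: less_top)
  finally show ?thesis
    by (subst (asm) tendsto_ennreal_iff) (auto intro!: always_eventually radial_norm_sq_nonneg)
qed

lemma hardy_space_add:
  assumes "f \<in> hardy_space D \<beta>" "g \<in> hardy_space D \<beta>"
  shows "(\<lambda>z. f z + c * g z) \<in> hardy_space D \<beta>"
proof -
  obtain M M' where h: "hol_on f D" "hol_on g D"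
    and M: "\<And>\<rho>. 0 \<le> \<rho> \<Longrightarrow> \<rho> < 1 \<Longrightarrow> radial_norm_sq f \<rho> \<le> M"
    and M': "\<And>\<rho>. 0 \<le> \<rho> \<Longrightarrow> \<rho> < 1 \<Longrightarrow> radial_norm_sq g \<rho> \<le> M'"
    using assms unfolding hardy_space_iff by blast
  have "radial_norm_sq (\<lambda>z. f z + c * g z) \<rho> \<le> 2 * M + 2 * (cmod c)\<^sup>2 * M'" if r: "0 \<le> \<rho>" "\<rho> < 1" for \<rho>
  proof -
    have pt: "(cmod (a + c * b))\<^sup>2 \<le> 2 * (cmod a)\<^sup>2 + 2 * (cmod c)\<^sup>2 * (cmod b)\<^sup>2" for a b
    proof -
      have "(cmod (a + c * b))\<^sup>2 \<le> (cmod a + cmod (c * b))\<^sup>2"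
        by (intro power_mono norm_triangle_ineq) auto
      also have "\<dots> \<le> 2 * (cmod a)\<^sup>2 + 2 * (cmod (c * b))\<^sup>2"
        using sum_squares_bound[of "cmod a" "cmod (c * b)"] by (simp add: power2_sum)
      finally show ?thesis by (simp add: norm_mult power_mult_distrib)
    qed
    have i: "integrable \<beta> (\<lambda>\<zeta>. (cmod (f (\<rho> *\<^sub>R \<zeta>)))\<^sup>2)" "integrable \<beta> (\<lambda>\<zeta>. (cmod (g (\<rho> *\<^sub>R \<zeta>)))\<^sup>2)"
      "integrable \<beta> (\<lambda>\<zeta>. (cmod (f (\<rho> *\<^sub>R \<zeta>) + c * g (\<rho> *\<^sub>R \<zeta>)))\<^sup>2)"
      by (intro integrable_continuous_\<beta> continuous_intros continuous_dilate h r)+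
    have "radial_norm_sq (\<lambda>z. f z + c * g z) \<rho> \<le> (\<integral>\<zeta>. 2 * (cmod (f (\<rho> *\<^sub>R \<zeta>)))\<^sup>2 + 2 * (cmod c)\<^sup>2 * (cmod (g (\<rho> *\<^sub>R \<zeta>)))\<^sup>2 \<partial>\<beta>)"
      unfolding radial_norm_sq_def by (intro integral_mono i Bochner_Integration.integrable_add integrable_mult_right pt)
    also have "\<dots> = 2 * radial_norm_sq f \<rho> + 2 * (cmod c)\<^sup>2 * radial_norm_sq g \<rho>"
      unfolding radial_norm_sq_def using i by simp
    also have "\<dots> \<le> 2 * M + 2 * (cmod c)\<^sup>2 * M'" by (intro add_mono mult_left_mono M M' r) auto
    finally show ?thesis .
  qed
  then show ?thesis unfolding hardy_space_iff using hol_on_add[OF h] by blast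
qed

text \<open>
  The polarization identity in the definition of the inner product holds pointwise, hence for the
  integrals, and the four norms converge.
\<close>

lemma hardy_inner_limit:
  assumes "f \<in> hardy_space D \<beta>" "g \<in> hardy_space D \<beta>"
  shows "(\<lambda>n. radial_inner f g (radius n) (radius n)) \<longlonglongrightarrow> hardy_inner \<beta> f g"
proof -
  have h: "hol_on f D" "hol_on g D" using assms by (auto simp: hardy_space_def)
  have pol: "radial_inner f g \<rho> \<rho> = (\<Sum>k<4. \<i> ^ k * of_real (radial_norm_sq (\<lambda>z. f z + \<i> ^ k * g z) \<rho>)) / 4"
    if r: "0 \<le> \<rho>" "\<rho> < 1" for \<rho>
  proof -
    have i: "integrable \<beta> (\<lambda>\<zeta>. complex_of_real ((cmod (f (\<rho> *\<^sub>R \<zeta>) + \<i> ^ k * g (\<rho> *\<^sub>R \<zeta>)))\<^sup>2))" for k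
      by (intro integrable_continuous_\<beta> continuous_intros continuous_dilate h r)
    have "radial_inner f g \<rho> \<rho> = (\<integral>\<zeta>. (\<Sum>k<4. \<i> ^ k * of_real ((cmod (f (\<rho> *\<^sub>R \<zeta>) + \<i> ^ k * g (\<rho> *\<^sub>R \<zeta>)))\<^sup>2)) / 4 \<partial>\<beta>)"
      unfolding radial_inner_def polarization_pointwise ..
    also have "\<dots> = (\<Sum>k<4. \<i> ^ k * (\<integral>\<zeta>. of_real ((cmod (f (\<rho> *\<^sub>R \<zeta>) + \<i> ^ k * g (\<rho> *\<^sub>R \<zeta>)))\<^sup>2) \<partial>\<beta>)) / 4"
      by (simp only: integral_divide_zero Bochner_Integration.integral_sum[OF integrable_mult_right[OF i]] integral_mult_right_zero)
    finally show ?thesis unfolding radial_norm_sq_def by (simp only: integral_complex_of_real)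
  qed
  have "(\<lambda>n. (\<Sum>k<4. \<i> ^ k * of_real (radial_norm_sq (\<lambda>z. f z + \<i> ^ k * g z) (radius n))) / 4) \<longlonglongrightarrow> hardy_inner \<beta> f g"
    unfolding hardy_inner_def
    by (intro tendsto_intros hardy_norm_sq_limit hardy_space_add assms) auto
  then show ?thesis unfolding pol[OF radius_bounds, symmetric] .
qed

lemma hardy_inner_hermitian:
  assumes "f \<in> hardy_space D \<beta>" "g \<in> hardy_space D \<beta>"
  shows "hardy_inner \<beta> g f = cnj (hardy_inner \<beta> f g)"
proof (rule LIMSEQ_unique[OF hardy_inner_limit[OF assms(2,1)]])
  have "cnj (radial_inner f g \<rho> \<rho>) = radial_inner g f \<rho> \<rho>" for \<rho>
    unfolding radial_inner_def Bochner_Integration.integral_cnj[symmetric] by (simp add: mult.commute)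
  then show "(\<lambda>n. radial_inner g f (radius n) (radius n)) \<longlonglongrightarrow> cnj (hardy_inner \<beta> f g)"
    using tendsto_cnj[OF hardy_inner_limit[OF assms]] by simp
qed

lemma hol_on_dilate:
  assumes "hol_on f D" "0 \<le> r" "r < 1" shows "hol_on (\<lambda>z. f (r *\<^sub>R z)) D"
  using hol_on_compose_linear[OF assms(1) clinear_scalar[of "of_real r"], of D] scaleR_D_mem_D assms(2,3)
  by (simp add: scaleR_eq_scalar_mult)

lemma hardy_space_dilate:
  assumes f: "f \<in> hardy_space D \<beta>" and r: "0 \<le> r" "r < 1"
  shows "(\<lambda>z. f (r *\<^sub>R z)) \<in> hardy_space D \<beta>"
proof -
  obtain M where M: "\<And>\<rho>. 0 \<le> \<rho> \<Longrightarrow> \<rho> < 1 \<Longrightarrow> radial_norm_sq f \<rho> \<le> M" and h: "hol_on f D"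
    using f unfolding hardy_space_iff by blast
  have "radial_norm_sq (\<lambda>z. f (r *\<^sub>R z)) \<rho> \<le> M" if "0 \<le> \<rho>" "\<rho> < 1" for \<rho>
  proof -
    have "r * \<rho> \<le> \<rho>" using that r by (intro mult_left_le_one_le) auto
    then have "radial_norm_sq f (r * \<rho>) \<le> M" using that r by (intro M) auto
    then show ?thesis by (simp add: radial_norm_sq_def)
  qed
  then show ?thesis unfolding hardy_space_iff using hol_on_dilate[OF h r] by blast
qed

text \<open>
  The dilation by \<open>s\<^sup>2\<close> can be shared between the two functions because only the product of the radii
  counts. Then both are evaluated inside \<open>D\<close> only, and the limit in the inner product is an integral
  of continuous functions.
\<close>

lemma hardy_inner_dilate:
  assumes f: "f \<in> hardy_space D \<beta>" and g: "g \<in> hardy_space D \<beta>" and s: "0 < s" "s < 1"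
  shows "hardy_inner \<beta> (\<lambda>z. f (s\<^sup>2 *\<^sub>R z)) g = radial_inner f g s s"
proof (rule LIMSEQ_unique)
  have h: "hol_on f D" "hol_on g D" using f g by (auto simp: hardy_space_def)
  have s2: "0 \<le> s\<^sup>2" "s\<^sup>2 < 1" using s by (auto simp: power_less_one_iff abs_square_less_1)
  show "(\<lambda>n. radial_inner (\<lambda>z. f (s\<^sup>2 *\<^sub>R z)) g (radius n) (radius n)) \<longlonglongrightarrow> hardy_inner \<beta> (\<lambda>z. f (s\<^sup>2 *\<^sub>R z)) g"
    by (rule hardy_inner_limit[OF hardy_space_dilate[OF f s2] g])
  have sr: "0 \<le> s * radius n" "s * radius n < 1" "s * radius n \<le> s" for n
    using s radius_bounds[of n] by (auto simp: mult_le_cancel_left1 less_imp_le intro: le_less_trans[OF mult_right_le_one_le])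
  have s2r: "0 \<le> s\<^sup>2 * radius n" "s\<^sup>2 * radius n < 1" for n
    using s2 radius_bounds[of n] by (auto intro: le_less_trans[OF mult_right_le_one_le])
  have "radial_inner (\<lambda>z. f (s\<^sup>2 *\<^sub>R z)) g (radius n) (radius n) = radial_inner f g (s * radius n) (s * radius n)" for n
  proof -
    have "radial_inner (\<lambda>z. f (s\<^sup>2 *\<^sub>R z)) g (radius n) (radius n) = radial_inner f g (s\<^sup>2 * radius n) (radius n)"
      by (simp add: radial_inner_def)
    also have "\<dots> = radial_inner f g (s * radius n) (s * radius n)"
      by (rule radial_inner_depends_on_product[OF h s2r radius_bounds sr(1,2) sr(1,2)]) (simp add: power2_eq_square)
    finally show ?thesis .
  qed
  moreover have "(\<lambda>n. radial_inner f g (s * radius n) (s * radius n)) \<longlonglongrightarrow> radial_inner f g s s"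
    unfolding radial_inner_def
  proof -
    have bd: "\<exists>M. \<forall>\<zeta>\<in>B. \<forall>t\<in>{0..s}. norm (f (t *\<^sub>R \<zeta>)) \<le> M" if "hol_on f D" for f
    proof -
      let ?K = "(\<lambda>p. fst p *\<^sub>R snd p) ` ({0..s} \<times> B)"
      have "compact ?K" by (intro compact_continuous_image compact_Times compact_B continuous_intros) auto
      moreover have "?K \<subseteq> D" using scaleR_B_mem_D s by fastforce
      then have "continuous_on ?K f" by (rule continuous_on_subset[OF hol_on_imp_continuous_on[OF that]])
      ultimately have "compact (f ` ?K)" by (rule compact_continuous_image[rotated])
      then have "bounded (f ` ?K)" by (rule compact_imp_bounded)
      then obtain M where "\<forall>y\<in>f ` ?K. norm y \<le> M" by (auto simp only: bounded_iff)
      then show ?thesis by (intro exI[of _ M]) auto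
    qed
    obtain M where M: "\<And>\<zeta> t. \<zeta> \<in> B \<Longrightarrow> t \<in> {0..s} \<Longrightarrow> norm (f (t *\<^sub>R \<zeta>)) \<le> M" using bd[OF h(1)] by blast
    obtain M' where M': "\<And>\<zeta> t. \<zeta> \<in> B \<Longrightarrow> t \<in> {0..s} \<Longrightarrow> norm (g (t *\<^sub>R \<zeta>)) \<le> M'" using bd[OF h(2)] by blast
    have lim: "(\<lambda>n. s * radius n) \<longlonglongrightarrow> s" using tendsto_mult_left[OF radius_tendsto, of s] by simp
    have ptw: "(\<lambda>n. f ((s * radius n) *\<^sub>R \<zeta>)) \<longlonglongrightarrow> f (s *\<^sub>R \<zeta>)" if "hol_on f D" "\<zeta> \<in> B" for f \<zeta>
    proof (rule continuous_on_tendsto_compose[OF hol_on_imp_continuous_on[OF that(1)]])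
      show "(\<lambda>n. (s * radius n) *\<^sub>R \<zeta>) \<longlonglongrightarrow> s *\<^sub>R \<zeta>" by (intro tendsto_scaleR lim tendsto_const)
      show "s *\<^sub>R \<zeta> \<in> D" using scaleR_B_mem_D that(2) s by auto
      show "\<forall>\<^sub>F n in sequentially. (s * radius n) *\<^sub>R \<zeta> \<in> D"
        using scaleR_B_mem_D[OF that(2) sr(1,2)] by simp
    qed
    show "(\<lambda>n. \<integral>\<zeta>. f ((s * radius n) *\<^sub>R \<zeta>) * cnj (g ((s * radius n) *\<^sub>R \<zeta>)) \<partial>\<beta>) \<longlonglongrightarrow> (\<integral>\<zeta>. f (s *\<^sub>R \<zeta>) * cnj (g (s *\<^sub>R \<zeta>)) \<partial>\<beta>)"
    proof (rule integral_dominated_convergence[where w = "\<lambda>_. M * M'"])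
      show "(\<lambda>\<zeta>. f (s *\<^sub>R \<zeta>) * cnj (g (s *\<^sub>R \<zeta>))) \<in> borel_measurable \<beta>"
        by (intro continuous_imp_measurable_\<beta> continuous_intros continuous_dilate h) (use s in auto)
      show "(\<lambda>\<zeta>. f ((s * radius n) *\<^sub>R \<zeta>) * cnj (g ((s * radius n) *\<^sub>R \<zeta>))) \<in> borel_measurable \<beta>" for n
        by (intro continuous_imp_measurable_\<beta> continuous_intros continuous_dilate h sr)
      show "AE \<zeta> in \<beta>. (\<lambda>n. f ((s * radius n) *\<^sub>R \<zeta>) * cnj (g ((s * radius n) *\<^sub>R \<zeta>))) \<longlonglongrightarrow> f (s *\<^sub>R \<zeta>) * cnj (g (s *\<^sub>R \<zeta>))"
        by (intro AE_I2 tendsto_mult tendsto_cnj ptw h) (auto simp: space_\<beta>)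
      show "AE \<zeta> in \<beta>. norm (f ((s * radius n) *\<^sub>R \<zeta>) * cnj (g ((s * radius n) *\<^sub>R \<zeta>))) \<le> M * M'" for n
      proof (rule AE_I2)
        fix \<zeta> assume "\<zeta> \<in> space \<beta>"
        then have \<zeta>: "\<zeta> \<in> B" by (simp add: space_\<beta>)
        have t: "s * radius n \<in> {0..s}" using sr by auto
        show "norm (f ((s * radius n) *\<^sub>R \<zeta>) * cnj (g ((s * radius n) *\<^sub>R \<zeta>))) \<le> M * M'"
          unfolding norm_mult complex_mod_cnj
          by (rule mult_mono[OF M[OF \<zeta> t] M'[OF \<zeta> t]]) (use order_trans[OF norm_ge_zero M[OF \<zeta> t]] in auto)
      qed
    qed simp
  qed
  ultimately show "(\<lambda>n. radial_inner (\<lambda>z. f (s\<^sup>2 *\<^sub>R z)) g (radius n) (radius n)) \<longlonglongrightarrow> radial_inner f g s s" by simp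
qed

end

section \<open>The kernel and its concentration at the boundary\<close>

lemma bij_linear_inv:
  assumes "Vector_Spaces.linear (*s) (*s) (T :: complex^'n \<Rightarrow> complex^'n)" "bij T"
  shows "Vector_Spaces.linear (*s) (*s) (inv T)"
proof -
  have T: "T (x + y) = T x + T y" "T (c *s x) = c *s T x" for x y c
    using assms(1) by (auto simp: Vector_Spaces.linear_iff)
  have s: "T (inv T x) = x" "inv T (T x) = x" for x
    using assms(2) by (simp_all add: bij_is_surj surj_f_inv_f bij_is_inj)
  have "inv T (x + y) = inv T x + inv T y" for x y
    using s(2)[of "inv T x + inv T y"] by (simp add: T s(1))
  moreover have "inv T (c *s x) = c *s inv T x" for x c
    using s(2)[of "c *s inv T x"] by (simp add: T s(1))
  ultimately show ?thesis using assms(1) by (simp add: Vector_Spaces.linear_iff)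
qed

lemma linear_automorphisms_inv:
  assumes "T \<in> linear_automorphisms D" shows "inv T \<in> linear_automorphisms D"
proof -
  have T: "Vector_Spaces.linear (*s) (*s) T" "bij T" "T ` D = D" using assms by (auto simp: linear_automorphisms_def)
  have "inv T ` D = D" using T(2,3) by (metis bij_is_inj image_inv_f_f)
  then show ?thesis using bij_linear_inv[OF T(1,2)] T(2) by (simp add: linear_automorphisms_def bij_imp_bij_inv)
qed

context circular_domain
begin

lemma kernel_hardy: "w \<in> D \<Longrightarrow> (\<lambda>z. C z w) \<in> hardy_space D \<beta>"
  and kernel_reproduces: "w \<in> D \<Longrightarrow> f \<in> hardy_space D \<beta> \<Longrightarrow> f w = hardy_inner \<beta> f (\<lambda>z. C z w)"
  using kernel by (auto simp: is_reproducing_kernel_def)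

lemma kernel_hol: "w \<in> D \<Longrightarrow> hol_on (\<lambda>z. C z w) D"
  using kernel_hardy by (auto simp: hardy_space_def)

lemma square_bounds: "0 < s \<Longrightarrow> s < 1 \<Longrightarrow> 0 \<le> s\<^sup>2 \<and> s\<^sup>2 < (1::real)"
  by (simp add: power_less_one_iff)

text \<open>
  The reproducing property applied to the dilate of \<open>f\<close>, whose inner products are integrals by
  \<open>hardy_inner_dilate\<close>.
\<close>

lemma reproducing_integral:
  assumes f: "f \<in> hardy_space D \<beta>" and w: "w \<in> D" and s: "0 < s" "s < 1"
  shows "f (s\<^sup>2 *\<^sub>R w) = (\<integral>\<zeta>. f (s *\<^sub>R \<zeta>) * cnj (C (s *\<^sub>R \<zeta>) w) \<partial>\<beta>)"
proof -
  have "f (s\<^sup>2 *\<^sub>R w) = hardy_inner \<beta> (\<lambda>z. f (s\<^sup>2 *\<^sub>R z)) (\<lambda>z. C z w)"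
    by (rule kernel_reproduces[OF w hardy_space_dilate[OF f]]) (use square_bounds[OF s] in auto)
  also have "\<dots> = radial_inner f (\<lambda>z. C z w) s s"
    by (rule hardy_inner_dilate[OF f kernel_hardy[OF w] s])
  finally show ?thesis by (simp add: radial_inner_def)
qed

lemma kernel_dilate_hermitian:
  assumes "v \<in> D" "w \<in> D" and s: "0 < s" "s < 1"
  shows "C (s\<^sup>2 *\<^sub>R w) v = cnj (C (s\<^sup>2 *\<^sub>R v) w)"
  unfolding reproducing_integral[OF kernel_hardy[OF assms(1)] assms(2) s] reproducing_integral[OF kernel_hardy[OF assms(2)] assms(1) s]
    Bochner_Integration.integral_cnj[symmetric]
  by (simp add: mult.commute)

text \<open>
  For dilated arguments this is the symmetry of the reproducing integral; the kernel is continuous in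
  its first argument.
\<close>

lemma kernel_hermitian:
  assumes "v \<in> D" "w \<in> D" shows "C w v = cnj (C v w)"
proof (rule LIMSEQ_unique)
  let ?s = "\<lambda>n. (radius (Suc n))\<^sup>2"
  have lim: "(\<lambda>n. C (?s n *\<^sub>R w) v) \<longlonglongrightarrow> C w v" if "v \<in> D" "w \<in> D" for v w
  proof (rule continuous_on_tendsto_compose[OF hol_on_imp_continuous_on[OF kernel_hol[OF that(1)]] _ that(2)])
    have "(\<lambda>n. ?s n *\<^sub>R w) \<longlonglongrightarrow> 1\<^sup>2 *\<^sub>R w" by (intro tendsto_intros LIMSEQ_Suc[OF radius_tendsto])
    then show "(\<lambda>n. ?s n *\<^sub>R w) \<longlonglongrightarrow> w" by simp
    show "\<forall>\<^sub>F n in sequentially. ?s n *\<^sub>R w \<in> D"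
      using radius_bounds by (auto intro!: always_eventually scaleR_D_mem_D that power_less_one_iff[THEN iffD2])
  qed
  show "(\<lambda>n. C (?s n *\<^sub>R w) v) \<longlonglongrightarrow> C w v" by (rule lim[OF assms])
  have "0 < radius (Suc n)" for n by (simp add: radius_def)
  then have "C (?s n *\<^sub>R w) v = cnj (C (?s n *\<^sub>R v) w)" for n
    by (rule kernel_dilate_hermitian[OF assms _ radius_bounds(2)])
  then show "(\<lambda>n. C (?s n *\<^sub>R w) v) \<longlonglongrightarrow> cnj (C v w)"
    using tendsto_cnj[OF lim[OF assms(2,1)]] by simp
qed

lemma kernel_move_dilation:
  assumes "v \<in> D" "w \<in> D" and r: "0 < r" "r < 1"
  shows "C (r *\<^sub>R w) v = C w (r *\<^sub>R v)"
proof -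
  have "C (r *\<^sub>R w) v = cnj (C (r *\<^sub>R v) w)"
    using kernel_dilate_hermitian[OF assms(1,2), of "sqrt r"] r by simp
  also have "\<dots> = C w (r *\<^sub>R v)"
    by (rule kernel_hermitian[symmetric]) (use scaleR_D_mem_D assms in auto)
  finally show ?thesis .
qed

text \<open>
  Moving the dilation to the second argument replaces the limit at the boundary point \<open>\<zeta>\<close> by the value
  at the interior point \<open>r *\<^sub>R \<zeta>\<close>.
\<close>

lemma kernel_extension_eq:
  assumes w: "w \<in> D" and \<zeta>: "\<zeta> \<in> B" and r: "0 < r" "r < 1"
  shows "kernel_extension D C (r *\<^sub>R w) \<zeta> = C w (r *\<^sub>R \<zeta>)"
  unfolding kernel_extension_def
proof (rule tendsto_Lim)
  have "\<zeta> \<in> closure D" "\<zeta> \<notin> D"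
    using B_frontier \<zeta> open_D by (auto simp: frontier_def interior_open)
  then show "at \<zeta> within D \<noteq> bot" by (simp add: closure_def trivial_limit_within)
  have rD: "r *\<^sub>R \<zeta> \<in> D" using scaleR_B_mem_D \<zeta> r by simp
  have "isCont (\<lambda>z. C z w) (r *\<^sub>R \<zeta>)"
    using hol_on_imp_continuous_on[OF kernel_hol[OF w]] rD open_D by (simp add: continuous_on_eq_continuous_at)
  then have "((\<lambda>v. C (r *\<^sub>R v) w) \<longlongrightarrow> C (r *\<^sub>R \<zeta>) w) (at \<zeta> within D)"
    by (rule isCont_tendsto_compose) (intro tendsto_intros)
  then have "((\<lambda>v. cnj (C (r *\<^sub>R v) w)) \<longlongrightarrow> cnj (C (r *\<^sub>R \<zeta>) w)) (at \<zeta> within D)"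
    by (rule tendsto_cnj)
  moreover have "cnj (C (r *\<^sub>R \<zeta>) w) = C w (r *\<^sub>R \<zeta>)"
    by (rule kernel_hermitian[OF rD w, symmetric])
  moreover have "\<forall>\<^sub>F v in at \<zeta> within D. C (r *\<^sub>R w) v = cnj (C (r *\<^sub>R v) w)"
  proof -
    have "C (r *\<^sub>R w) v = cnj (C (r *\<^sub>R v) w)" if "v \<in> D" for v
      using kernel_dilate_hermitian[OF that w, of "sqrt r"] r by simp
    then show ?thesis by (simp add: eventually_at_filter)
  qed
  ultimately show "(C (r *\<^sub>R w) \<longlongrightarrow> C w (r *\<^sub>R \<zeta>)) (at \<zeta> within D)"
    by (auto intro: Lim_transform_eventually[rotated] elim!: eventually_mono)
qed

lemma radial_inner_automorphism:
  assumes T: "T \<in> linear_automorphisms D" and f: "hol_on f D" and \<rho>: "0 \<le> \<rho>" "\<rho> < 1" and g: "hol_on g D"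
  shows "radial_inner (\<lambda>z. f (T z)) g \<rho> \<rho> = radial_inner f (\<lambda>z. g (inv T z)) \<rho> \<rho>"
proof -
  have lin: "Vector_Spaces.linear (*s) (*s) T" and bij: "bij T" using T by (auto simp: linear_automorphisms_def)
  have T_scale: "T (\<rho> *\<^sub>R \<zeta>) = \<rho> *\<^sub>R T \<zeta>" for \<zeta>
    using lin by (simp add: Vector_Spaces.linear_iff scaleR_eq_scalar_mult)
  have lin': "Vector_Spaces.linear (*s) (*s) (inv T)" by (rule bij_linear_inv[OF lin bij])
  have T_scale': "inv T (\<rho> *\<^sub>R \<zeta>) = \<rho> *\<^sub>R inv T \<zeta>" for \<zeta>
    using lin' by (simp add: Vector_Spaces.linear_iff scaleR_eq_scalar_mult)
  have "hol_on (\<lambda>z. g (inv T z)) D"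
    using linear_automorphisms_inv[OF T] by (intro hol_on_compose_linear[OF g lin']) (auto simp: linear_automorphisms_def)
  then have "(\<lambda>\<zeta>. f (\<rho> *\<^sub>R \<zeta>) * cnj (g (inv T (\<rho> *\<^sub>R \<zeta>)))) \<in> borel_measurable \<beta>"
    by (intro continuous_imp_measurable_\<beta> continuous_intros continuous_dilate[where f = f] continuous_dilate[where f = "\<lambda>z. g (inv T z)"] f \<rho>)
  from integral_automorphism[OF T this] show ?thesis
    using bij by (simp add: radial_inner_def T_scale T_scale' bij_is_inj)
qed

lemma hardy_space_automorphism:
  assumes T: "T \<in> linear_automorphisms D" and f: "f \<in> hardy_space D \<beta>"
  shows "(\<lambda>z. f (T z)) \<in> hardy_space D \<beta>"
proof -
  have lin: "Vector_Spaces.linear (*s) (*s) T" using T by (auto simp: linear_automorphisms_def)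
  have T_scale: "T (\<rho> *\<^sub>R \<zeta>) = \<rho> *\<^sub>R T \<zeta>" for \<rho> \<zeta>
    using lin by (simp add: Vector_Spaces.linear_iff scaleR_eq_scalar_mult)
  have h: "hol_on f D" using f by (simp add: hardy_space_def)
  have "radial_norm_sq (\<lambda>z. f (T z)) \<rho> = radial_norm_sq f \<rho>" if "0 \<le> \<rho>" "\<rho> < 1" for \<rho>
  proof -
    have "(\<lambda>\<zeta>. (cmod (f (\<rho> *\<^sub>R \<zeta>)))\<^sup>2) \<in> borel_measurable \<beta>"
      by (intro continuous_imp_measurable_\<beta> continuous_intros continuous_dilate h that)
    from integral_automorphism[OF T this] show ?thesis by (simp add: radial_norm_sq_def T_scale)
  qed
  moreover have "hol_on (\<lambda>z. f (T z)) D"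
    using T by (intro hol_on_compose_linear[OF h lin]) (auto simp: linear_automorphisms_def)
  ultimately show ?thesis using f unfolding hardy_space_iff by simp
qed

text \<open>
  The kernel composed with \<open>T\<close> in both arguments reproduces as well, because composition with \<open>T\<close> preserves
  the inner product.
\<close>

lemma kernel_automorphism:
  assumes T: "T \<in> linear_automorphisms D" and z: "z \<in> D" and w: "w \<in> D"
  shows "C (T z) (T w) = C z w"
proof -
  have TD: "T w \<in> D" using T w by (auto simp: linear_automorphisms_def)
  have invT: "inv T (T w) = w" using T by (auto simp: linear_automorphisms_def bij_is_inj)
  let ?h = "\<lambda>z. C (T z) (T w)" and ?k = "\<lambda>y. C (inv T y) z"
  have h: "?h \<in> hardy_space D \<beta>" by (rule hardy_space_automorphism[OF T kernel_hardy[OF TD]])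
  have k: "?k \<in> hardy_space D \<beta>" by (rule hardy_space_automorphism[OF linear_automorphisms_inv[OF T] kernel_hardy[OF z]])
  have "?h z = hardy_inner \<beta> ?h (\<lambda>y. C y z)" by (rule kernel_reproduces[OF z h])
  also have "\<dots> = hardy_inner \<beta> (\<lambda>y. C y (T w)) ?k"
  proof (rule LIMSEQ_unique[OF hardy_inner_limit[OF h kernel_hardy[OF z]]])
    have "radial_inner ?h (\<lambda>y. C y z) (radius n) (radius n) = radial_inner (\<lambda>y. C y (T w)) ?k (radius n) (radius n)" for n
      by (rule radial_inner_automorphism[OF T kernel_hol[OF TD] radius_bounds kernel_hol[OF z]])
    then show "(\<lambda>n. radial_inner ?h (\<lambda>y. C y z) (radius n) (radius n)) \<longlonglongrightarrow> hardy_inner \<beta> (\<lambda>y. C y (T w)) ?k"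
      using hardy_inner_limit[OF kernel_hardy[OF TD] k] by simp
  qed
  also have "\<dots> = cnj (hardy_inner \<beta> ?k (\<lambda>y. C y (T w)))"
    by (rule hardy_inner_hermitian[OF k kernel_hardy[OF TD]])
  also have "\<dots> = cnj (?k (T w))" by (simp only: kernel_reproduces[OF TD k, symmetric])
  also have "\<dots> = cnj (C w z)" by (simp add: invT)
  also have "\<dots> = C z w" by (rule kernel_hermitian[OF w z, symmetric])
  finally show ?thesis .
qed

text \<open>
  By \<open>kernel_automorphism\<close> and transitivity the kernel takes one and the same value at all points
  \<open>(r *\<^sub>R \<xi>, r *\<^sub>R \<xi>)\<close> with \<open>\<xi> \<in> B\<close>.
\<close>

definition diagonal :: "real \<Rightarrow> real" where
  "diagonal r = Re (C (r *\<^sub>R (SOME \<zeta>. \<zeta> \<in> B)) (r *\<^sub>R (SOME \<zeta>. \<zeta> \<in> B)))"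

lemma kernel_square_integral:
  assumes w: "w \<in> D" and s: "0 < s" "s < 1"
  shows "of_real (\<integral>\<zeta>. (cmod (C (s *\<^sub>R \<zeta>) w))\<^sup>2 \<partial>\<beta>) = C (s *\<^sub>R w) (s *\<^sub>R w)"
proof -
  have "of_real (\<integral>\<zeta>. (cmod (C (s *\<^sub>R \<zeta>) w))\<^sup>2 \<partial>\<beta>) = (\<integral>\<zeta>. C (s *\<^sub>R \<zeta>) w * cnj (C (s *\<^sub>R \<zeta>) w) \<partial>\<beta>)"
    by (simp only: complex_norm_square[symmetric] integral_complex_of_real)
  also have "\<dots> = C (s\<^sup>2 *\<^sub>R w) w" by (rule reproducing_integral[OF kernel_hardy[OF w] w s, symmetric])
  also have "\<dots> = C (s *\<^sub>R (s *\<^sub>R w)) w" by (simp add: power2_eq_square)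
  also have "\<dots> = C (s *\<^sub>R w) (s *\<^sub>R w)"
    by (rule kernel_move_dilation[OF w _ s]) (use scaleR_D_mem_D w s in auto)
  finally show ?thesis .
qed

lemma kernel_diagonal_real:
  assumes \<xi>: "\<xi> \<in> B" and r: "0 < r" "r < 1"
  shows "C (r *\<^sub>R \<xi>) (r *\<^sub>R \<xi>) = of_real (diagonal r)"
proof -
  define p where "p = (SOME \<zeta>. \<zeta> \<in> B)"
  have p: "p \<in> B" unfolding p_def using nonempty_B by (simp add: some_in_eq)
  obtain T where T: "T \<in> linear_automorphisms D" "\<xi> = T p" using transitive[OF p] \<xi> by blast
  have "T (r *\<^sub>R p) = r *\<^sub>R \<xi>"
    using T by (simp add: linear_automorphisms_def Vector_Spaces.linear_iff scaleR_eq_scalar_mult)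
  then have "C (r *\<^sub>R \<xi>) (r *\<^sub>R \<xi>) = C (r *\<^sub>R p) (r *\<^sub>R p)"
    using kernel_automorphism[OF T(1), of "r *\<^sub>R p" "r *\<^sub>R p"] scaleR_B_mem_D[OF p] r by simp
  moreover have "C (r *\<^sub>R p) (r *\<^sub>R p) = of_real (Re (C (r *\<^sub>R p) (r *\<^sub>R p)))"
  proof -
    have "r *\<^sub>R p \<in> D" using scaleR_B_mem_D[OF p] r by simp
    from kernel_hermitian[OF this this] show ?thesis by (simp add: complex_eq_iff)
  qed
  ultimately show ?thesis by (simp add: diagonal_def p_def)
qed

lemma one_hardy: "(\<lambda>_. 1) \<in> hardy_space D \<beta>"
  unfolding hardy_space_iff by (auto simp: hol_on_const radial_norm_sq_def measure_space_\<beta> space_\<beta>)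

lemma kernel_square_integral_boundary:
  assumes \<xi>: "\<xi> \<in> B" and R: "0 < R" "R < 1"
  shows "(\<integral>\<zeta>. (cmod (C (sqrt R *\<^sub>R \<zeta>) (sqrt R *\<^sub>R \<xi>)))\<^sup>2 \<partial>\<beta>) = diagonal R"
proof -
  have s: "0 < sqrt R" "sqrt R < 1" using R by auto
  have "complex_of_real (\<integral>\<zeta>. (cmod (C (sqrt R *\<^sub>R \<zeta>) (sqrt R *\<^sub>R \<xi>)))\<^sup>2 \<partial>\<beta>) = of_real (diagonal R)"
    using kernel_square_integral[OF scaleR_B_mem_D[OF \<xi>, of "sqrt R"] s] kernel_diagonal_real[OF \<xi> R] s R by simp
  then show ?thesis by simp
qed

lemma continuous_kernel: "w \<in> D \<Longrightarrow> 0 \<le> r \<Longrightarrow> r < 1 \<Longrightarrow> continuous_on B (\<lambda>\<zeta>. C (r *\<^sub>R \<zeta>) w)"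
  by (rule continuous_dilate[OF kernel_hol])

text \<open>
  The kernel reproduces the constant \<open>1\<close>, so it has mean \<open>1\<close> on \<open>B\<close>; its mean square is therefore at
  least \<open>1\<close>.
\<close>

lemma diagonal_ge_1:
  assumes R: "0 < R" "R < 1" shows "diagonal R \<ge> 1"
proof -
  obtain \<xi> where \<xi>: "\<xi> \<in> B" using nonempty_B by blast
  have s: "0 < sqrt R" "sqrt R < 1" using R by auto
  have w: "sqrt R *\<^sub>R \<xi> \<in> D" using scaleR_B_mem_D[OF \<xi>] s by simp
  define k where "k \<zeta> = C (sqrt R *\<^sub>R \<zeta>) (sqrt R *\<^sub>R \<xi>)" for \<zeta>
  have kc: "continuous_on B k" unfolding k_def using continuous_kernel[OF w] s by simp
  have "(\<integral>\<zeta>. cnj (k \<zeta>) \<partial>\<beta>) = 1"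
    using reproducing_integral[OF one_hardy w s] by (simp add: k_def)
  then have one: "(\<integral>\<zeta>. k \<zeta> \<partial>\<beta>) = 1" by simp
  have "0 \<le> (\<integral>\<zeta>. (cmod (k \<zeta> - 1))\<^sup>2 \<partial>\<beta>)" by (rule Bochner_Integration.integral_nonneg) simp
  also have "\<dots> = (\<integral>\<zeta>. (cmod (k \<zeta>))\<^sup>2 - 2 * Re (k \<zeta>) + 1 \<partial>\<beta>)"
    by (intro Bochner_Integration.integral_cong refl, simp only: cmod_power2) (simp add: power2_eq_square algebra_simps)
  also have "\<dots> = (\<integral>\<zeta>. (cmod (k \<zeta>))\<^sup>2 \<partial>\<beta>) - 2 * Re (\<integral>\<zeta>. k \<zeta> \<partial>\<beta>) + 1"
  proof -
    have i: "integrable \<beta> (\<lambda>\<zeta>. (cmod (k \<zeta>))\<^sup>2)" "integrable \<beta> k"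
      by (intro integrable_continuous_\<beta> continuous_intros kc)+
    show ?thesis using i by (simp add: integral_Re measure_space_\<beta> space_\<beta>)
  qed
  also have "(\<integral>\<zeta>. (cmod (k \<zeta>))\<^sup>2 \<partial>\<beta>) = diagonal R"
    using kernel_square_integral_boundary[OF \<xi> R] by (simp add: k_def)
  finally show ?thesis by (simp add: one)
qed

lemma kernel_bound:
  assumes \<xi>: "\<xi> \<in> B" and \<zeta>: "\<zeta> \<in> B" and r: "0 < r" "r < 1"
  shows "cmod (C (r *\<^sub>R \<xi>) (r *\<^sub>R \<zeta>)) \<le> diagonal r"
proof -
  define s where "s = sqrt r"
  have s: "0 < s" "s < 1" "s\<^sup>2 = r" using r by (auto simp: s_def)
  have D: "s *\<^sub>R \<xi> \<in> D" "s *\<^sub>R \<zeta> \<in> D" using scaleR_B_mem_D \<xi> \<zeta> s by auto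
  define a b where "a \<eta> = C (s *\<^sub>R \<eta>) (s *\<^sub>R \<zeta>)" and "b \<eta> = C (s *\<^sub>R \<eta>) (s *\<^sub>R \<xi>)" for \<eta>
  have c: "continuous_on B a" "continuous_on B b" unfolding a_def b_def using continuous_kernel D s by auto
  have i: "integrable \<beta> (\<lambda>\<eta>. (cmod (a \<eta>))\<^sup>2)" "integrable \<beta> (\<lambda>\<eta>. (cmod (b \<eta>))\<^sup>2)" "integrable \<beta> (\<lambda>\<eta>. a \<eta> * cnj (b \<eta>))"
    by (intro integrable_continuous_\<beta> continuous_intros c)+
  have "C (r *\<^sub>R \<xi>) (r *\<^sub>R \<zeta>) = C (s *\<^sub>R (s *\<^sub>R \<xi>)) (s *\<^sub>R (s *\<^sub>R \<zeta>))"
    using s(3) by (simp add: power2_eq_square)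
  also have "\<dots> = C (s *\<^sub>R (s *\<^sub>R (s *\<^sub>R \<xi>))) (s *\<^sub>R \<zeta>)"
    by (rule kernel_move_dilation[OF D(2) _ s(1,2), symmetric]) (use scaleR_D_mem_D[OF D(1)] s in auto)
  also have "\<dots> = C (s\<^sup>2 *\<^sub>R (s *\<^sub>R \<xi>)) (s *\<^sub>R \<zeta>)" by (simp add: power2_eq_square mult.assoc)
  also have "\<dots> = (\<integral>\<eta>. a \<eta> * cnj (b \<eta>) \<partial>\<beta>)"
    unfolding a_def b_def by (rule reproducing_integral[OF kernel_hardy[OF D(2)] D(1) s(1,2)])
  also have "cmod \<dots> \<le> (\<integral>\<eta>. (cmod (a \<eta>))\<^sup>2 / 2 + (cmod (b \<eta>))\<^sup>2 / 2 \<partial>\<beta>)"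
  proof (rule Bochner_Integration.integral_norm_bound_integral)
    show "cmod (a \<eta> * cnj (b \<eta>)) \<le> (cmod (a \<eta>))\<^sup>2 / 2 + (cmod (b \<eta>))\<^sup>2 / 2" for \<eta>
      using sum_squares_bound[of "cmod (a \<eta>)" "cmod (b \<eta>)"] by (simp add: norm_mult)
  qed (use i in auto)
  also have "\<dots> = diagonal r"
    using i kernel_square_integral_boundary[OF \<xi> r] kernel_square_integral_boundary[OF \<zeta> r]
    by (simp add: a_def b_def s_def)
  finally show ?thesis .
qed

text \<open>
  The product of the kernel with a linear function lies in the Hardy space and is reproduced. One
  factor \<open>sqrt R\<close> comes from the linear function on the smaller copy of \<open>B\<close> and cancels, leaving \<open>R\<close>.
\<close>

lemma linear_reproducing_integral:
  assumes \<xi>: "\<xi> \<in> B" and R: "0 < R" "R < 1"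
  shows "(\<integral>\<zeta>. Re (hermitian_inner \<zeta> \<xi>) * (cmod (C (sqrt R *\<^sub>R \<zeta>) (sqrt R *\<^sub>R \<xi>)))\<^sup>2 \<partial>\<beta>) = R * diagonal R"
proof -
  define s where "s = sqrt R"
  have s: "0 < s" "s < 1" "s\<^sup>2 = R" using R by (auto simp: s_def)
  have w: "s *\<^sub>R \<xi> \<in> D" using scaleR_B_mem_D[OF \<xi>] s by simp
  let ?l = "\<lambda>z. hermitian_inner z \<xi>" and ?k = "\<lambda>z. C z (s *\<^sub>R \<xi>)"
  have lscale: "?l (r *\<^sub>R z) = of_real r * ?l z" for r z
    by (simp add: scaleR_eq_scalar_mult hermitian_inner_def sum_distrib_left mult.assoc)
  have l\<xi>: "?l \<xi> = 1"
  proof -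
    have "?l \<xi> = of_real (Re (?l \<xi>))"
      by (simp add: hermitian_inner_def complex_eq_iff)
    also have "Re (?l \<xi>) = 1" using norm_B[OF \<xi>] by (simp flip: inner_eq_Re_hermitian_inner power2_norm_eq_inner)
    finally show ?thesis by simp
  qed
  have lbound: "cmod (?l \<zeta>) \<le> 1" if \<zeta>: "\<zeta> \<in> B" for \<zeta>
  proof -
    define \<gamma> where "\<gamma> = cnj (sgn (?l \<zeta>))"
    have "?l (\<gamma> *s \<zeta>) = of_real (cmod (?l \<zeta>))"
    proof -
      have "?l (\<gamma> *s \<zeta>) = \<gamma> * ?l \<zeta>" by (simp add: hermitian_inner_def sum_distrib_left mult.assoc)
      also have "\<dots> = of_real (cmod (?l \<zeta>))"
        by (cases "?l \<zeta> = 0") (auto simp: \<gamma>_def sgn_eq complex_norm_square[symmetric] power2_eq_square mult.commute)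
      finally show ?thesis .
    qed
    then have "cmod (?l \<zeta>) = (\<gamma> *s \<zeta>) \<bullet> \<xi>" by (simp add: inner_eq_Re_hermitian_inner)
    also have "\<dots> \<le> norm (\<gamma> *s \<zeta>) * norm \<xi>" by (rule norm_cauchy_schwarz)
    also have "\<dots> \<le> 1" using norm_B \<xi> \<zeta> by (simp add: \<gamma>_def norm_sgn)
    finally show ?thesis .
  qed
  have F: "(\<lambda>z. ?l z * ?k z) \<in> hardy_space D \<beta>"
  proof -
    obtain M where M: "\<And>\<rho>. 0 \<le> \<rho> \<Longrightarrow> \<rho> < 1 \<Longrightarrow> radial_norm_sq ?k \<rho> \<le> M"
      using kernel_hardy[OF w] unfolding hardy_space_iff by blast
    have hol: "hol_on (\<lambda>z. ?l z * ?k z) D" by (intro hol_on_mult hol_on_hermitian_inner kernel_hol w)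
    have "radial_norm_sq (\<lambda>z. ?l z * ?k z) \<rho> \<le> M" if \<rho>: "0 \<le> \<rho>" "\<rho> < 1" for \<rho>
    proof -
      have "radial_norm_sq (\<lambda>z. ?l z * ?k z) \<rho> \<le> radial_norm_sq ?k \<rho>"
        unfolding radial_norm_sq_def
      proof (rule integral_mono)
        show "integrable \<beta> (\<lambda>\<zeta>. (cmod (?l (\<rho> *\<^sub>R \<zeta>) * ?k (\<rho> *\<^sub>R \<zeta>)))\<^sup>2)"
          by (rule integrable_continuous_\<beta>[OF continuous_on_power[OF continuous_on_norm[OF continuous_dilate[OF hol \<rho>]]]])
        show "integrable \<beta> (\<lambda>\<zeta>. (cmod (?k (\<rho> *\<^sub>R \<zeta>)))\<^sup>2)"
          by (intro integrable_continuous_\<beta> continuous_intros continuous_kernel w \<rho>)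
        fix \<zeta> assume "\<zeta> \<in> space \<beta>"
        then have "cmod (?l (\<rho> *\<^sub>R \<zeta>)) \<le> 1"
          using lbound[of \<zeta>] \<rho> by (auto simp: lscale norm_mult space_\<beta> intro: mult_le_one)
        then show "(cmod (?l (\<rho> *\<^sub>R \<zeta>) * ?k (\<rho> *\<^sub>R \<zeta>)))\<^sup>2 \<le> (cmod (?k (\<rho> *\<^sub>R \<zeta>)))\<^sup>2"
          unfolding norm_mult by (intro power_mono mult_left_le_one_le) auto
      qed
      then show ?thesis using M[OF \<rho>] by simp
    qed
    then show ?thesis unfolding hardy_space_iff using hol by blast
  qed
  have "?l (s\<^sup>2 *\<^sub>R (s *\<^sub>R \<xi>)) * ?k (s\<^sup>2 *\<^sub>R (s *\<^sub>R \<xi>)) = (\<integral>\<zeta>. ?l (s *\<^sub>R \<zeta>) * ?k (s *\<^sub>R \<zeta>) * cnj (?k (s *\<^sub>R \<zeta>)) \<partial>\<beta>)"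
    by (rule reproducing_integral[OF F w s(1,2)])
  also have "\<dots> = (\<integral>\<zeta>. of_real s * (?l \<zeta> * of_real ((cmod (?k (s *\<^sub>R \<zeta>)))\<^sup>2)) \<partial>\<beta>)"
    by (simp only: lscale complex_norm_square mult.assoc)
  also have "\<dots> = of_real s * (\<integral>\<zeta>. ?l \<zeta> * of_real ((cmod (?k (s *\<^sub>R \<zeta>)))\<^sup>2) \<partial>\<beta>)"
    by (rule integral_mult_right_zero)
  finally have "of_real s * (\<integral>\<zeta>. ?l \<zeta> * of_real ((cmod (?k (s *\<^sub>R \<zeta>)))\<^sup>2) \<partial>\<beta>) = of_real s * (of_real R * ?k (s\<^sup>2 *\<^sub>R (s *\<^sub>R \<xi>)))"
    using s(3) by (auto simp add: lscale l\<xi> mult_ac)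
  then have I: "(\<integral>\<zeta>. ?l \<zeta> * of_real ((cmod (?k (s *\<^sub>R \<zeta>)))\<^sup>2) \<partial>\<beta>) = of_real R * ?k (s\<^sup>2 *\<^sub>R (s *\<^sub>R \<xi>))"
    using s(1) by simp
  have "?k (s\<^sup>2 *\<^sub>R (s *\<^sub>R \<xi>)) = C (s *\<^sub>R (s *\<^sub>R (s *\<^sub>R \<xi>))) (s *\<^sub>R \<xi>)" by (simp add: power2_eq_square mult.assoc)
  also have "\<dots> = C (s *\<^sub>R (s *\<^sub>R \<xi>)) (s *\<^sub>R (s *\<^sub>R \<xi>))"
    by (rule kernel_move_dilation[OF w _ s(1,2)]) (use scaleR_D_mem_D[OF w] s in auto)
  also have "\<dots> = C (R *\<^sub>R \<xi>) (R *\<^sub>R \<xi>)" using s(3) by (simp add: power2_eq_square)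
  also have "\<dots> = of_real (diagonal R)" by (rule kernel_diagonal_real[OF \<xi> R])
  finally have I': "(\<integral>\<zeta>. ?l \<zeta> * of_real ((cmod (?k (s *\<^sub>R \<zeta>)))\<^sup>2) \<partial>\<beta>) = of_real (R * diagonal R)"
    using I by simp
  have "continuous_on B ?l" using hol_on_imp_continuous_on[OF hol_on_hermitian_inner] .
  then have "integrable \<beta> (\<lambda>\<zeta>. ?l \<zeta> * of_real ((cmod (?k (s *\<^sub>R \<zeta>)))\<^sup>2))"
    by (intro integrable_continuous_\<beta> continuous_intros continuous_kernel w) (use s in auto)
  from integral_Re[OF this] have "(\<integral>\<zeta>. Re (?l \<zeta>) * (cmod (?k (s *\<^sub>R \<zeta>)))\<^sup>2 \<partial>\<beta>) = Re (of_real (R * diagonal R))"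
    unfolding I' by simp
  then show ?thesis by (simp add: s_def)
qed

text \<open>
  The Poisson-Szego kernel at \<open>(R *\<^sub>R \<xi>, \<zeta>)\<close>, with the dilation shared equally between the two boundary
  points. In this form both arguments of \<open>C\<close> are interior points and the symmetry is visible.
\<close>

definition boundary_kernel :: "real \<Rightarrow> complex^'n \<Rightarrow> complex^'n \<Rightarrow> real" where
  "boundary_kernel R \<xi> \<zeta> = (cmod (C (sqrt R *\<^sub>R \<xi>) (sqrt R *\<^sub>R \<zeta>)))\<^sup>2 / diagonal R"

lemma poisson_szego_eq_boundary_kernel:
  assumes "\<xi> \<in> B" "\<zeta> \<in> B" "0 < R" "R < 1"
  shows "poisson_szego D C (R *\<^sub>R \<xi>) \<zeta> = of_real (boundary_kernel R \<xi> \<zeta>)"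
proof -
  have s: "0 < sqrt R" "sqrt R < 1" using assms by auto
  have "kernel_extension D C (sqrt R *\<^sub>R (sqrt R *\<^sub>R \<xi>)) \<zeta> = C (sqrt R *\<^sub>R \<xi>) (sqrt R *\<^sub>R \<zeta>)"
    by (rule kernel_extension_eq) (use scaleR_B_mem_D assms s in auto)
  then have "kernel_extension D C (R *\<^sub>R \<xi>) \<zeta> = C (sqrt R *\<^sub>R \<xi>) (sqrt R *\<^sub>R \<zeta>)"
    using assms by simp
  then show ?thesis
    using kernel_diagonal_real[OF assms(1,3,4)] by (simp add: poisson_szego_def boundary_kernel_def)
qed

lemma boundary_kernel_symmetric:
  assumes "\<xi> \<in> B" "\<zeta> \<in> B" "0 < R" "R < 1"
  shows "boundary_kernel R \<xi> \<zeta> = boundary_kernel R \<zeta> \<xi>"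
  using kernel_hermitian[of "sqrt R *\<^sub>R \<zeta>" "sqrt R *\<^sub>R \<xi>"] assms scaleR_B_mem_D by (simp add: boundary_kernel_def)

lemma boundary_kernel_nonneg: "0 < R \<Longrightarrow> R < 1 \<Longrightarrow> 0 \<le> boundary_kernel R \<xi> \<zeta>"
  using diagonal_ge_1[of R] by (simp add: boundary_kernel_def)

lemma boundary_kernel_bound:
  assumes "\<xi> \<in> B" "\<zeta> \<in> B" "0 < R" "R < 1"
  shows "boundary_kernel R \<xi> \<zeta> \<le> (diagonal (sqrt R))\<^sup>2"
proof -
  have "(cmod (C (sqrt R *\<^sub>R \<xi>) (sqrt R *\<^sub>R \<zeta>)))\<^sup>2 \<le> (diagonal (sqrt R))\<^sup>2"
    by (intro power_mono kernel_bound) (use assms in auto)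
  also have "\<dots> \<le> (diagonal (sqrt R))\<^sup>2 * diagonal R"
    using diagonal_ge_1[OF assms(3,4)] by (simp add: mult_le_cancel_left1)
  finally show ?thesis
    using diagonal_ge_1[OF assms(3,4)] by (simp add: boundary_kernel_def divide_le_eq)
qed

lemma continuous_boundary_kernel:
  assumes "\<zeta> \<in> B" "0 < R" "R < 1" shows "continuous_on B (\<lambda>\<xi>. boundary_kernel R \<xi> \<zeta>)"
  unfolding boundary_kernel_def
  using diagonal_ge_1[of R] assms scaleR_B_mem_D[OF assms(1)]
  by (intro continuous_intros continuous_kernel) auto

lemma boundary_kernel_integral:
  assumes "\<xi> \<in> B" "0 < R" "R < 1"
  shows "(\<integral>\<zeta>. boundary_kernel R \<zeta> \<xi> \<partial>\<beta>) = 1"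
  using kernel_square_integral_boundary[OF assms] diagonal_ge_1[OF assms(2,3)] by (simp add: boundary_kernel_def)

text \<open>
  On the unit sphere the squared distance to \<open>\<xi>\<close> is \<open>2 - 2 * Re (hermitian_inner \<zeta> \<xi>)\<close>, whose integral is
  known from \<open>linear_reproducing_integral\<close>.
\<close>

lemma boundary_kernel_concentration:
  assumes \<xi>: "\<xi> \<in> B" and R: "0 < R" "R < 1"
  shows "(\<integral>\<zeta>. (norm (\<zeta> - \<xi>))\<^sup>2 * boundary_kernel R \<zeta> \<xi> \<partial>\<beta>) = 2 * (1 - R)"
proof -
  have i: "integrable \<beta> (\<lambda>\<zeta>. boundary_kernel R \<zeta> \<xi>)" "integrable \<beta> (\<lambda>\<zeta>. Re (hermitian_inner \<zeta> \<xi>) * boundary_kernel R \<zeta> \<xi>)"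
    by (intro integrable_continuous_\<beta> continuous_intros continuous_boundary_kernel \<xi> R
        hol_on_imp_continuous_on[OF hol_on_hermitian_inner])+
  have "(\<integral>\<zeta>. (norm (\<zeta> - \<xi>))\<^sup>2 * boundary_kernel R \<zeta> \<xi> \<partial>\<beta>) =
      (\<integral>\<zeta>. 2 * boundary_kernel R \<zeta> \<xi> - 2 * (Re (hermitian_inner \<zeta> \<xi>) * boundary_kernel R \<zeta> \<xi>) \<partial>\<beta>)"
  proof (rule Bochner_Integration.integral_cong[OF refl])
    fix \<zeta> assume "\<zeta> \<in> space \<beta>"
    then have "norm \<zeta> = 1" "norm \<xi> = 1" using norm_B \<xi> by (auto simp: space_\<beta>)
    then have eq: "(norm (\<zeta> - \<xi>))\<^sup>2 = 2 - 2 * Re (hermitian_inner \<zeta> \<xi>)"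
      using dot_norm_neg[of \<zeta> \<xi>] by (simp add: inner_eq_Re_hermitian_inner[symmetric])
    show "(norm (\<zeta> - \<xi>))\<^sup>2 * boundary_kernel R \<zeta> \<xi> = 2 * boundary_kernel R \<zeta> \<xi> - 2 * (Re (hermitian_inner \<zeta> \<xi>) * boundary_kernel R \<zeta> \<xi>)"
      unfolding eq by (simp add: algebra_simps)
  qed
  also have "\<dots> = 2 * (\<integral>\<zeta>. boundary_kernel R \<zeta> \<xi> \<partial>\<beta>) - 2 * (\<integral>\<zeta>. Re (hermitian_inner \<zeta> \<xi>) * boundary_kernel R \<zeta> \<xi> \<partial>\<beta>)"
    using i by simp
  also have "(\<integral>\<zeta>. Re (hermitian_inner \<zeta> \<xi>) * boundary_kernel R \<zeta> \<xi> \<partial>\<beta>) = R"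
    using linear_reproducing_integral[OF \<xi> R] diagonal_ge_1[OF R] by (simp add: boundary_kernel_def)
  finally show ?thesis using boundary_kernel_integral[OF \<xi> R] by simp
qed

end

section \<open>Weak convergence of the dilated Poisson integrals\<close>

text \<open>
  The second variable is replaced by simple functions that converge to the identity, which gives
  finite sums of products. The simple functions must take their values in \<open>B\<close>; \<^const>\<open>closest_point\<close> moves
  them there and at most doubles their distance to points of \<open>B\<close>.
\<close>

lemma separately_continuous_measurable:
  fixes f :: "'a::euclidean_space \<Rightarrow> 'a \<Rightarrow> real"
  assumes B: "closed B" "B \<noteq> {}" and M: "sets M = sets (borel_on B)" and N: "sets N = sets (borel_on B)"
    and f1: "\<And>y. y \<in> B \<Longrightarrow> continuous_on B (\<lambda>x. f x y)" and f2: "\<And>x. x \<in> B \<Longrightarrow> continuous_on B (f x)"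
  shows "(\<lambda>p. f (fst p) (snd p)) \<in> borel_measurable (M \<Otimes>\<^sub>M N)"
proof -
  have sp: "space M = B" "space N = B" using sets_eq_imp_space_eq[OF M] sets_eq_imp_space_eq[OF N] by (simp_all add: space_borel_on)
  have "(\<lambda>y. y) \<in> borel_measurable (borel_on B)"
    unfolding borel_on_def by (rule measurable_restrict_space1) simp
  then have "(\<lambda>y. y) \<in> borel_measurable N" using measurable_cong_sets[OF N refl] by blast
  from borel_measurable_implies_sequence_metric[OF this, of undefined] obtain F where
    "\<forall>i. simple_function N (F i)" and Flim: "\<forall>y\<in>space N. (\<lambda>i. F i y) \<longlonglongrightarrow> y"
    by - (elim exE conjE, rule that, assumption+)
  then have F: "simple_function N (F i)" for i by simp
  define G where "G i y = closest_point B (F i y)" for i y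
  have GB: "G i y \<in> B" for i y unfolding G_def by (rule closest_point_in_set[OF B])
  have Gs: "simple_function N (G i)" for i
    using simple_function_compose[OF F[of i], of "closest_point B"] by (simp add: G_def[abs_def] o_def)
  have Glim: "(\<lambda>i. G i y) \<longlonglongrightarrow> y" if y: "y \<in> B" for y
  proof -
    have "dist (G i y) y \<le> 2 * dist (F i y) y" for i
      using closest_point_le[OF B(1) y, of "F i y"] dist_triangle3[of "G i y" y "F i y"] unfolding G_def by linarith
    moreover have "(\<lambda>i. 2 * dist (F i y) y) \<longlonglongrightarrow> 0"
      using tendsto_mult_left[OF tendsto_dist[OF bspec[OF Flim, unfolded sp, OF y] tendsto_const[of y]], of 2] by simp
    ultimately have "(\<lambda>i. dist (G i y) y) \<longlonglongrightarrow> 0"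
      by (intro Lim_null_comparison[of "\<lambda>i. dist (G i y) y" "\<lambda>i. 2 * dist (F i y) y"]) auto
    then show ?thesis by (rule tendsto_dist_iff[THEN iffD2])
  qed
  show ?thesis
  proof (rule borel_measurable_LIMSEQ_real)
    fix p assume "p \<in> space (M \<Otimes>\<^sub>M N)"
    then have p: "fst p \<in> B" "snd p \<in> B" by (auto simp: space_pair_measure sp)
    show "(\<lambda>i. f (fst p) (G i (snd p))) \<longlonglongrightarrow> f (fst p) (snd p)"
      by (rule continuous_on_tendsto_compose[OF f2[OF p(1)] Glim[OF p(2)] p(2)]) (simp add: GB)
  next
    fix i
    let ?V = "G i ` space N"
    have fin: "finite ?V" using Gs by (simp add: simple_function_def)
    have "(\<lambda>p. \<Sum>v\<in>?V. f (fst p) v * indicator (G i -` {v} \<inter> space N) (snd p)) \<in> borel_measurable (M \<Otimes>\<^sub>M N)"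
    proof (intro borel_measurable_sum borel_measurable_times)
      fix v assume "v \<in> ?V"
      then have "v \<in> B" using GB by auto
      from borel_measurable_continuous_on_restrict[OF f1[OF this]]
      have "(\<lambda>x. f x v) \<in> borel_measurable M" using measurable_cong_sets[OF M refl] by (auto simp: borel_on_def)
      then show "(\<lambda>p. f (fst p) v) \<in> borel_measurable (M \<Otimes>\<^sub>M N)" by (rule measurable_compose[OF measurable_fst])
      have "G i -` {v} \<inter> space N \<in> sets N" by (rule simple_functionD(2)[OF Gs])
      then show "(\<lambda>p. indicator (G i -` {v} \<inter> space N) (snd p) :: real) \<in> borel_measurable (M \<Otimes>\<^sub>M N)"
        by (intro measurable_compose[OF measurable_snd] borel_measurable_indicator)
    qed
    moreover have "(\<Sum>v\<in>?V. f (fst p) v * indicator (G i -` {v} \<inter> space N) (snd p)) = f (fst p) (G i (snd p))"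
      if "p \<in> space (M \<Otimes>\<^sub>M N)" for p
    proof -
      have s: "snd p \<in> space N" using that by (auto simp: space_pair_measure)
      have "(\<Sum>v\<in>?V. f (fst p) v * indicator (G i -` {v} \<inter> space N) (snd p)) = (\<Sum>v\<in>?V. if v = G i (snd p) then f (fst p) v else 0)"
        by (rule sum.cong[OF refl]) (use s in \<open>auto simp: indicator_def\<close>)
      then show ?thesis using fin s by simp
    qed
    ultimately show "(\<lambda>p. f (fst p) (G i (snd p))) \<in> borel_measurable (M \<Otimes>\<^sub>M N)"
      by (subst measurable_cong[where g = "\<lambda>p. \<Sum>v\<in>?V. f (fst p) v * indicator (G i -` {v} \<inter> space N) (snd p)"]) simp_all
  qed
qed

locale circular_domain_measure = circular_domain D B \<beta> C
  for D B :: "(complex^'n) set" and \<beta> C +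
  fixes \<mu> :: "(complex^'n) set \<Rightarrow> complex"
  assumes complex_measure_\<mu>: "complex_measure (borel_on B) \<mu>"
begin

definition jordan_part :: "nat \<Rightarrow> (complex^'n) measure" where
  "jordan_part k = complex_part (borel_on B) \<mu> k"

definition mu_integral :: "(complex^'n \<Rightarrow> complex) \<Rightarrow> complex" where
  "mu_integral f = (\<Sum>k<4. \<i> ^ k * integral\<^sup>L (jordan_part k) f)"

text \<open>
  An upper bound for the total variation of \<open>\<mu>\<close>.
\<close>

definition total_mass :: real where
  "total_mass = (\<Sum>k<4. measure (jordan_part k) B)"

lemma sets_part: "sets (jordan_part k) = sets (borel_on B)" and space_part: "space (jordan_part k) = B"
  by (simp_all add: jordan_part_def space_borel_on)

lemma finite_part: "finite_measure (jordan_part k)"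
  unfolding jordan_part_def by (rule finite_measure_complex_part[OF complex_measure_\<mu>])

lemma mu_integral_eq: "complex_measure_integral (borel_on B) \<mu> f = mu_integral f"
  unfolding mu_integral_def jordan_part_def by (rule complex_measure_integral_eq_sum)

lemma measurable_part_iff: "f \<in> borel_measurable (jordan_part k) \<longleftrightarrow> f \<in> borel_measurable \<beta>"
  using measurable_cong_sets[OF sets_part[of k] refl] measurable_cong_sets[OF sets_\<beta> refl] by blast

lemma integrable_part:
  fixes f :: "complex^'n \<Rightarrow> 'b::{banach,second_countable_topology}"
  assumes "f \<in> borel_measurable \<beta>" "\<And>\<zeta>. \<zeta> \<in> B \<Longrightarrow> norm (f \<zeta>) \<le> M"
  shows "integrable (jordan_part k) f"
proof -
  interpret finite_measure "jordan_part k" by (rule finite_part)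
  show ?thesis by (rule integrable_const_bound[of _ M]) (use assms in \<open>auto simp: space_part measurable_part_iff\<close>)
qed

lemma mu_integral_bound:
  assumes f: "f \<in> borel_measurable \<beta>" and M: "\<And>\<zeta>. \<zeta> \<in> B \<Longrightarrow> cmod (f \<zeta>) \<le> M"
  shows "cmod (mu_integral f) \<le> M * total_mass"
proof -
  have "cmod (integral\<^sup>L (jordan_part k) f) \<le> M * measure (jordan_part k) B" for k
  proof -
    interpret finite_measure "jordan_part k" by (rule finite_part)
    have "cmod (integral\<^sup>L (jordan_part k) f) \<le> (\<integral>\<zeta>. M \<partial>jordan_part k)"
      by (rule Bochner_Integration.integral_norm_bound_integral)
         (use integrable_part[OF f M] M in \<open>auto simp: space_part\<close>)
    then show ?thesis by (simp add: space_part mult.commute)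
  qed
  then have "cmod (mu_integral f) \<le> (\<Sum>k<4. M * measure (jordan_part k) B)"
    unfolding mu_integral_def by (intro order_trans[OF norm_sum] sum_mono) (simp add: norm_mult norm_power)
  then show ?thesis by (simp add: total_mass_def sum_distrib_left)
qed

lemma total_mass_nonneg: "0 \<le> total_mass"
  unfolding total_mass_def by (intro sum_nonneg) simp

lemma mu_integral_diff:
  assumes "f \<in> borel_measurable \<beta>" "\<And>\<zeta>. \<zeta> \<in> B \<Longrightarrow> cmod (f \<zeta>) \<le> M"
    and "g \<in> borel_measurable \<beta>" "\<And>\<zeta>. \<zeta> \<in> B \<Longrightarrow> cmod (g \<zeta>) \<le> M'"
  shows "mu_integral (\<lambda>\<zeta>. f \<zeta> - g \<zeta>) = mu_integral f - mu_integral g"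
  unfolding mu_integral_def
  by (simp add: Bochner_Integration.integral_diff[OF integrable_part[OF assms(1,2)] integrable_part[OF assms(3,4)]]
      right_diff_distrib sum_subtractf)

lemma mu_integral_add:
  assumes "f \<in> borel_measurable \<beta>" "\<And>\<zeta>. \<zeta> \<in> B \<Longrightarrow> cmod (f \<zeta>) \<le> M"
    and "g \<in> borel_measurable \<beta>" "\<And>\<zeta>. \<zeta> \<in> B \<Longrightarrow> cmod (g \<zeta>) \<le> M'"
  shows "mu_integral (\<lambda>\<zeta>. f \<zeta> + g \<zeta>) = mu_integral f + mu_integral g"
  unfolding mu_integral_def
  by (simp add: Bochner_Integration.integral_add[OF integrable_part[OF assms(1,2)] integrable_part[OF assms(3,4)]]
      distrib_left sum.distrib)

lemma mu_integral_cong: "(\<And>\<zeta>. \<zeta> \<in> B \<Longrightarrow> f \<zeta> = g \<zeta>) \<Longrightarrow> mu_integral f = mu_integral g"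
  unfolding mu_integral_def by (intro sum.cong refl arg_cong2[where f = "(*)"] Bochner_Integration.integral_cong) (auto simp: space_part)

lemma mu_integral_dominated_convergence:
  assumes f: "\<And>n. f n \<in> borel_measurable \<beta>" and g: "g \<in> borel_measurable \<beta>"
    and M: "\<And>n \<zeta>. \<zeta> \<in> B \<Longrightarrow> cmod (f n \<zeta>) \<le> M" and lim: "\<And>\<zeta>. \<zeta> \<in> B \<Longrightarrow> (\<lambda>n. f n \<zeta>) \<longlonglongrightarrow> g \<zeta>"
  shows "(\<lambda>n. mu_integral (f n)) \<longlonglongrightarrow> mu_integral g"
  unfolding mu_integral_def
proof (intro tendsto_intros)
  fix k
  interpret finite_measure "jordan_part k" by (rule finite_part)
  show "(\<lambda>n. integral\<^sup>L (jordan_part k) (f n)) \<longlonglongrightarrow> integral\<^sup>L (jordan_part k) g"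
    by (rule integral_dominated_convergence[where w = "\<lambda>_. M"])
       (use f g M lim in \<open>auto simp: measurable_part_iff space_part\<close>)
qed

definition poisson :: "complex^'n \<Rightarrow> complex" where
  "poisson = poisson_szego_integral D B C \<mu>"

lemma poisson_eq:
  assumes "\<zeta> \<in> B" "0 < R" "R < 1"
  shows "poisson (R *\<^sub>R \<zeta>) = mu_integral (\<lambda>\<xi>. of_real (boundary_kernel R \<zeta> \<xi>))"
  unfolding poisson_def poisson_szego_integral_def mu_integral_eq
  by (rule mu_integral_cong) (rule poisson_szego_eq_boundary_kernel[OF assms(1) _ assms(2,3)])

lemma continuous_boundary_kernel':
  assumes "\<zeta> \<in> B" "0 < R" "R < 1" shows "continuous_on B (boundary_kernel R \<zeta>)"
  by (rule continuous_on_eq[OF continuous_boundary_kernel[OF assms]])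
     (rule boundary_kernel_symmetric, use assms in auto)

lemma boundary_kernel_measurable_pair:
  assumes "0 < R" "R < 1"
  shows "(\<lambda>p. boundary_kernel R (fst p) (snd p)) \<in> borel_measurable (\<beta> \<Otimes>\<^sub>M jordan_part k)"
  by (rule separately_continuous_measurable[OF closed_B nonempty_B sets_\<beta> sets_part])
     (use continuous_boundary_kernel continuous_boundary_kernel' assms in auto)

lemma boundary_kernel_measurable_pair_complex:
  assumes "0 < R" "R < 1"
  shows "(\<lambda>p. complex_of_real (boundary_kernel R (fst p) (snd p))) \<in> borel_measurable (\<beta> \<Otimes>\<^sub>M jordan_part k)"
  by (rule measurable_compose[OF boundary_kernel_measurable_pair[OF assms] borel_measurable_of_real])

lemma poisson_bound:
  assumes "\<zeta> \<in> B" "0 < R" "R < 1" shows "cmod (poisson (R *\<^sub>R \<zeta>)) \<le> (diagonal (sqrt R))\<^sup>2 * total_mass"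
  unfolding poisson_eq[OF assms]
proof (rule mu_integral_bound)
  show "(\<lambda>\<xi>. complex_of_real (boundary_kernel R \<zeta> \<xi>)) \<in> borel_measurable \<beta>"
    by (intro continuous_imp_measurable_\<beta> continuous_intros continuous_boundary_kernel' assms)
  show "cmod (complex_of_real (boundary_kernel R \<zeta> \<xi>)) \<le> (diagonal (sqrt R))\<^sup>2" if "\<xi> \<in> B" for \<xi>
    using boundary_kernel_nonneg[of R \<zeta> \<xi>] boundary_kernel_bound[OF assms(1) that assms(2,3)] assms by simp
qed

lemma kernel_pair_integrable:
  assumes R: "0 < R" "R < 1" and \<phi>: "continuous_on B \<phi>"
  shows "integrable (\<beta> \<Otimes>\<^sub>M jordan_part k) (\<lambda>(\<zeta>, \<xi>). \<phi> \<zeta> * complex_of_real (boundary_kernel R \<zeta> \<xi>))"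
proof -
  interpret K: finite_measure "jordan_part k" by (rule finite_part)
  interpret P: pair_sigma_finite \<beta> "jordan_part k" ..
  interpret PF: finite_measure "\<beta> \<Otimes>\<^sub>M jordan_part k" by (rule finite_measure_pair_measure) unfold_locales
  obtain M where M: "M \<ge> 0" "\<And>\<zeta>. \<zeta> \<in> B \<Longrightarrow> cmod (\<phi> \<zeta>) \<le> M" using bounded_on_B[OF \<phi>] by blast
  have m: "(\<lambda>p. \<phi> (fst p) * complex_of_real (boundary_kernel R (fst p) (snd p))) \<in> borel_measurable (\<beta> \<Otimes>\<^sub>M jordan_part k)"
    by (intro borel_measurable_times measurable_compose[OF measurable_fst continuous_imp_measurable_\<beta>[OF \<phi>]]
        boundary_kernel_measurable_pair_complex R)
  have "cmod (\<phi> \<zeta> * complex_of_real (boundary_kernel R \<zeta> \<xi>)) \<le> M * (diagonal (sqrt R))\<^sup>2" if "\<zeta> \<in> B" "\<xi> \<in> B" for \<zeta> \<xi>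
    unfolding norm_mult
    by (intro mult_mono M that) (use boundary_kernel_nonneg[OF R] boundary_kernel_bound[OF that R] M(1) in auto)
  then show ?thesis
    by (intro PF.integrable_const_bound[of _ "M * (diagonal (sqrt R))\<^sup>2"])
       (use m in \<open>auto simp: case_prod_beta space_pair_measure space_\<beta> space_part\<close>)
qed

lemma poisson_measurable:
  assumes R: "0 < R" "R < 1" shows "(\<lambda>\<zeta>. poisson (R *\<^sub>R \<zeta>)) \<in> borel_measurable \<beta>"
proof -
  have "(\<lambda>\<zeta>. mu_integral (\<lambda>\<xi>. complex_of_real (boundary_kernel R \<zeta> \<xi>))) \<in> borel_measurable \<beta>"
    unfolding mu_integral_def
  proof (intro borel_measurable_sum borel_measurable_times borel_measurable_const)
    fix k
    interpret K: finite_measure "jordan_part k" by (rule finite_part)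
    show "(\<lambda>\<zeta>. \<integral>\<xi>. complex_of_real (boundary_kernel R \<zeta> \<xi>) \<partial>jordan_part k) \<in> borel_measurable \<beta>"
      by (rule K.borel_measurable_lebesgue_integral)
         (use boundary_kernel_measurable_pair_complex[OF R] in \<open>simp add: case_prod_beta\<close>)
  qed
  then show ?thesis
    by (subst measurable_cong[where g = "\<lambda>\<zeta>. mu_integral (\<lambda>\<xi>. complex_of_real (boundary_kernel R \<zeta> \<xi>))"])
       (use R in \<open>auto simp: space_\<beta> poisson_eq\<close>)
qed

text \<open>
  Fubini's theorem: pairing \<open>\<phi>\<close> with the dilated Poisson integral of \<open>\<mu>\<close> amounts to pairing \<open>\<mu>\<close> with an
  integral of \<open>\<phi>\<close> against the kernel.
\<close>

lemma dual_poisson: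
  assumes R: "0 < R" "R < 1" and \<phi>: "continuous_on B \<phi>"
  shows "(\<integral>\<zeta>. \<phi> \<zeta> * poisson (R *\<^sub>R \<zeta>) \<partial>\<beta>) = mu_integral (\<lambda>\<xi>. \<integral>\<zeta>. \<phi> \<zeta> * complex_of_real (boundary_kernel R \<zeta> \<xi>) \<partial>\<beta>)"
    and "(\<lambda>\<xi>. \<integral>\<zeta>. \<phi> \<zeta> * complex_of_real (boundary_kernel R \<zeta> \<xi>) \<partial>\<beta>) \<in> borel_measurable \<beta>"
proof -
  let ?F = "\<lambda>\<zeta> \<xi>. \<phi> \<zeta> * complex_of_real (boundary_kernel R \<zeta> \<xi>)"
  have fub: "integrable \<beta> (\<lambda>\<zeta>. \<integral>\<xi>. ?F \<zeta> \<xi> \<partial>jordan_part k)" "(\<integral>\<zeta>. (\<integral>\<xi>. ?F \<zeta> \<xi> \<partial>jordan_part k) \<partial>\<beta>) = (\<integral>\<xi>. (\<integral>\<zeta>. ?F \<zeta> \<xi> \<partial>\<beta>) \<partial>jordan_part k)"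
    "integrable (jordan_part k) (\<lambda>\<xi>. \<integral>\<zeta>. ?F \<zeta> \<xi> \<partial>\<beta>)" for k
  proof -
    interpret K: finite_measure "jordan_part k" by (rule finite_part)
    interpret P: pair_sigma_finite \<beta> "jordan_part k" ..
    note i = kernel_pair_integrable[OF R \<phi>, of k]
    show "integrable \<beta> (\<lambda>\<zeta>. \<integral>\<xi>. ?F \<zeta> \<xi> \<partial>jordan_part k)" using P.integrable_fst'[OF i] by simp
    show "(\<integral>\<zeta>. (\<integral>\<xi>. ?F \<zeta> \<xi> \<partial>jordan_part k) \<partial>\<beta>) = (\<integral>\<xi>. (\<integral>\<zeta>. ?F \<zeta> \<xi> \<partial>\<beta>) \<partial>jordan_part k)"
      by (rule P.Fubini_integral[OF i, symmetric])
    show "integrable (jordan_part k) (\<lambda>\<xi>. \<integral>\<zeta>. ?F \<zeta> \<xi> \<partial>\<beta>)" using P.integrable_snd[OF i] by simp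
  qed
  show "(\<lambda>\<xi>. \<integral>\<zeta>. ?F \<zeta> \<xi> \<partial>\<beta>) \<in> borel_measurable \<beta>"
    using borel_measurable_integrable[OF fub(3)[of 0]] by (simp add: measurable_part_iff)
  have "(\<integral>\<zeta>. \<phi> \<zeta> * poisson (R *\<^sub>R \<zeta>) \<partial>\<beta>) = (\<integral>\<zeta>. (\<Sum>k<4. \<i> ^ k * (\<integral>\<xi>. ?F \<zeta> \<xi> \<partial>jordan_part k)) \<partial>\<beta>)"
    by (rule Bochner_Integration.integral_cong[OF refl])
       (use R in \<open>simp add: space_\<beta> poisson_eq mu_integral_def sum_distrib_left mult_ac\<close>)
  also have "\<dots> = (\<Sum>k<4. \<i> ^ k * (\<integral>\<zeta>. (\<integral>\<xi>. ?F \<zeta> \<xi> \<partial>jordan_part k) \<partial>\<beta>))"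
    unfolding Bochner_Integration.integral_sum[OF integrable_mult_right[OF fub(1)]]
    by (intro sum.cong refl integral_mult_right_zero)
  also have "\<dots> = mu_integral (\<lambda>\<xi>. \<integral>\<zeta>. ?F \<zeta> \<xi> \<partial>\<beta>)" unfolding mu_integral_def fub(2) ..
  finally show "(\<integral>\<zeta>. \<phi> \<zeta> * poisson (R *\<^sub>R \<zeta>) \<partial>\<beta>) = mu_integral (\<lambda>\<xi>. \<integral>\<zeta>. ?F \<zeta> \<xi> \<partial>\<beta>)" .
qed

text \<open>
  A quantitative Chebyshev inequality: the kernel has mass \<open>1\<close> and second moment \<open>2 * (1 - R)\<close> about \<open>\<xi>\<close>.
\<close>

lemma approximate_identity_bound:
  assumes R: "0 < R" "R < 1" and \<phi>: "continuous_on B \<phi>" and \<xi>: "\<xi> \<in> B"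
    and h: "h \<ge> 0" "l \<ge> 0" "\<And>\<zeta>. \<zeta> \<in> B \<Longrightarrow> cmod (\<phi> \<zeta> - a) \<le> h + l * (norm (\<zeta> - \<xi>))\<^sup>2"
  shows "cmod ((\<integral>\<zeta>. \<phi> \<zeta> * complex_of_real (boundary_kernel R \<zeta> \<xi>) \<partial>\<beta>) - a) \<le> h + l * (2 * (1 - R))"
proof -
  let ?k = "\<lambda>\<zeta>. boundary_kernel R \<zeta> \<xi>"
  have kc: "continuous_on B ?k" by (rule continuous_boundary_kernel[OF \<xi> R])
  have i: "integrable \<beta> (\<lambda>\<zeta>. \<phi> \<zeta> * complex_of_real (?k \<zeta>))" "integrable \<beta> (\<lambda>\<zeta>. a * complex_of_real (?k \<zeta>))"
    "integrable \<beta> (\<lambda>\<zeta>. h * ?k \<zeta>)" "integrable \<beta> (\<lambda>\<zeta>. l * ((norm (\<zeta> - \<xi>))\<^sup>2 * ?k \<zeta>))"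
    by (intro integrable_continuous_\<beta> continuous_intros \<phi> kc)+
  have "(\<integral>\<zeta>. \<phi> \<zeta> * complex_of_real (?k \<zeta>) \<partial>\<beta>) - a = (\<integral>\<zeta>. \<phi> \<zeta> * complex_of_real (?k \<zeta>) \<partial>\<beta>) - (\<integral>\<zeta>. a * complex_of_real (?k \<zeta>) \<partial>\<beta>)"
    using boundary_kernel_integral[OF \<xi> R] by simp
  also have "\<dots> = (\<integral>\<zeta>. (\<phi> \<zeta> - a) * complex_of_real (?k \<zeta>) \<partial>\<beta>)"
    unfolding left_diff_distrib by (rule Bochner_Integration.integral_diff[OF i(1,2), symmetric])
  also have "cmod \<dots> \<le> (\<integral>\<zeta>. h * ?k \<zeta> + l * ((norm (\<zeta> - \<xi>))\<^sup>2 * ?k \<zeta>) \<partial>\<beta>)"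
  proof (rule Bochner_Integration.integral_norm_bound_integral)
    show "integrable \<beta> (\<lambda>\<zeta>. (\<phi> \<zeta> - a) * complex_of_real (?k \<zeta>))"
      by (intro integrable_continuous_\<beta> continuous_intros \<phi> kc)
    show "integrable \<beta> (\<lambda>\<zeta>. h * ?k \<zeta> + l * ((norm (\<zeta> - \<xi>))\<^sup>2 * ?k \<zeta>))" using i by (intro Bochner_Integration.integrable_add)
    fix \<zeta> assume "\<zeta> \<in> space \<beta>"
    then have "cmod (\<phi> \<zeta> - a) * ?k \<zeta> \<le> (h + l * (norm (\<zeta> - \<xi>))\<^sup>2) * ?k \<zeta>"
      by (intro mult_right_mono h(3) boundary_kernel_nonneg R) (simp add: space_\<beta>)
    then show "cmod ((\<phi> \<zeta> - a) * complex_of_real (?k \<zeta>)) \<le> h * ?k \<zeta> + l * ((norm (\<zeta> - \<xi>))\<^sup>2 * ?k \<zeta>)"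
      using boundary_kernel_nonneg[OF R, of \<zeta> \<xi>]
      unfolding norm_mult norm_of_real by (simp add: distrib_right mult.assoc)
  qed
  also have "\<dots> = h * (\<integral>\<zeta>. ?k \<zeta> \<partial>\<beta>) + l * (\<integral>\<zeta>. (norm (\<zeta> - \<xi>))\<^sup>2 * ?k \<zeta> \<partial>\<beta>)"
    using i(3,4) by (simp only: Bochner_Integration.integral_add integral_mult_right_zero)
  finally show ?thesis
    using boundary_kernel_integral[OF \<xi> R] boundary_kernel_concentration[OF \<xi> R] by simp
qed

lemma radius_Suc_bounds: "0 < radius (Suc n)" "radius (Suc n) < 1"
  by (auto simp: radius_def)

lemma approximate_identity:
  assumes \<phi>: "continuous_on B \<phi>" and \<xi>: "\<xi> \<in> B"
  shows "(\<lambda>n. \<integral>\<zeta>. \<phi> \<zeta> * complex_of_real (boundary_kernel (radius (Suc n)) \<zeta> \<xi>) \<partial>\<beta>) \<longlonglongrightarrow> \<phi> \<xi>"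
proof (rule tendstoI)
  fix e :: real assume e: "e > 0"
  obtain M where M: "M \<ge> 0" "\<And>\<zeta>. \<zeta> \<in> B \<Longrightarrow> cmod (\<phi> \<zeta>) \<le> M" using bounded_on_B[OF \<phi>] by blast
  obtain \<delta> where \<delta>: "\<delta> > 0" "\<And>\<zeta>. \<zeta> \<in> B \<Longrightarrow> dist \<zeta> \<xi> < \<delta> \<Longrightarrow> dist (\<phi> \<zeta>) (\<phi> \<xi>) < e / 2"
    using \<phi> \<xi> e unfolding continuous_on_iff by (metis half_gt_zero)
  \<comment> \<open>beyond distance \<open>\<delta>\<close> the trivial bound \<open>2 * M\<close> is at most \<open>l * (norm (\<zeta> - \<xi>))\<^sup>2\<close>\<close>
  define l where "l = 2 * M / \<delta>\<^sup>2"
  have l: "l \<ge> 0" using M \<delta> by (simp add: l_def)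
  have bd: "cmod (\<phi> \<zeta> - \<phi> \<xi>) \<le> e / 2 + l * (norm (\<zeta> - \<xi>))\<^sup>2" if \<zeta>: "\<zeta> \<in> B" for \<zeta>
  proof (cases "dist \<zeta> \<xi> < \<delta>")
    case True
    then show ?thesis using \<delta>(2)[OF \<zeta> True] l by (simp add: dist_norm add_increasing2)
  next
    case False
    then have "\<delta>\<^sup>2 \<le> (norm (\<zeta> - \<xi>))\<^sup>2" using \<delta>(1) by (intro power_mono) (auto simp: dist_norm)
    then have "l * \<delta>\<^sup>2 \<le> l * (norm (\<zeta> - \<xi>))\<^sup>2" by (rule mult_left_mono[OF _ l])
    moreover have "l * \<delta>\<^sup>2 = 2 * M" using \<delta>(1) by (simp add: l_def)
    moreover have "cmod (\<phi> \<zeta> - \<phi> \<xi>) \<le> M + M" by (rule order_trans[OF norm_triangle_ineq4 add_mono[OF M(2)[OF \<zeta>] M(2)[OF \<xi>]]])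
    ultimately show ?thesis using e by simp
  qed
  have "(\<lambda>n. e / 2 + l * (2 * (1 - radius (Suc n)))) \<longlonglongrightarrow> e / 2 + l * (2 * (1 - 1))"
    by (intro tendsto_intros LIMSEQ_Suc[OF radius_tendsto])
  then have "eventually (\<lambda>n. e / 2 + l * (2 * (1 - radius (Suc n))) < e) sequentially"
    by (rule order_tendstoD) (use e in auto)
  then show "\<forall>\<^sub>F n in sequentially. dist (\<integral>\<zeta>. \<phi> \<zeta> * complex_of_real (boundary_kernel (radius (Suc n)) \<zeta> \<xi>) \<partial>\<beta>) (\<phi> \<xi>) < e"
  proof (rule eventually_mono)
    fix n assume "e / 2 + l * (2 * (1 - radius (Suc n))) < e"
    with approximate_identity_bound[OF radius_Suc_bounds \<phi> \<xi> _ l bd, of n] e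
    show "dist (\<integral>\<zeta>. \<phi> \<zeta> * complex_of_real (boundary_kernel (radius (Suc n)) \<zeta> \<xi>) \<partial>\<beta>) (\<phi> \<xi>) < e"
      by (simp add: dist_norm)
  qed
qed

text \<open>
  By \<open>dual_poisson\<close> the left-hand side pairs \<open>\<mu>\<close> with functions that converge boundedly to \<open>\<phi>\<close>.
\<close>

lemma weak_limit:
  assumes \<phi>: "continuous_on B \<phi>"
  shows "(\<lambda>n. \<integral>\<zeta>. \<phi> \<zeta> * poisson (radius (Suc n) *\<^sub>R \<zeta>) \<partial>\<beta>) \<longlonglongrightarrow> mu_integral \<phi>"
proof -
  obtain M where M: "M \<ge> 0" "\<And>\<zeta>. \<zeta> \<in> B \<Longrightarrow> cmod (\<phi> \<zeta>) \<le> M" using bounded_on_B[OF \<phi>] by blast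
  show ?thesis
    unfolding dual_poisson(1)[OF radius_Suc_bounds \<phi>]
  proof (rule mu_integral_dominated_convergence)
    show "cmod (\<integral>\<zeta>. \<phi> \<zeta> * complex_of_real (boundary_kernel (radius (Suc n)) \<zeta> \<xi>) \<partial>\<beta>) \<le> M" if "\<xi> \<in> B" for n \<xi>
      using approximate_identity_bound[OF radius_Suc_bounds \<phi> that M(1), of 0 0] M(2) by simp
  qed (auto intro: dual_poisson(2)[OF radius_Suc_bounds \<phi>] continuous_imp_measurable_\<beta>[OF \<phi>] approximate_identity[OF \<phi>])
qed

end

section \<open>Pluriharmonic measures on circle-invariant null sets\<close>

definition circle_weight :: "int \<Rightarrow> (complex^'n \<Rightarrow> complex) \<Rightarrow> bool" where
  "circle_weight j f \<longleftrightarrow> (\<forall>\<alpha> z. cmod \<alpha> = 1 \<longrightarrow> f (\<alpha> *s z) = \<alpha> powi j * f z)"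

text \<open>
  Finite sums of continuous functions of pure weight under the circle action. They form an algebra
  that contains the real polynomials, since a real linear function splits into parts of weights
  \<open>1\<close> and \<open>- 1\<close>.
\<close>

inductive circle_polynomial :: "(complex^'n \<Rightarrow> complex) \<Rightarrow> bool" where
  homogeneous: "continuous_on UNIV f \<Longrightarrow> circle_weight j f \<Longrightarrow> circle_polynomial f"
| sum: "circle_polynomial f \<Longrightarrow> circle_polynomial g \<Longrightarrow> circle_polynomial (\<lambda>z. f z + g z)"

lemma circle_polynomial_continuous: "circle_polynomial f \<Longrightarrow> continuous_on UNIV f"
  by (induction rule: circle_polynomial.induct) (auto intro: continuous_on_add)

lemma circle_polynomial_mult_homogeneous:
  fixes f g :: "complex^'n \<Rightarrow> complex"
  assumes "circle_polynomial g" "continuous_on UNIV f" "circle_weight j f"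
  shows "circle_polynomial (\<lambda>z. f z * g z)"
  using assms
proof (induction rule: circle_polynomial.induct)
  case (homogeneous g i)
  show ?case
  proof (rule circle_polynomial.homogeneous[of _ "j + i"])
    show "circle_weight (j + i) (\<lambda>z. f z * g z)"
      unfolding circle_weight_def
    proof (intro allI impI)
      fix \<alpha> :: complex and z :: "complex^'n" assume a: "cmod \<alpha> = 1"
      then have "\<alpha> \<noteq> 0" by auto
      then show "f (\<alpha> *s z) * g (\<alpha> *s z) = \<alpha> powi (j + i) * (f z * g z)"
        using homogeneous a by (simp add: circle_weight_def power_int_add)
    qed
  qed (intro continuous_on_mult homogeneous)
next
  case (sum g1 g2)
  then show ?case by (simp add: distrib_left circle_polynomial.sum)
qed

lemma circle_polynomial_mult:
  fixes f g :: "complex^'n \<Rightarrow> complex"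
  assumes "circle_polynomial f" "circle_polynomial g" shows "circle_polynomial (\<lambda>z. f z * g z)"
  using assms
proof (induction rule: circle_polynomial.induct)
  case (homogeneous f j)
  then show ?case by (intro circle_polynomial_mult_homogeneous)
next
  case (sum f1 f2)
  then show ?case by (simp add: distrib_right circle_polynomial.sum)
qed

lemma real_polynomial_circle_polynomial:
  assumes "real_polynomial_function (p :: complex^'n \<Rightarrow> real)"
  shows "circle_polynomial (\<lambda>z. complex_of_real (p z))"
  using assms
proof (induction rule: real_polynomial_function.induct)
  case (linear l)
  have lin: "linear l" using linear by (rule bounded_linear.linear)
  have cont: "continuous_on UNIV (\<lambda>z. complex_of_real (l (c *s z)))" for c
    by (intro continuous_on_of_real continuous_on_compose2[OF linear_continuous_on[OF linear, of UNIV]]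
        continuous_on_scalar_mult continuous_on_const continuous_on_id) auto
  \<comment> \<open>the parts of weight \<open>1\<close> and \<open>- 1\<close> are \<open>(P - \<i> * Q) / 2\<close> and \<open>(P + \<i> * Q) / 2\<close> with \<open>P\<close> and \<open>Q\<close> below\<close>
  have rot: "l ((complex_of_real a + \<i> * complex_of_real b) *s z) = a * l z + b * l (\<i> *s z)" for a b z
  proof -
    have "(complex_of_real a + \<i> * complex_of_real b) *s z = a *\<^sub>R z + b *\<^sub>R (\<i> *s z)"
      by (simp add: scaleR_eq_scalar_mult vector_sadd_rdistrib vector_smult_assoc mult.commute)
    then show ?thesis by (simp only: linear_add[OF lin] linear_cmul[OF lin] real_scaleR_def)
  qed
  define P Q where "P z = complex_of_real (l (1 *s z))" and "Q z = complex_of_real (l (\<i> *s z))" for z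
  have PQ: "P (\<alpha> *s z) = of_real (Re \<alpha>) * P z + of_real (Im \<alpha>) * Q z"
    "Q (\<alpha> *s z) = - of_real (Im \<alpha>) * P z + of_real (Re \<alpha>) * Q z" for \<alpha> z
  proof -
    have "l (\<alpha> *s z) = Re \<alpha> * l z + Im \<alpha> * l (\<i> *s z)"
      using rot[of "Re \<alpha>" "Im \<alpha>" z] unfolding complex_eq[of \<alpha>, symmetric] .
    then show "P (\<alpha> *s z) = of_real (Re \<alpha>) * P z + of_real (Im \<alpha>) * Q z"
      unfolding P_def Q_def vector_smult_lid by simp
    have e: "complex_of_real (- Im \<alpha>) + \<i> * complex_of_real (Re \<alpha>) = \<i> * \<alpha>" by (simp add: complex_eq_iff)
    have "l (\<i> *s (\<alpha> *s z)) = - Im \<alpha> * l z + Re \<alpha> * l (\<i> *s z)"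
      using rot[of "- Im \<alpha>" "Re \<alpha>" z] unfolding e vector_smult_assoc .
    then show "Q (\<alpha> *s z) = - of_real (Im \<alpha>) * P z + of_real (Re \<alpha>) * Q z"
      unfolding P_def Q_def vector_smult_lid by simp
  qed
  have contPQ: "continuous_on UNIV (\<lambda>z. (P z - \<i> * Q z) / 2)" "continuous_on UNIV (\<lambda>z. (P z + \<i> * Q z) / 2)"
    unfolding P_def Q_def
    by (intro continuous_on_divide continuous_on_diff continuous_on_add continuous_on_mult continuous_on_const cont; simp)+
  have "P (\<alpha> *s z) - \<i> * Q (\<alpha> *s z) = \<alpha> * (P z - \<i> * Q z)" for \<alpha> z
  proof -
    have "P (\<alpha> *s z) - \<i> * Q (\<alpha> *s z) = (of_real (Re \<alpha>) + \<i> * of_real (Im \<alpha>)) * (P z - \<i> * Q z)"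
      unfolding PQ by (simp add: algebra_simps)
    then show ?thesis unfolding complex_eq[of \<alpha>, symmetric] .
  qed
  then have "circle_weight 1 (\<lambda>z. (P z - \<i> * Q z) / 2)"
    unfolding circle_weight_def by simp
  with contPQ(1) have h1: "circle_polynomial (\<lambda>z. (P z - \<i> * Q z) / 2)" by (rule circle_polynomial.homogeneous)
  have "P (\<alpha> *s z) + \<i> * Q (\<alpha> *s z) = \<alpha> powi (- 1) * (P z + \<i> * Q z)" if "cmod \<alpha> = 1" for \<alpha> z
  proof -
    have "P (\<alpha> *s z) + \<i> * Q (\<alpha> *s z) = (of_real (Re \<alpha>) - \<i> * of_real (Im \<alpha>)) * (P z + \<i> * Q z)"
      unfolding PQ by (simp add: algebra_simps)
    also have "of_real (Re \<alpha>) - \<i> * of_real (Im \<alpha>) = cnj \<alpha>" by (simp add: complex_eq_iff)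
    also have "cnj \<alpha> = inverse \<alpha>"
    proof -
      have "\<alpha> * cnj \<alpha> = 1" using that by (simp add: complex_norm_square[symmetric])
      then show ?thesis by (rule inverse_unique[symmetric])
    qed
    finally show ?thesis by (simp add: power_int_minus)
  qed
  then have "circle_weight (- 1) (\<lambda>z. (P z + \<i> * Q z) / 2)"
    unfolding circle_weight_def by simp
  with contPQ(2) have h2: "circle_polynomial (\<lambda>z. (P z + \<i> * Q z) / 2)" by (rule circle_polynomial.homogeneous)
  have "(P z - \<i> * Q z) / 2 + (P z + \<i> * Q z) / 2 = complex_of_real (l z)" for z
    by (simp add: P_def field_simps)
  with circle_polynomial.sum[OF h1 h2] show ?case by (simp only:)
next
  case (const c)
  show ?case by (rule circle_polynomial.homogeneous[of _ 0]) (auto simp: circle_weight_def)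
next
  case (add f g)
  show ?case unfolding of_real_add by (rule circle_polynomial.sum[OF add.IH])
next
  case (mult f g)
  show ?case unfolding of_real_mult by (rule circle_polynomial_mult[OF mult.IH])
qed

text \<open>
  Makes the cutoff functions of a circle-invariant set invariant, so that they do not change weights.
\<close>

lemma infdist_rotate:
  assumes K: "circle_invariant K" and \<alpha>: "cmod \<alpha> = 1" shows "infdist (\<alpha> *s z) K = infdist z K"
proof -
  have le: "infdist (\<alpha> *s z) K \<le> infdist z K" if \<alpha>: "cmod \<alpha> = 1" for \<alpha> z
  proof (cases "K = {}")
    case False
    have "infdist (\<alpha> *s z) K \<le> dist z a" if "a \<in> K" for a
    proof -
      have "infdist (\<alpha> *s z) K \<le> dist (\<alpha> *s z) (\<alpha> *s a)"
        using K that \<alpha> by (intro infdist_le) (auto simp: circle_invariant_def)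
      then show ?thesis using \<alpha> by (simp add: dist_scalar_mult)
    qed
    then show ?thesis unfolding infdist_notempty[OF False, of z] by (intro cINF_greatest[OF False])
  qed (simp add: infdist_def)
  have "\<alpha> \<noteq> 0" using \<alpha> by auto
  then have i: "cmod (inverse \<alpha>) = 1" "inverse \<alpha> *s (\<alpha> *s z) = z" using \<alpha> by (simp_all add: norm_inverse vector_smult_assoc)
  show ?thesis using le[OF \<alpha>, of z] le[OF i(1), of "\<alpha> *s z"] i(2) by simp
qed

definition cutoff :: "'a::metric_space set \<Rightarrow> nat \<Rightarrow> 'a \<Rightarrow> real" where
  "cutoff K n z = max 0 (1 - real n * infdist z K)"

lemma cutoff_bounds: "0 \<le> cutoff K n z" "cutoff K n z \<le> 1"
  using infdist_nonneg[of z K] by (auto simp: cutoff_def)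

lemma continuous_cutoff [continuous_intros]: "continuous_on S (cutoff K n)"
  unfolding cutoff_def by (intro continuous_intros)

lemma cutoff_tendsto:
  assumes "closed K" "K \<noteq> {}" shows "(\<lambda>n. cutoff K n z) \<longlonglongrightarrow> indicator K z"
proof (cases "z \<in> K")
  case True
  then show ?thesis by (simp add: cutoff_def infdist_zero)
next
  case False
  then have "infdist z K > 0" using assms by (simp add: infdist_pos_not_in_closed)
  then obtain N where N: "real N * infdist z K > 1" using reals_Archimedean3 by blast
  have "cutoff K n z = 0" if "n \<ge> N" for n
  proof -
    have "real N * infdist z K \<le> real n * infdist z K" using that by (intro mult_right_mono) (auto simp: infdist_nonneg)
    then show ?thesis using N by (simp add: cutoff_def)
  qed
  then have "eventually (\<lambda>n. cutoff K n z = indicator K z) sequentially"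
    using False by (auto simp: eventually_sequentially)
  then show ?thesis by (rule tendsto_eventually)
qed

locale pluriharmonic_domain_measure = circular_domain_measure D B \<beta> C \<mu>
  for D B :: "(complex^'n) set" and \<beta> C \<mu> +
  assumes pluriharmonic: "pluriharmonic_on poisson D"
begin

text \<open>
  The Poisson integral is harmonic on the disc through \<open>\<zeta>\<close>, and on \<open>(1/2) *\<^sub>R B\<close> it is bounded.
\<close>

lemma weight_mean_bound:
  assumes \<zeta>: "\<zeta> \<in> B" and R: "0 < R" "R < 1"
  shows "cmod (circle_mean (\<lambda>\<alpha>. \<alpha> powi j * poisson (R *\<^sub>R (\<alpha> *s \<zeta>)))) \<le> 2 ^ nat \<bar>j\<bar> * ((diagonal (sqrt (1/2)))\<^sup>2 * total_mass)"
proof -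
  have "\<zeta> \<noteq> 0" using norm_B[OF \<zeta>] by auto
  then have h: "harmonic_on (\<lambda>t. poisson (0 + t *s \<zeta>)) {t. 0 + t *s \<zeta> \<in> D}"
    using pluriharmonic unfolding pluriharmonic_on_def by blast
  have U: "ball 0 1 \<subseteq> {t. 0 + t *s \<zeta> \<in> D}" using disc_mem_D[OF \<zeta>] by auto
  have M: "cmod (poisson (0 + z *s \<zeta>)) \<le> (diagonal (sqrt (1/2)))\<^sup>2 * total_mass" if z: "cmod z = 1 / 2" for z
  proof -
    have "(2 * z) *s \<zeta> \<in> B" by (rule rotate_mem_B[OF \<zeta>]) (simp add: norm_mult z)
    moreover have "(1/2) *\<^sub>R ((2 * z) *s \<zeta>) = z *s \<zeta>" by (simp add: scaleR_eq_scalar_mult vector_smult_assoc)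
    ultimately show ?thesis using poisson_bound[of "(2 * z) *s \<zeta>" "1/2"] by simp
  qed
  have "R *\<^sub>R (\<alpha> *s \<zeta>) = 0 + (of_real R * \<alpha>) *s \<zeta>" for \<alpha> by (simp add: scaleR_eq_scalar_mult vector_smult_assoc)
  then show ?thesis using circle_mean_harmonic_bound[OF h U R M, of j] by simp
qed

text \<open>
  Rotating the integration variable replaces the Poisson integral by its Fourier coefficients along
  circles, which are bounded up to the boundary.
\<close>

lemma weighted_integral_bound:
  assumes \<phi>: "continuous_on B \<phi>" and w: "\<And>\<alpha> \<zeta>. \<zeta> \<in> B \<Longrightarrow> cmod \<alpha> = 1 \<Longrightarrow> \<phi> (\<alpha> *s \<zeta>) = \<alpha> powi j * \<phi> \<zeta>"
    and R: "0 < R" "R < 1"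
  shows "cmod (\<integral>\<zeta>. \<phi> \<zeta> * poisson (R *\<^sub>R \<zeta>) \<partial>\<beta>) \<le> 2 ^ nat \<bar>j\<bar> * ((diagonal (sqrt (1/2)))\<^sup>2 * total_mass) * (\<integral>\<zeta>. cmod (\<phi> \<zeta>) \<partial>\<beta>)"
proof -
  let ?K = "2 ^ nat \<bar>j\<bar> * ((diagonal (sqrt (1/2)))\<^sup>2 * total_mass)"
  obtain M where M: "M \<ge> 0" "\<And>\<zeta>. \<zeta> \<in> B \<Longrightarrow> cmod (\<phi> \<zeta>) \<le> M" using bounded_on_B[OF \<phi>] by blast
  have m: "(\<lambda>\<zeta>. \<phi> \<zeta> * poisson (R *\<^sub>R \<zeta>)) \<in> borel_measurable \<beta>"
    by (intro borel_measurable_times continuous_imp_measurable_\<beta>[OF \<phi>] poisson_measurable R)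
  have b: "cmod (\<phi> \<zeta> * poisson (R *\<^sub>R \<zeta>)) \<le> M * ((diagonal (sqrt R))\<^sup>2 * total_mass)" if "\<zeta> \<in> B" for \<zeta>
    unfolding norm_mult by (intro mult_mono M poisson_bound that R) auto
  have ptw: "cmod (circle_mean (\<lambda>\<alpha>. \<phi> (\<alpha> *s \<zeta>) * poisson (R *\<^sub>R (\<alpha> *s \<zeta>)))) \<le> ?K * cmod (\<phi> \<zeta>)" if \<zeta>: "\<zeta> \<in> B" for \<zeta>
  proof -
    have "circle_mean (\<lambda>\<alpha>. \<phi> (\<alpha> *s \<zeta>) * poisson (R *\<^sub>R (\<alpha> *s \<zeta>))) = \<phi> \<zeta> * circle_mean (\<lambda>\<alpha>. \<alpha> powi j * poisson (R *\<^sub>R (\<alpha> *s \<zeta>)))"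
      unfolding circle_mean_def integral_mult_right_zero[symmetric]
      by (intro Bochner_Integration.integral_cong refl) (simp add: w[OF \<zeta>] mult_ac)
    then show ?thesis
      using mult_left_mono[OF weight_mean_bound[OF \<zeta> R, of j] norm_ge_zero[of "\<phi> \<zeta>"]] by (simp add: norm_mult mult_ac)
  qed
  have K: "?K \<ge> 0" using total_mass_nonneg by simp
  have "(\<integral>\<zeta>. \<phi> \<zeta> * poisson (R *\<^sub>R \<zeta>) \<partial>\<beta>) = (\<integral>\<zeta>. circle_mean (\<lambda>\<alpha>. \<phi> (\<alpha> *s \<zeta>) * poisson (R *\<^sub>R (\<alpha> *s \<zeta>))) \<partial>\<beta>)"
    by (rule integral_circle_average(1)[OF m b])
  also have "cmod \<dots> \<le> (\<integral>\<zeta>. ?K * cmod (\<phi> \<zeta>) \<partial>\<beta>)"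
  proof (rule Bochner_Integration.integral_norm_bound_integral)
    show int: "integrable \<beta> (\<lambda>\<zeta>. ?K * cmod (\<phi> \<zeta>))" by (intro integrable_continuous_\<beta> continuous_intros \<phi>)
    show "integrable \<beta> (\<lambda>\<zeta>. circle_mean (\<lambda>\<alpha>. \<phi> (\<alpha> *s \<zeta>) * poisson (R *\<^sub>R (\<alpha> *s \<zeta>))))"
      by (rule Bochner_Integration.integrable_bound[OF int integral_circle_average(2)[OF m b]])
         (use ptw K in \<open>auto simp: space_\<beta>\<close>)
  qed (use ptw in \<open>simp add: space_\<beta>\<close>)
  finally show ?thesis by simp
qed

lemma weighted_mu_integral_bound:
  assumes \<phi>: "continuous_on B \<phi>" and w: "\<And>\<alpha> \<zeta>. \<zeta> \<in> B \<Longrightarrow> cmod \<alpha> = 1 \<Longrightarrow> \<phi> (\<alpha> *s \<zeta>) = \<alpha> powi j * \<phi> \<zeta>"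
  shows "cmod (mu_integral \<phi>) \<le> 2 ^ nat \<bar>j\<bar> * ((diagonal (sqrt (1/2)))\<^sup>2 * total_mass) * (\<integral>\<zeta>. cmod (\<phi> \<zeta>) \<partial>\<beta>)"
  by (rule tendsto_upperbound[OF tendsto_norm[OF weak_limit[OF \<phi>]]])
     (auto intro!: always_eventually weighted_integral_bound[OF \<phi> w radius_Suc_bounds])

lemma indicator_measurable: "K \<in> sets borel \<Longrightarrow> (indicator K :: _ \<Rightarrow> complex) \<in> borel_measurable \<beta>"
  by (intro measurable_\<beta>I borel_measurable_indicator)

text \<open>
  Cutting off does not change the weight, so \<open>weighted_mu_integral_bound\<close> applies to \<open>f\<close> times a cutoff
  with one and the same constant. As the cutoffs decrease to the indicator of \<open>K\<close>, the right-hand side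
  tends to the integral of \<open>cmod \<circ> f\<close> over the \<open>\<beta>\<close>-null set \<open>K\<close>.
\<close>

lemma null_compact_homogeneous:
  assumes K: "compact K" "K \<subseteq> B" "circle_invariant K" "emeasure \<beta> K = 0"
    and f: "continuous_on UNIV f" "circle_weight j f"
  shows "mu_integral (\<lambda>\<zeta>. indicator K \<zeta> * f \<zeta>) = 0"
proof (cases "K = {}")
  case True
  then show ?thesis by (simp add: mu_integral_def)
next
  case False
  have closed: "closed K" using K(1) by (rule compact_imp_closed)
  have fB: "continuous_on B f" by (rule continuous_on_subset[OF f(1)]) simp
  obtain M where M: "M \<ge> 0" "\<And>\<zeta>. \<zeta> \<in> B \<Longrightarrow> cmod (f \<zeta>) \<le> M" using bounded_on_B[OF fB] by blast
  let ?f = "\<lambda>n \<zeta>. complex_of_real (cutoff K n \<zeta>) * f \<zeta>"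
  let ?C = "2 ^ nat \<bar>j\<bar> * ((diagonal (sqrt (1/2)))\<^sup>2 * total_mass)"
  have cont: "continuous_on B (?f n)" for n by (intro continuous_intros fB)
  have Mf: "cmod (?f n \<zeta>) \<le> M" if "\<zeta> \<in> B" for n \<zeta>
    unfolding norm_mult using cutoff_bounds[of K n \<zeta>] M(2)[OF that] by (simp add: mult_le_one order_trans[OF mult_left_le_one_le])
  have lim: "(\<lambda>n. ?f n \<zeta>) \<longlonglongrightarrow> indicator K \<zeta> * f \<zeta>" for \<zeta>
  proof -
    have "(\<lambda>n. complex_of_real (cutoff K n \<zeta>)) \<longlonglongrightarrow> complex_of_real (indicator K \<zeta>)"
      by (intro tendsto_of_real cutoff_tendsto closed False)
    then show ?thesis by (intro tendsto_mult tendsto_const) (simp add: indicator_def of_bool_def split: if_splits)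
  qed
  have Kb: "K \<in> sets borel" using closed by auto
  have lhs: "(\<lambda>n. mu_integral (?f n)) \<longlonglongrightarrow> mu_integral (\<lambda>\<zeta>. indicator K \<zeta> * f \<zeta>)"
    by (rule mu_integral_dominated_convergence[OF continuous_imp_measurable_\<beta>[OF cont]
          borel_measurable_times[OF indicator_measurable[OF Kb] continuous_imp_measurable_\<beta>[OF fB]] Mf lim])
  have bound: "cmod (mu_integral (?f n)) \<le> ?C * (\<integral>\<zeta>. cmod (?f n \<zeta>) \<partial>\<beta>)" for n
    by (rule weighted_mu_integral_bound[OF cont])
       (use f(2) infdist_rotate[OF K(3)] in \<open>simp add: circle_weight_def cutoff_def\<close>)
  have "(\<lambda>n. \<integral>\<zeta>. cmod (?f n \<zeta>) \<partial>\<beta>) \<longlonglongrightarrow> (\<integral>\<zeta>. cmod (indicator K \<zeta> * f \<zeta>) \<partial>\<beta>)"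
  proof (rule integral_dominated_convergence[where w = "\<lambda>_. M"])
    show "(\<lambda>\<zeta>. cmod (indicator K \<zeta> * f \<zeta>)) \<in> borel_measurable \<beta>"
      by (rule measurable_compose[OF borel_measurable_times[OF indicator_measurable[OF Kb] continuous_imp_measurable_\<beta>[OF fB]] borel_measurable_norm])
    show "(\<lambda>\<zeta>. cmod (?f n \<zeta>)) \<in> borel_measurable \<beta>" for n
      by (rule measurable_compose[OF continuous_imp_measurable_\<beta>[OF cont] borel_measurable_norm])
  qed (use Mf lim in \<open>auto simp: space_\<beta> intro!: tendsto_norm\<close>)
  moreover have "(\<integral>\<zeta>. cmod (indicator K \<zeta> * f \<zeta>) \<partial>\<beta>) = 0"
  proof (rule integral_eq_zero_AE)
    have "K \<in> null_sets \<beta>"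
      using K(2,4) sets_borel_on_Int[OF Kb, of B] by (auto simp: null_sets_def sets_\<beta> Int_absorb1)
    then have "AE \<zeta> in \<beta>. \<zeta> \<notin> K" by (rule AE_not_in)
    then show "AE \<zeta> in \<beta>. cmod (indicator K \<zeta> * f \<zeta>) = 0" by eventually_elim simp
  qed
  ultimately have "(\<lambda>n. ?C * (\<integral>\<zeta>. cmod (?f n \<zeta>) \<partial>\<beta>)) \<longlonglongrightarrow> ?C * 0" by (intro tendsto_mult_left) simp
  then have "cmod (mu_integral (\<lambda>\<zeta>. indicator K \<zeta> * f \<zeta>)) \<le> ?C * 0"
    by (rule tendsto_le[OF sequentially_bot _ tendsto_norm[OF lhs]]) (simp add: bound)
  then show ?thesis by simp
qed

lemma indicator_mult_bounded:
  assumes K: "closed K" and f: "continuous_on B f"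
  obtains M where "(\<lambda>\<zeta>. indicator K \<zeta> * f \<zeta> :: complex) \<in> borel_measurable \<beta>" "\<And>\<zeta>. \<zeta> \<in> B \<Longrightarrow> cmod (indicator K \<zeta> * f \<zeta>) \<le> M"
proof -
  obtain M where M: "M \<ge> 0" "\<And>\<zeta>. \<zeta> \<in> B \<Longrightarrow> cmod (f \<zeta>) \<le> M" using bounded_on_B[OF f] by blast
  show thesis
  proof (rule that[of M])
    show "(\<lambda>\<zeta>. indicator K \<zeta> * f \<zeta>) \<in> borel_measurable \<beta>"
      by (rule borel_measurable_times[OF indicator_measurable[OF borel_closed[OF K]] continuous_imp_measurable_\<beta>[OF f]])
    show "cmod (indicator K \<zeta> * f \<zeta>) \<le> M" if "\<zeta> \<in> B" for \<zeta>
      using M(1) M(2)[OF that] by (simp add: indicator_def)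
  qed
qed

lemma null_compact_circle_polynomial:
  assumes K: "compact K" "K \<subseteq> B" "circle_invariant K" "emeasure \<beta> K = 0" and f: "circle_polynomial f"
  shows "mu_integral (\<lambda>\<zeta>. indicator K \<zeta> * f \<zeta>) = 0"
  using f
proof (induction rule: circle_polynomial.induct)
  case (homogeneous f j)
  then show ?case by (rule null_compact_homogeneous[OF K])
next
  case (sum f g)
  have c: "continuous_on B f" "continuous_on B g"
    by (rule continuous_on_subset[OF circle_polynomial_continuous], use sum in simp_all)+
  have closed: "closed K" using K(1) by (rule compact_imp_closed)
  obtain M where M: "(\<lambda>\<zeta>. indicator K \<zeta> * f \<zeta>) \<in> borel_measurable \<beta>" "\<And>\<zeta>. \<zeta> \<in> B \<Longrightarrow> cmod (indicator K \<zeta> * f \<zeta>) \<le> M"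
    using indicator_mult_bounded[OF closed c(1)] by blast
  obtain M' where M': "(\<lambda>\<zeta>. indicator K \<zeta> * g \<zeta>) \<in> borel_measurable \<beta>" "\<And>\<zeta>. \<zeta> \<in> B \<Longrightarrow> cmod (indicator K \<zeta> * g \<zeta>) \<le> M'"
    using indicator_mult_bounded[OF closed c(2)] by blast
  show ?case using mu_integral_add[OF M M'] sum by (simp add: distrib_left)
qed

text \<open>
  Stone-Weierstrass: real polynomials are circle polynomials.
\<close>

lemma null_compact_continuous:
  assumes K: "compact K" "K \<subseteq> B" "circle_invariant K" "emeasure \<beta> K = 0" and g: "continuous_on B (g :: _ \<Rightarrow> real)"
  shows "mu_integral (\<lambda>\<zeta>. indicator K \<zeta> * complex_of_real (g \<zeta>)) = 0"
proof -
  have closed: "closed K" using K(1) by (rule compact_imp_closed)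
  have "cmod (mu_integral (\<lambda>\<zeta>. indicator K \<zeta> * complex_of_real (g \<zeta>))) \<le> 0 + e" if e: "e > 0" for e
  proof -
    define d where "d = e / (total_mass + 1)"
    have d: "d > 0" using e total_mass_nonneg by (simp add: d_def add_nonneg_pos)
    obtain p where p: "real_polynomial_function p" "\<And>\<zeta>. \<zeta> \<in> B \<Longrightarrow> \<bar>g \<zeta> - p \<zeta>\<bar> < d"
      using Stone_Weierstrass_real_polynomial_function[OF compact_B g d] by blast
    have pc: "circle_polynomial (\<lambda>z. complex_of_real (p z))" by (rule real_polynomial_circle_polynomial[OF p(1)])
    have cp: "continuous_on B (\<lambda>z. complex_of_real (p z))"
      by (rule continuous_on_subset[OF circle_polynomial_continuous[OF pc]]) simp
    have cg: "continuous_on B (\<lambda>z. complex_of_real (g z))" by (intro continuous_intros g)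
    obtain M where M: "(\<lambda>\<zeta>. indicator K \<zeta> * complex_of_real (g \<zeta>)) \<in> borel_measurable \<beta>" "\<And>\<zeta>. \<zeta> \<in> B \<Longrightarrow> cmod (indicator K \<zeta> * complex_of_real (g \<zeta>)) \<le> M"
      using indicator_mult_bounded[OF closed cg] by blast
    obtain M' where M': "(\<lambda>\<zeta>. indicator K \<zeta> * complex_of_real (p \<zeta>)) \<in> borel_measurable \<beta>" "\<And>\<zeta>. \<zeta> \<in> B \<Longrightarrow> cmod (indicator K \<zeta> * complex_of_real (p \<zeta>)) \<le> M'"
      using indicator_mult_bounded[OF closed cp] by blast
    have "mu_integral (\<lambda>\<zeta>. indicator K \<zeta> * complex_of_real (g \<zeta>)) = mu_integral (\<lambda>\<zeta>. indicator K \<zeta> * complex_of_real (g \<zeta>) - indicator K \<zeta> * complex_of_real (p \<zeta>))"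
      using mu_integral_diff[OF M M'] null_compact_circle_polynomial[OF K pc] by simp
    also have "cmod \<dots> \<le> d * total_mass"
    proof (rule mu_integral_bound)
      fix \<zeta> assume \<zeta>: "\<zeta> \<in> B"
      have "cmod (complex_of_real (g \<zeta>) - complex_of_real (p \<zeta>)) \<le> d"
        using p(2)[OF \<zeta>] by (simp flip: of_real_diff)
      then show "cmod (indicator K \<zeta> * complex_of_real (g \<zeta>) - indicator K \<zeta> * complex_of_real (p \<zeta>)) \<le> d"
        using d by (simp add: indicator_def)
    qed (rule borel_measurable_diff[OF M(1) M'(1)])
    also have "\<dots> \<le> e" using e total_mass_nonneg by (simp add: d_def field_simps)
    finally show ?thesis by simp
  qed
  then have "cmod (mu_integral (\<lambda>\<zeta>. indicator K \<zeta> * complex_of_real (g \<zeta>))) \<le> 0" by (rule field_le_epsilon)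
  then show ?thesis by simp
qed

lemma complex_measure_eq_parts:
  assumes "A \<in> sets (borel_on B)" shows "\<mu> A = (\<Sum>k<4. \<i> ^ k * measure (jordan_part k) A)"
  unfolding jordan_part_def by (rule complex_measure_eq_sum[OF complex_measure_\<mu> assms])

lemma null_compact_subset:
  assumes K: "compact K" "K \<subseteq> B" "circle_invariant K" "emeasure \<beta> K = 0" and Q: "compact Q" "Q \<subseteq> K"
  shows "\<mu> Q = 0"
proof (cases "Q = {}")
  case True
  then show ?thesis using complex_measure_\<mu> by (simp add: complex_measure_def)
next
  case False
  have cl: "closed K" "closed Q" using K(1) Q(1) by (auto intro: compact_imp_closed)
  let ?f = "\<lambda>n \<zeta>. indicator K \<zeta> * complex_of_real (cutoff Q n \<zeta>)"
  have zero: "mu_integral (?f n) = 0" for n by (rule null_compact_continuous[OF K]) (intro continuous_intros)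
  have "(\<lambda>n. mu_integral (?f n)) \<longlonglongrightarrow> mu_integral (indicator Q)"
  proof (rule mu_integral_dominated_convergence)
    show "?f n \<in> borel_measurable \<beta>" for n
      using cl by (intro borel_measurable_times indicator_measurable continuous_imp_measurable_\<beta> continuous_intros) auto
    show "(indicator Q :: _ \<Rightarrow> complex) \<in> borel_measurable \<beta>" by (rule indicator_measurable[OF borel_closed[OF cl(2)]])
    show "cmod (?f n \<zeta>) \<le> 1" for n \<zeta>
      using cutoff_bounds[of Q n \<zeta>] by (simp add: norm_mult indicator_def)
    fix \<zeta>
    have "(\<lambda>n. ?f n \<zeta>) \<longlonglongrightarrow> indicator K \<zeta> * complex_of_real (indicator Q \<zeta>)"
      by (intro tendsto_mult tendsto_const tendsto_of_real cutoff_tendsto cl False)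
    moreover have "indicator K \<zeta> * complex_of_real (indicator Q \<zeta>) = indicator Q \<zeta>"
      using Q(2) by (auto simp: indicator_def)
    ultimately show "(\<lambda>n. ?f n \<zeta>) \<longlonglongrightarrow> indicator Q \<zeta>" by simp
  qed
  then have "mu_integral (indicator Q) = 0" using LIMSEQ_unique[OF _ tendsto_const[of 0]] by (simp add: zero)
  moreover have QB: "Q \<in> sets (borel_on B)"
    using sets_borel_on_Int[of Q B] cl(2) Q(2) K(2) by (simp add: Int_absorb1 subset_trans)
  have "mu_integral (indicator Q) = \<mu> Q"
  proof -
    have "integral\<^sup>L (jordan_part k) (indicator Q) = complex_of_real (measure (jordan_part k) Q)" for k
    proof -
      interpret finite_measure "jordan_part k" by (rule finite_part)
      have "integral\<^sup>L (jordan_part k) (indicator Q) = (\<integral>\<zeta>. complex_of_real (indicator Q \<zeta>) \<partial>jordan_part k)"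
        by (intro Bochner_Integration.integral_cong refl) (simp add: indicator_def)
      then show ?thesis using QB by (simp add: sets_part space_part Int_absorb2 subset_trans[OF Q(2) K(2)])
    qed
    then show ?thesis unfolding mu_integral_def complex_measure_eq_parts[OF QB] by simp
  qed
  ultimately show ?thesis by simp
qed

text \<open>
  Inner regularity of finite Borel measures on the whole space, applied to the image of the measure
  under the inclusion of \<open>B\<close>.
\<close>

lemma part_inner_regular:
  assumes A: "A \<in> sets (borel_on B)" and e: "e > 0"
  shows "\<exists>Q. compact Q \<and> Q \<subseteq> A \<and> measure (jordan_part k) (A - Q) < e"
proof -
  interpret finite_measure "jordan_part k" by (rule finite_part)
  have idm: "(\<lambda>x. x) \<in> measurable (jordan_part k) borel"
  proof -
    have "(\<lambda>x. x) \<in> borel_measurable (borel_on B)" unfolding borel_on_def by (rule measurable_restrict_space1) simp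
    then show ?thesis using measurable_cong_sets[OF sets_part refl] by blast
  qed
  define M where "M = distr (jordan_part k) borel (\<lambda>x. x)"
  have Ab: "A \<in> sets borel" "A \<subseteq> B"
    using A closed_B by (auto simp: borel_on_def sets_restrict_space)
  have MA: "emeasure M X = emeasure (jordan_part k) X" if "X \<in> sets borel" "X \<subseteq> B" for X
    unfolding M_def using emeasure_distr[OF idm that(1)] that(2) by (simp add: space_part Int_absorb2)
  have fin: "emeasure M (space M) \<noteq> \<infinity>"
    unfolding M_def by (simp add: emeasure_distr[OF idm] space_part emeasure_eq_measure)
  have "emeasure M A = (SUP Q\<in>{Q. Q \<subseteq> A \<and> compact Q}. emeasure M Q)"
    by (rule inner_regular) (use fin Ab in \<open>auto simp: M_def\<close>)
  then have eq: "emeasure (jordan_part k) A = (SUP Q\<in>{Q. Q \<subseteq> A \<and> compact Q}. emeasure M Q)" using MA[OF Ab] by simp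
  show ?thesis
  proof (cases "emeasure (jordan_part k) A = 0")
    case True
    then show ?thesis using e by (intro exI[of _ "{}"]) (simp add: measure_def)
  next
    case False
    then have "ennreal (measure (jordan_part k) A - e) < emeasure (jordan_part k) A"
      unfolding emeasure_eq_measure using e by (intro ennreal_lessI) (simp_all add: zero_less_measure_iff)
    then obtain Q where Q: "Q \<subseteq> A" "compact Q" "ennreal (measure (jordan_part k) A - e) < emeasure M Q"
      unfolding eq less_SUP_iff by blast
    have Qb: "Q \<in> sets borel" "Q \<subseteq> B" using Q Ab by (auto intro: borel_closed compact_imp_closed)
    have Qs: "Q \<in> sets (jordan_part k)"
      using sets_borel_on_Int[OF Qb(1), of B] Qb(2) by (simp add: sets_part Int_absorb1)
    have "measure (jordan_part k) A - e < measure (jordan_part k) Q"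
    proof (rule ccontr)
      assume "\<not> measure (jordan_part k) A - e < measure (jordan_part k) Q"
      then have "ennreal (measure (jordan_part k) Q) \<le> ennreal (measure (jordan_part k) A - e)" by (intro ennreal_leI) simp
      with Q(3) show False unfolding MA[OF Qb] emeasure_eq_measure by simp
    qed
    then have "measure (jordan_part k) (A - Q) < e"
      using finite_measure_Diff[of A Q] A Q(1) Qs by (simp add: sets_part)
    then show ?thesis using Q by blast
  qed
qed

text \<open>
  A compact subset \<open>Q\<close> of \<open>P\<close> that exhausts \<open>P\<close> up to small mass for all four parts is swept by the circle
  into a compact invariant subset of \<open>G\<close>, to which \<open>null_compact_subset\<close> applies.
\<close>

lemma invariant_null_imp_measure_zero:
  assumes G: "G \<in> sets \<beta>" "circle_invariant G" "emeasure \<beta> G = 0" and P: "P \<in> sets (borel_on B)" "P \<subseteq> G"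
  shows "\<mu> P = 0"
proof -
  have "cmod (\<mu> P) \<le> 0 + e" if e: "e > 0" for e
  proof -
    have "\<forall>k. \<exists>Q. compact Q \<and> Q \<subseteq> P \<and> measure (jordan_part k) (P - Q) < e / 4"
      by (intro allI part_inner_regular[OF P(1)]) (use e in simp)
    from choice[OF this] obtain Q' where "\<forall>k. compact (Q' k) \<and> Q' k \<subseteq> P \<and> measure (jordan_part k) (P - Q' k) < e / 4" ..
    then have Q': "compact (Q' k)" "Q' k \<subseteq> P" "measure (jordan_part k) (P - Q' k) < e / 4" for k by simp_all
    define Q where "Q = (\<Union>k<4::nat. Q' k)"
    have Q: "compact Q" "Q \<subseteq> P" unfolding Q_def by (intro compact_UN Q'(1)) (auto dest: subsetD[OF Q'(2)])
    have PB: "P \<subseteq> B" using P(1) by (auto simp: borel_on_def sets_restrict_space)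
    have cs: "X \<in> sets (borel_on B)" if "compact X" "X \<subseteq> B" for X
      using sets_borel_on_Int[of X B] that by (simp add: Int_absorb1 borel_closed compact_imp_closed)
    define K where "K = (\<lambda>p. fst p *s snd p) ` (sphere 0 1 \<times> Q)"
    have K1: "compact K" unfolding K_def
      by (intro compact_continuous_image continuous_intros compact_Times compact_sphere Q)
    have KG: "K \<subseteq> G" using G(2) Q(2) P(2) by (auto simp: K_def circle_invariant_def)
    have GB: "G \<subseteq> B" using G(1) by (auto simp: sets_\<beta> borel_on_def sets_restrict_space)
    have K2: "circle_invariant K"
      unfolding circle_invariant_def
    proof (intro ballI allI impI)
      fix z \<alpha> assume "z \<in> K" "cmod \<alpha> = 1"
      then obtain \<gamma> q where "cmod \<gamma> = 1" "q \<in> Q" "z = \<gamma> *s q" by (auto simp: K_def)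
      then show "\<alpha> *s z \<in> K" unfolding K_def using \<open>cmod \<alpha> = 1\<close>
        by (intro image_eqI[of _ _ "(\<alpha> * \<gamma>, q)"]) (auto simp: vector_smult_assoc norm_mult)
    qed
    have K3: "emeasure \<beta> K = 0" using emeasure_mono[OF KG G(1)] G(3) by simp
    have QK: "Q \<subseteq> K"
    proof
      fix q assume "q \<in> Q"
      then show "q \<in> K" unfolding K_def by (intro image_eqI[of _ _ "(1, q)"]) auto
    qed
    have "\<mu> Q = 0" by (rule null_compact_subset[OF K1 subset_trans[OF KG GB] K2 K3 Q(1) QK])
    have Qs: "Q \<in> sets (borel_on B)" by (rule cs[OF Q(1) subset_trans[OF Q(2) PB]])
    have m: "measure (jordan_part k) P - measure (jordan_part k) Q \<le> e / 4 \<and> 0 \<le> measure (jordan_part k) P - measure (jordan_part k) Q" if "k < 4" for k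
    proof -
      interpret finite_measure "jordan_part k" by (rule finite_part)
      have "measure (jordan_part k) P - measure (jordan_part k) Q = measure (jordan_part k) (P - Q)"
        using finite_measure_Diff[of P Q] P(1) Qs Q(2) by (simp add: sets_part)
      also have "\<dots> \<le> measure (jordan_part k) (P - Q' k)"
        using that P(1) cs[OF Q'(1) subset_trans[OF Q'(2) PB]] by (intro finite_measure_mono) (auto simp: Q_def sets_part)
      also have "\<dots> \<le> e / 4" using Q'(3) by (simp add: less_imp_le)
      finally show ?thesis using \<open>measure (jordan_part k) P - measure (jordan_part k) Q = measure (jordan_part k) (P - Q)\<close> by simp
    qed
    have "\<mu> P = \<mu> P - \<mu> Q" using \<open>\<mu> Q = 0\<close> by simp
    also have "\<dots> = (\<Sum>k<4. \<i> ^ k * of_real (measure (jordan_part k) P - measure (jordan_part k) Q))"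
      unfolding complex_measure_eq_parts[OF P(1)] complex_measure_eq_parts[OF Qs]
      by (simp add: sum_subtractf right_diff_distrib)
    also have "cmod \<dots> \<le> (\<Sum>k<4::nat. e / 4)"
    proof (intro order_trans[OF norm_sum] sum_mono)
      fix k :: nat assume "k \<in> {..<4}"
      then have "\<bar>measure (jordan_part k) P - measure (jordan_part k) Q\<bar> \<le> e / 4" using m[of k] by simp
      then show "cmod (\<i> ^ k * of_real (measure (jordan_part k) P - measure (jordan_part k) Q)) \<le> e / 4"
        unfolding norm_mult norm_power norm_of_real by simp
    qed
    finally show ?thesis by simp
  qed
  then have "cmod (\<mu> P) \<le> 0" by (rule field_le_epsilon)
  then show ?thesis by simp
qed

lemma invariant_null_imp_negligible:
  assumes G: "G \<in> sets \<beta>" "circle_invariant G" "emeasure \<beta> G = 0" and E: "E \<subseteq> G"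
  shows "negligible_wrt (borel_on B) \<mu> E"
proof -
  have "total_variation (borel_on B) \<mu> G \<le> 0"
    unfolding total_variation_def
  proof (rule SUP_least)
    fix P :: "nat \<Rightarrow> (complex^'n) set"
    assume P: "P \<in> {P. range P \<subseteq> sets (borel_on B) \<and> disjoint_family P \<and> (\<Union>i. P i) = G}"
    have "\<mu> (P i) = 0" for i by (rule invariant_null_imp_measure_zero[OF G]) (use P in auto)
    then show "(\<Sum>i. ennreal (cmod (\<mu> (P i)))) \<le> 0" by simp
  qed
  then have "total_variation (borel_on B) \<mu> G = 0" by simp
  then show ?thesis unfolding negligible_wrt_def using G(1) E unfolding sets_\<beta> by (intro bexI[of _ G] conjI)
qed

end

theorem corollary3p3:
  fixes D B :: "(complex^'n) set"
    and \<beta> :: "(complex^'n) measure"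
    and C :: "complex^'n \<Rightarrow> complex^'n \<Rightarrow> complex"
    and \<mu> :: "(complex^'n) set \<Rightarrow> complex"
    and m :: nat
  assumes "bounded_symmetric_domain D" and "convex D" and "circular D"
    and "is_silov_boundary D B"
    and "real_analytic_submanifold m B"
    and "linear_automorphisms D \<subseteq> unitary_maps"
    and "\<And>\<zeta>. \<zeta> \<in> B \<Longrightarrow> (\<lambda>T. T \<zeta>) ` linear_automorphisms D = B"
    and "B \<subseteq> sphere 0 1"
    and "is_unique_invariant_probability D B \<beta>"
    and "is_reproducing_kernel D \<beta> C"
    and "pluriharmonic_measure D B C \<mu>"
  shows "\<forall>E. E \<subseteq> B \<and> hausdorff_measure (m - 1) E = 0 \<longrightarrow> negligible_wrt (borel_on B) \<mu> E"
proof (intro allI impI)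
  fix E assume E: "E \<subseteq> B \<and> hausdorff_measure (m - 1) E = 0"
  have D: "open D" "D \<noteq> {}" using assms(1) by (simp_all add: bounded_symmetric_domain_def)
  have B: "closed B" "B \<subseteq> frontier D" using assms(4) by (simp_all add: is_silov_boundary_def)
  have inv: "is_invariant_probability D B \<beta>" using assms(9) by (simp add: is_unique_invariant_probability_def)
  interpret circular_domain D B \<beta> C
    by (rule circular_domain.intro) (rule D B inv assms | assumption)+
  interpret circular_domain_measure D B \<beta> C \<mu>
    using assms(11) by unfold_locales (simp add: pluriharmonic_measure_def)
  interpret pluriharmonic_domain_measure D B \<beta> C \<mu>
    using assms(11) by unfold_locales (simp add: pluriharmonic_measure_def poisson_def)
  obtain p where p: "p \<in> B" using nonempty_B by blast
  have hom: "measure \<beta> (B \<inter> ball \<zeta> r) = measure \<beta> (B \<inter> ball p r)" if "\<zeta> \<in> B" for \<zeta> r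
    by (rule measure_ball_homogeneous[OF that p])
  obtain c where "c > 0 \<and> (\<forall>\<zeta>\<in>B. \<forall>r>0. measure \<beta> (B \<inter> ball \<zeta> r) \<le> c * r ^ m)"
    by (rule homogeneous_ball_mass_bound[OF sets_\<beta> emeasure_space_\<beta> assms(5) p hom], assumption, rule that) blast
  then have c: "c > 0" and ball: "measure \<beta> (B \<inter> ball \<zeta> r) \<le> c * r ^ m" if "\<zeta> \<in> B" "r > 0" for \<zeta> r
    using that by simp_all
  obtain G where "G \<in> sets \<beta>" "E \<subseteq> G" "circle_invariant G" "emeasure \<beta> G = 0"
    by (rule hausdorff_null_imp_invariant_null[OF sets_\<beta> emeasure_space_\<beta> B_sphere circle_invariant_B c[OF p zero_less_one] ball E[THEN conjunct1] E[THEN conjunct2]])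
  then show "negligible_wrt (borel_on B) \<mu> E" by (intro invariant_null_imp_negligible)
qed

end
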